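(* Let $L$ be a Lagrangian surface in a symplectic 4-manifold $(W,\omega)$ and $D$ a Lagrangian attaching disk of $L$. Let $\eta_D(L)$ be obtained from $L$ by performing the $la$-disk surgery on $L$ via $D$. Then $\eta_D(L)$ is a Lagrangian surface smoothly isotopic to $L$.
   Context: A Lagrangian attaching disk ($la$-disk) of a closed immersed Lagrangian surface $L$ is a closed embedded Lagrangian disk $D\subset W$ with $\partial D=D\cap L=:C$ and $T_CL\cap T_CD=TC$. Surgery. Let $\mathcal G=\{g_\theta=\begin{pmatrix}\cos\theta&-\sin\theta\\ \sin\theta&\cos\theta\end{pmatrix}\mid\theta\in\mathbb R/2\pi\mathbb Z\}$ act on $\mathbb C^2\cong\mathbb R^4$ with complex coordinates $x_j+iy_j$ and $\omega=\sum_{j=1}^2dx_j\wedge dy_j$; $Orb_{\mathcal G}(\gamma)$ is the $\mathcal G$-orbit of $\gamma$. A neighborhood of $D$ in $W$ can be symplectically identified with a domain in $\mathbb R^4$ containing the closed ball $B_r$ of some radius $r>0$ about $0$ so that $D=\{x_1^2+x_2^2\le(\sqrt2-1)^2r^2,\ y_1=y_2=0\}$ and $L\cap B_r=Orb_{\mathcal G}(\gamma)$, where $\gamma(s)=(x_1=\sqrt2r+r\cos s,\ y_1=r\sin s)$, $s$ between $\frac{3\pi}{4}$ and $\frac{5\pi}{4}$, is a curve in the $x_1y_1$-plane. Let $M$ be the linear map of $\mathbb R^4$ exchanging $x_j$ and $y_j$ ($j=1,2$). Then $\eta_D(L):=(L\setminus Orb_{\mathcal G}(\gamma))\cup Orb_{\mathcal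 G}(M(\gamma))$; the annuli $Orb_{\mathcal G}(\gamma)$ and $Orb_{\mathcal G}(M(\gamma))$ are tangent along their common boundary. Two surfaces are smoothly isotopic if they belong to a smooth 1-parameter family $L_t\subset W$, $t\in[0,1]$, of submanifolds (immersed if $L$ is immersed) all diffeomorphic to $L$, with $L_0=L$ and $L_1=\eta_D(L)$.
   Formalization: The literal surgered surface has a curvature jump along the common boundary of the two annuli, so it is never C^2 there; it is shown to be a C^1 Lagrangian surface, smooth off that boundary, and the isotopy is C^1, and smooth except at time 1 on that boundary. *)

theory Defs
  imports "HOL-Analysis.Analysis" "HOL-Library.Extended_Nat"
begin

section \<open>Smoothness in Euclidean space\<close>

text \<open>Here \<open>U\<close> is meant to be open.\<close>

primrec higher_diff ::
  "nat \<Rightarrow> 'a::euclidean_space set \<Rightarrow> ('a \<Rightarrow> 'b::euclidean_space) \<Rightarrow> bool" where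
  "higher_diff 0 U f \<longleftrightarrow> continuous_on U f"
| "higher_diff (Suc n) U f \<longleftrightarrow>
     (\<forall>x\<in>U. f differentiable (at x)) \<and>
     (\<forall>v. higher_diff n U (\<lambda>x. frechet_derivative f (at x) v))"

text \<open>\<open>C\<^sup>k\<close> on an arbitrary set (needed for closed disks and for families over \<open>[0,1]\<close>):
  locally the restriction of a \<open>C\<^sup>k\<close> map on an open set.\<close>

definition ck_euc ::
  "enat \<Rightarrow> 'a::euclidean_space set \<Rightarrow> ('a \<Rightarrow> 'b::euclidean_space) \<Rightarrow> bool" where
  "ck_euc k S f \<longleftrightarrow>
     (\<forall>x\<in>S. \<exists>U g. open U \<and> x \<in> U \<and> (\<forall>n. enat n \<le> k \<longrightarrow> higher_diff n U g) \<and>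
        (\<forall>y\<in>S \<inter> U. g y = f y))"


section \<open>Manifolds\<close>

text \<open>A chart is a pair of its domain and the coordinate map, of which only the values on the
  domain matter; the model space \<open>'e\<close> fixes the dimension. The atlas need not be maximal.\<close>

type_synonym ('a, 'e) chart = "'a set \<times> ('a \<Rightarrow> 'e)"

record ('a, 'e) manifold =
  mtop :: "'a topology"
  atlas :: "('a, 'e) chart set"

abbreviation mpoints :: "('a, 'e) manifold \<Rightarrow> 'a set" where
  "mpoints M \<equiv> topspace (mtop M)"

definition chart_inv :: "('a, 'e) chart \<Rightarrow> 'e \<Rightarrow> 'a" where
  "chart_inv c = inv_into (fst c) (snd c)"

text \<open>The coordinate expression of \<open>f\<close>, restricted to \<open>S\<close>, in the charts \<open>c\<close> and \<open>d\<close>.\<close>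

definition loc_rep :: "('a, 'e) chart \<Rightarrow> ('b, 'f) chart \<Rightarrow> ('a \<Rightarrow> 'b) \<Rightarrow> 'e \<Rightarrow> 'f" where
  "loc_rep c d f = snd d \<circ> f \<circ> chart_inv c"

definition loc_dom ::
  "('a, 'e) chart \<Rightarrow> ('b, 'f) chart \<Rightarrow> 'a set \<Rightarrow> ('a \<Rightarrow> 'b) \<Rightarrow> 'e set" where
  "loc_dom c d S f = snd c ` (S \<inter> fst c \<inter> f -` fst d)"

definition smooth_manifold :: "('a, 'e::euclidean_space) manifold \<Rightarrow> bool" where
  "smooth_manifold M \<longleftrightarrow>
     Hausdorff_space (mtop M) \<and> second_countable (mtop M) \<and>
     (\<Union>c\<in>atlas M. fst c) = mpoints M \<and>
     (\<forall>c\<in>atlas M. openin (mtop M) (fst c) \<and> open (snd c ` fst c) \<and>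
        homeomorphic_map (subtopology (mtop M) (fst c)) (top_of_set (snd c ` fst c)) (snd c)) \<and>
     (\<forall>c\<in>atlas M. \<forall>d\<in>atlas M. ck_euc \<infinity> (snd c ` (fst c \<inter> fst d)) (snd d \<circ> chart_inv c))"

definition eucl_mfd :: "('e::euclidean_space, 'e) manifold" where
  "eucl_mfd = \<lparr>mtop = euclidean, atlas = {(UNIV, id)}\<rparr>"

definition prod_mfd ::
  "('a, 'e) manifold \<Rightarrow> ('b, 'f) manifold \<Rightarrow> ('a \<times> 'b, 'e \<times> 'f) manifold" where
  "prod_mfd M N = \<lparr>mtop = prod_topology (mtop M) (mtop N),
     atlas = {(fst c \<times> fst d, map_prod (snd c) (snd d)) | c d. c \<in> atlas M \<and> d \<in> atlas N}\<rparr>"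

definition ck_on ::
  "enat \<Rightarrow> ('a, 'e::euclidean_space) manifold \<Rightarrow> ('b, 'f::euclidean_space) manifold \<Rightarrow>
    'a set \<Rightarrow> ('a \<Rightarrow> 'b) \<Rightarrow> bool" where
  "ck_on k M N S f \<longleftrightarrow>
     S \<subseteq> mpoints M \<and> continuous_map (subtopology (mtop M) S) (mtop N) f \<and>
     (\<forall>c\<in>atlas M. \<forall>d\<in>atlas N. ck_euc k (loc_dom c d S f) (loc_rep c d f))"

text \<open>The differential at \<open>p\<close> of \<open>f\<close> on \<open>S\<close>, in the charts \<open>c\<close> and \<open>d\<close>. The derivative is taken
  within the domain of the coordinate expression; it is only used when \<open>S\<close> is open or the closed
  unit disk, where it is uniquely determined.\<close>

definition diff_in ::
  "('a, 'e::euclidean_space) chart \<Rightarrow> ('b, 'f::euclidean_space) chart \<Rightarrow>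
    'a set \<Rightarrow> ('a \<Rightarrow> 'b) \<Rightarrow> 'a \<Rightarrow> 'e \<Rightarrow> 'f" where
  "diff_in c d S f p =
     frechet_derivative (loc_rep c d f) (at (snd c p) within loc_dom c d S f)"

definition immersive_on ::
  "('a, 'e::euclidean_space) manifold \<Rightarrow> ('b, 'f::euclidean_space) manifold \<Rightarrow>
    'a set \<Rightarrow> ('a \<Rightarrow> 'b) \<Rightarrow> bool" where
  "immersive_on M N S f \<longleftrightarrow>
     (\<forall>c\<in>atlas M. \<forall>d\<in>atlas N. \<forall>p\<in>S \<inter> fst c \<inter> f -` fst d. inj (diff_in c d S f p))"


section \<open>Symplectic 4-manifolds and Lagrangian surfaces\<close>

text \<open>\<open>\<real>\<^sup>4\<close> is \<open>complex \<times> complex\<close> with coordinates \<open>x\<^sub>j + i y\<^sub>j\<close>.\<close>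

type_synonym R2 = "real \<times> real"
type_synonym R4 = "complex \<times> complex"

definition omega0 :: "R4 \<Rightarrow> R4 \<Rightarrow> real" where
  "omega0 u v = (Re (fst u) * Im (fst v) - Im (fst u) * Re (fst v)) +
                (Re (snd u) * Im (snd v) - Im (snd u) * Re (snd v))"

text \<open>A 2-form is given by its coordinate expressions: \<open>\<omega> c p u v\<close> is the value at \<open>p\<close> on the
  tangent vectors whose coordinates in the chart \<open>c\<close> are \<open>u\<close> and \<open>v\<close>.\<close>

type_synonym ('a, 'e) two_form = "('a, 'e) chart \<Rightarrow> 'a \<Rightarrow> 'e \<Rightarrow> 'e \<Rightarrow> real"

definition smooth_two_form ::
  "('a, 'e::euclidean_space) manifold \<Rightarrow> ('a, 'e) two_form \<Rightarrow> bool" where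
  "smooth_two_form M \<omega> \<longleftrightarrow>
     (\<forall>c\<in>atlas M. \<forall>p\<in>fst c. bilinear (\<omega> c p) \<and> (\<forall>u. \<omega> c p u u = 0)) \<and>
     (\<forall>c\<in>atlas M. \<forall>d\<in>atlas M. \<forall>p\<in>fst c \<inter> fst d. \<forall>u v.
        \<omega> c p u v =
          \<omega> d p (diff_in c d (mpoints M) (\<lambda>q. q) p u) (diff_in c d (mpoints M) (\<lambda>q. q) p v)) \<and>
     (\<forall>c\<in>atlas M. \<forall>u v. ck_euc \<infinity> (snd c ` fst c) (\<lambda>x. \<omega> c (chart_inv c x) u v))"

text \<open>The exterior derivative, evaluated on constant coordinate vector fields.\<close>

definition ext_deriv ::
  "('a, 'e::euclidean_space) two_form \<Rightarrow> ('a, 'e) chart \<Rightarrow> 'a \<Rightarrow> 'e \<Rightarrow> 'e \<Rightarrow> 'e \<Rightarrow> real" where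
  "ext_deriv \<omega> c p u v w =
     frechet_derivative (\<lambda>x. \<omega> c (chart_inv c x) v w) (at (snd c p)) u +
     frechet_derivative (\<lambda>x. \<omega> c (chart_inv c x) w u) (at (snd c p)) v +
     frechet_derivative (\<lambda>x. \<omega> c (chart_inv c x) u v) (at (snd c p)) w"

definition symplectic_4_manifold :: "('w, R4) manifold \<Rightarrow> ('w, R4) two_form \<Rightarrow> bool" where
  "symplectic_4_manifold W \<omega> \<longleftrightarrow>
     smooth_manifold W \<and> smooth_two_form W \<omega> \<and>
     (\<forall>c\<in>atlas W. \<forall>p\<in>fst c.
        (\<forall>u v w. ext_deriv \<omega> c p u v w = 0) \<and> (\<forall>u. u \<noteq> 0 \<longrightarrow> (\<exists>v. \<omega> c p u v \<noteq> 0)))"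

definition isotropic_on ::
  "('a, R2) manifold \<Rightarrow> ('w, R4) manifold \<Rightarrow> ('w, R4) two_form \<Rightarrow> 'a set \<Rightarrow> ('a \<Rightarrow> 'w) \<Rightarrow> bool" where
  "isotropic_on M W \<omega> S f \<longleftrightarrow>
     (\<forall>c\<in>atlas M. \<forall>d\<in>atlas W. \<forall>p\<in>S \<inter> fst c \<inter> f -` fst d. \<forall>u v.
        \<omega> d (f p) (diff_in c d S f p u) (diff_in c d S f p v) = 0)"

text \<open>The closed immersed Lagrangian surface \<open>L\<close> is the image of a Lagrangian immersion of a
  compact surface without boundary.

  The set \<open>E\<close> is where \<open>f\<close> is only required to be \<open>C\<^sup>1\<close>; smooth surfaces are the case \<open>E = {}\<close>.
  The generality is forced by the surgery: the two annuli it exchanges have the same tangent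
  planes along their common boundary, but their profile curves have opposite curvatures
  \<open>\<plusminus>1/r\<close> there, so the surface obtained from a smooth \<open>L\<close> is \<open>C\<^sup>1\<close> but never \<open>C\<^sup>2\<close> along it.\<close>

definition lagrangian_surface ::
  "'s set \<Rightarrow> ('s, R2) manifold \<Rightarrow> ('w, R4) manifold \<Rightarrow> ('w, R4) two_form \<Rightarrow> ('s \<Rightarrow> 'w) \<Rightarrow> bool" where
  "lagrangian_surface E S W \<omega> f \<longleftrightarrow>
     smooth_manifold S \<and> compact_space (mtop S) \<and>
     ck_on 1 S W (mpoints S) f \<and> ck_on \<infinity> S W (mpoints S - E) f \<and>
     immersive_on S W (mpoints S) f \<and> isotropic_on S W \<omega> (mpoints S) f"

text \<open>\<open>F t\<close>, \<open>t \<in> [0,1]\<close>, is a family of immersions of \<open>S\<close>, of embeddings if \<open>f\<close> is one. It is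
  jointly \<open>C\<^sup>1\<close>, and jointly smooth away from \<open>E \<subseteq> [0,1] \<times> S\<close>; a smooth isotopy is the case
  \<open>E = {}\<close>.\<close>

definition smoothly_isotopic ::
  "(real \<times> 's) set \<Rightarrow> ('s, R2) manifold \<Rightarrow> ('w, R4) manifold \<Rightarrow> ('s \<Rightarrow> 'w) \<Rightarrow> ('s \<Rightarrow> 'w) \<Rightarrow> bool" where
  "smoothly_isotopic E S W f g \<longleftrightarrow>
     (\<exists>F :: real \<Rightarrow> 's \<Rightarrow> 'w.
        ck_on 1 (prod_mfd eucl_mfd S) W ({0..1} \<times> mpoints S) (\<lambda>(t, p). F t p) \<and>
        ck_on \<infinity> (prod_mfd eucl_mfd S) W ({0..1} \<times> mpoints S - E) (\<lambda>(t, p). F t p) \<and>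
        (\<forall>t\<in>{0..1}. immersive_on S W (mpoints S) (F t)) \<and>
        (embedding_map (mtop S) (mtop W) f \<longrightarrow>
           (\<forall>t\<in>{0..1}. embedding_map (mtop S) (mtop W) (F t))) \<and>
        (\<forall>p\<in>mpoints S. F 0 p = f p \<and> F 1 p = g p))"


section \<open>Attaching disks and surgery\<close>

text \<open>In the last condition \<open>{v. v \<bullet> q = 0}\<close> is the tangent line at \<open>q\<close> of the unit circle; since \<open>L\<close>
  is immersed, the condition is imposed on each of its branches through a point of \<open>C\<close>.\<close>

definition la_disk ::
  "('s, R2) manifold \<Rightarrow> ('w, R4) manifold \<Rightarrow> ('w, R4) two_form \<Rightarrow> ('s \<Rightarrow> 'w) \<Rightarrow> 'w set \<Rightarrow> bool" where
  "la_disk S W \<omega> \<iota> D \<longleftrightarrow>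
     (\<exists>\<delta> :: R2 \<Rightarrow> 'w.
        D = \<delta> ` cball 0 1 \<and> inj_on \<delta> (cball 0 1) \<and>
        ck_on \<infinity> eucl_mfd W (cball 0 1) \<delta> \<and> immersive_on eucl_mfd W (cball 0 1) \<delta> \<and>
        isotropic_on eucl_mfd W \<omega> (cball 0 1) \<delta> \<and>
        D \<inter> \<iota> ` mpoints S = \<delta> ` sphere 0 1 \<and>
        (\<forall>q\<in>sphere 0 1. \<forall>c\<in>atlas S. \<forall>d\<in>atlas W. \<forall>p\<in>fst c. \<iota> p = \<delta> q \<and> \<delta> q \<in> fst d \<longrightarrow>
           range (diff_in c d (mpoints S) \<iota> p) \<inter>
             range (diff_in (UNIV, id) d (cball 0 1) \<delta> q) =
           diff_in (UNIV, id) d (cball 0 1) \<delta> q ` {v. v \<bullet> q = 0}))"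

definition rot :: "real \<Rightarrow> R4 \<Rightarrow> R4" where
  "rot \<theta> z = (of_real (cos \<theta>) * fst z - of_real (sin \<theta>) * snd z,
              of_real (sin \<theta>) * fst z + of_real (cos \<theta>) * snd z)"

definition Orb :: "R4 set \<Rightarrow> R4 set" where
  "Orb X = (\<Union>\<theta>. rot \<theta> ` X)"

definition gamma :: "real \<Rightarrow> R4 set" where
  "gamma r = (\<lambda>s. (Complex (sqrt 2 * r + r * cos s) (r * sin s), 0)) ` {3 * pi / 4 .. 5 * pi / 4}"

definition swap_xy :: "R4 \<Rightarrow> R4" where
  "swap_xy z = (Complex (Im (fst z)) (Re (fst z)), Complex (Im (snd z)) (Re (snd z)))"

text \<open>\<open>\<Phi>\<close> is a symplectic identification of the open neighborhood \<open>U\<close> of \<open>D\<close> with a domain in \<open>\<real>\<^sup>4\<close>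
  in which \<open>D\<close> and \<open>L\<close> have the normal form that the surgery is defined by.\<close>

definition la_nbhd ::
  "('w, R4) manifold \<Rightarrow> ('w, R4) two_form \<Rightarrow> 'w set \<Rightarrow> 'w set \<Rightarrow>
    'w set \<Rightarrow> ('w \<Rightarrow> R4) \<Rightarrow> real \<Rightarrow> bool" where
  "la_nbhd W \<omega> L D U \<Phi> r \<longleftrightarrow>
     openin (mtop W) U \<and> D \<subseteq> U \<and> inj_on \<Phi> U \<and> open (\<Phi> ` U) \<and>
     ck_on \<infinity> W eucl_mfd U \<Phi> \<and> ck_on \<infinity> eucl_mfd W (\<Phi> ` U) (inv_into U \<Phi>) \<and>
     (\<forall>c\<in>atlas W. \<forall>p\<in>U \<inter> fst c. \<forall>u v.
        \<omega> c p u v = omega0 (diff_in c (UNIV, id) U \<Phi> p u) (diff_in c (UNIV, id) U \<Phi> p v)) \<and>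
     r > 0 \<and> cball 0 r \<subseteq> \<Phi> ` U \<and>
     \<Phi> ` D = {z. (Re (fst z))\<^sup>2 + (Re (snd z))\<^sup>2 \<le> (sqrt 2 - 1)\<^sup>2 * r\<^sup>2 \<and>
                 Im (fst z) = 0 \<and> Im (snd z) = 0} \<and>
     \<Phi> ` (L \<inter> U) \<inter> cball 0 r = Orb (gamma r)"

definition la_surgery :: "'w set \<Rightarrow> ('w \<Rightarrow> R4) \<Rightarrow> real \<Rightarrow> 'w set \<Rightarrow> 'w set" where
  "la_surgery U \<Phi> r L =
     (L - {p\<in>U. \<Phi> p \<in> Orb (gamma r)}) \<union> {p\<in>U. \<Phi> p \<in> Orb (swap_xy ` gamma r)}"

text \<open>The common boundary of the two annuli.\<close>

definition seam :: "'w set \<Rightarrow> ('w \<Rightarrow> R4) \<Rightarrow> real \<Rightarrow> 'w set" where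
  "seam U \<Phi> r = {p\<in>U. \<Phi> p \<in> Orb (gamma r) \<inter> Orb (swap_xy ` gamma r)}"

end

theory Submission
  imports Defs
begin

text \<open>The maps \<open>x + y\<close> and \<open>x - y\<close> identify \<open>\<real>\<^sup>4\<close> with \<open>\<complex>\<^sup>2\<close> so that \<open>\<G>\<close> acts by scalar multiplication by
  unit complex numbers, \<open>M\<close> becomes \<open>(w\<^sub>1, w\<^sub>2) \<mapsto> (w\<^sub>1, - w\<^sub>2)\<close>, and \<open>Orb \<gamma>\<close> becomes the set of points
  \<open>e\<^sup>i\<^sup>\<theta> (a, b)\<close> with \<open>(a, b)\<close> on a quarter circle tangent to the two axes at \<open>(r, 0)\<close> and \<open>(0, r)\<close>. Rotating
  \<open>w\<^sub>1\<close> by a phase \<open>A\<close> and \<open>w\<^sub>2\<close> by a phase \<open>B\<close> with \<open>B - A\<close> going from \<open>0\<close> to \<open>\<pi>\<close> therefore moves one annulus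
  to the other. The phases depend only on the time and on \<open>|w\<^sub>1|, |w\<^sub>2|\<close>, so each stage is a bijection of
  the ambient space, with inverse given by the opposite phases; this makes every stage an immersion,
  and an embedding if \<open>L\<close> is embedded.

  With \<open>\<eta> = r\<^sup>2 - |w|\<^sup>2\<close> the phases carry the factor \<open>exp (- (1 - t)\<^sup>2 / \<eta>)\<close> for \<open>\<eta> > 0\<close> and vanish for \<open>\<eta> \<le> 0\<close>,
  so the family is smooth except where \<open>t = 1\<close> and \<open>\<eta> = 0\<close>. On the annulus \<open>|w\<^sub>1| |w\<^sub>2| = \<eta>\<^sup>2 / (8 r\<^sup>2)\<close>, and
  this factor \<open>\<eta>\<^sup>2\<close> compensates the singularity there: the family is \<open>C\<^sup>1\<close> and its derivative at the seam
  is that of the inclusion. At time \<open>1\<close> the map is \<open>M\<close> followed by a rotation through a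
  position-dependent angle; since the moment map of \<open>\<G>\<close> vanishes on the annulus, that rotation
  does not affect the Lagrangian condition.\<close>

section \<open>Calculus of smooth functions\<close>

lemma higher_diff_subset: "higher_diff n U f \<Longrightarrow> V \<subseteq> U \<Longrightarrow> higher_diff n V f"
  by (induction n arbitrary: f) (auto intro: continuous_on_subset)

text \<open>Functions that agree near \<open>x\<close> have the same set of derivatives there,
  possibly empty, so the choice made by \<open>frechet_derivative\<close> is the same for
  both.\<close>

lemma frechet_derivative_cong_open:
  assumes "open U" "x \<in> U" "\<And>y. y \<in> U \<Longrightarrow> f y = g y"
  shows "frechet_derivative f (at x) = frechet_derivative g (at x)"
proof -
  have "(f has_derivative D) (at x) \<longleftrightarrow> (g has_derivative D) (at x)" for D
    using has_derivative_transform_within_open[of f D x UNIV U g]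
      has_derivative_transform_within_open[of g D x UNIV U f] assms by metis
  then show ?thesis
    by (simp add: frechet_derivative_def)
qed

lemma differentiable_cong_open:
  assumes "open U" "x \<in> U" "\<And>y. y \<in> U \<Longrightarrow> f y = g y" "f differentiable (at x)"
  shows "g differentiable (at x)"
  using assms has_derivative_transform_within_open[of f _ x UNIV U g]
  unfolding differentiable_def by blast

lemma higher_diff_cong:
  assumes "open U" "\<And>x. x \<in> U \<Longrightarrow> f x = g x" "higher_diff n U f"
  shows "higher_diff n U g"
  using assms(2,3)
proof (induction n arbitrary: f g)
  case 0
  then show ?case by (simp cong: continuous_on_cong)
next
  case (Suc n)
  show ?case
    unfolding higher_diff.simps
  proof (intro conjI ballI allI)
    fix x assume "x \<in> U"
    then show "g differentiable (at x)"
      using differentiable_cong_open[OF \<open>open U\<close> _ Suc.prems(1)] Suc.prems(2) by simp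
  next
    fix v
    have "higher_diff n U (\<lambda>x. frechet_derivative f (at x) v)"
      using Suc.prems by simp
    then show "higher_diff n U (\<lambda>x. frechet_derivative g (at x) v)"
      by (rule Suc.IH[rotated]) (use frechet_derivative_cong_open[OF \<open>open U\<close> _ Suc.prems(1)] in simp)
  qed
qed

lemma higher_diff_imp_continuous_on: "higher_diff n U f \<Longrightarrow> continuous_on U f"
  by (cases n) (simp_all add: continuous_at_imp_continuous_on differentiable_imp_continuous_within)

lemma higher_diff_SucD: "higher_diff (Suc n) U f \<Longrightarrow> higher_diff n U f"
proof (induction n arbitrary: f)
  case 0
  then show ?case using higher_diff_imp_continuous_on by fastforce
next
  case (Suc n)
  then have "\<forall>v. higher_diff n U (\<lambda>x. frechet_derivative f (at x) v)"
    unfolding higher_diff.simps(2)[of "Suc n"] by blast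
  then show ?case
    using Suc.prems by simp
qed

lemma higher_diff_antimono: "higher_diff n U f \<Longrightarrow> m \<le> n \<Longrightarrow> higher_diff m U f"
proof (induction n)
  case (Suc n)
  then show ?case using higher_diff_SucD le_Suc_eq by blast
qed simp

text \<open>Serves to supply the derivative in closed form \<open>D\<close>: on the open set
  \<open>U\<close> it agrees with the chosen \<open>frechet_derivative\<close>, so its regularity
  carries over.\<close>

lemma higher_diff_SucI:
  assumes "open U" "\<And>x. x \<in> U \<Longrightarrow> (f has_derivative D x) (at x)"
    "\<And>v. higher_diff n U (\<lambda>x. D x v)"
  shows "higher_diff (Suc n) U f"
  unfolding higher_diff.simps
proof (intro conjI ballI allI)
  fix v
  have "D x v = frechet_derivative f (at x) v" if "x \<in> U" for x
    using frechet_derivative_at[OF assms(2)[OF that]] by simp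
  from higher_diff_cong[OF \<open>open U\<close> this assms(3)]
  show "higher_diff n U (\<lambda>x. frechet_derivative f (at x) v)" .
qed (rule differentiableI[OF assms(2)])

lemma higher_diff_Suc_derivative:
  assumes "higher_diff (Suc n) U f"
  shows "x \<in> U \<Longrightarrow> (f has_derivative frechet_derivative f (at x)) (at x)"
    and "higher_diff n U (\<lambda>x. frechet_derivative f (at x) v)"
  using assms by (simp_all add: frechet_derivative_works)

lemma higher_diff_const: "higher_diff n U (\<lambda>x. c)"
proof (induction n arbitrary: c)
  case (Suc n)
  then show ?case by simp
qed simp

lemma higher_diff_bounded_linear:
  assumes "bounded_linear f" "open U"
  shows "higher_diff n U f"
proof (cases n)
  case 0
  then show ?thesis
    by (simp add: assms(1) linear_continuous_on)
next
  case (Suc m)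
  show ?thesis unfolding Suc
    by (rule higher_diff_SucI[OF \<open>open U\<close>, of _ "\<lambda>x. f"])
      (auto intro: bounded_linear_imp_has_derivative assms higher_diff_const)
qed

lemma higher_diff_add:
  assumes "open U" "higher_diff n U f" "higher_diff n U g"
  shows "higher_diff n U (\<lambda>x. f x + g x)"
  using assms(2,3)
proof (induction n arbitrary: f g)
  case 0
  then show ?case by (auto intro: continuous_intros)
next
  case (Suc n)
  let ?D = "\<lambda>x. frechet_derivative f (at x)"
  note D = higher_diff_Suc_derivative[OF Suc.prems(1)]
  let ?D' = "\<lambda>x. frechet_derivative g (at x)"
  note D' = higher_diff_Suc_derivative[OF Suc.prems(2)]
  show ?case
  proof (rule higher_diff_SucI[OF \<open>open U\<close>])
    show "((\<lambda>x. f x + g x) has_derivative (\<lambda>v. ?D x v + ?D' x v)) (at x)" if "x \<in> U" for x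
      by (rule has_derivative_add[OF D(1)[OF that] D'(1)[OF that]])
    show "higher_diff n U (\<lambda>x. ?D x v + ?D' x v)" for v
      by (rule Suc.IH[OF D(2) D'(2)])
  qed
qed

lemma higher_diff_sum:
  assumes "open U" "\<And>i. i \<in> I \<Longrightarrow> higher_diff n U (f i)"
  shows "higher_diff n U (\<lambda>x. \<Sum>i\<in>I. f i x)"
  using assms(2)
  by (induction I rule: infinite_finite_induct)
    (auto intro: higher_diff_const higher_diff_add[OF assms(1)])

text \<open>Leibniz rule. Each term of the derivative pairs one function with the derivative of the
  other, so the induction generalizes over both and lowers the order of the undifferentiated one as
  well. One statement covers products, scalar multiples and inner products.\<close>

lemma higher_diff_bilinear:
  assumes "bounded_bilinear b" "open U" "higher_diff n U f" "higher_diff n U g"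
  shows "higher_diff n U (\<lambda>x. b (f x) (g x))"
  using assms(3,4)
proof (induction n arbitrary: f g)
  case 0
  then show ?case by (auto intro: bounded_bilinear.continuous_on[OF assms(1)])
next
  case (Suc n)
  let ?D = "\<lambda>x. frechet_derivative f (at x)"
  note D = higher_diff_Suc_derivative[OF Suc.prems(1)]
  let ?D' = "\<lambda>x. frechet_derivative g (at x)"
  note D' = higher_diff_Suc_derivative[OF Suc.prems(2)]
  show ?case
  proof (rule higher_diff_SucI[OF \<open>open U\<close>])
    show "((\<lambda>x. b (f x) (g x)) has_derivative (\<lambda>v. b (f x) (?D' x v) + b (?D x v) (g x))) (at x)"
      if "x \<in> U" for x
      by (rule bounded_bilinear.FDERIV[OF assms(1) D(1)[OF that] D'(1)[OF that]])
    show "higher_diff n U (\<lambda>x. b (f x) (?D' x v) + b (?D x v) (g x))" for v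
      by (rule higher_diff_add[OF assms(2) Suc.IH[OF higher_diff_SucD[OF Suc.prems(1)] D'(2)]
            Suc.IH[OF D(2) higher_diff_SucD[OF Suc.prems(2)]]])
  qed
qed

text \<open>The chain rule evaluates the derivative of \<open>g\<close> in a direction that moves
  with \<open>x\<close>. Expanding this direction in the basis leaves derivatives of
  \<open>g\<close> in fixed directions, composed with \<open>f\<close>, to which the induction
  hypothesis applies.\<close>

lemma higher_diff_compose:
  fixes f :: "'a::euclidean_space \<Rightarrow> 'b::euclidean_space" and g :: "'b \<Rightarrow> 'c::euclidean_space"
  assumes "open U" "open V" "f ` U \<subseteq> V" "higher_diff n U f" "higher_diff n V g"
  shows "higher_diff n U (\<lambda>x. g (f x))"
  using assms(3-5)
proof (induction n arbitrary: f g)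
  case 0
  then show ?case using continuous_on_compose2 by auto
next
  case (Suc n)
  let ?D = "\<lambda>x. frechet_derivative f (at x)"
  note D = higher_diff_Suc_derivative[OF Suc.prems(2)]
  let ?D' = "\<lambda>x. frechet_derivative g (at x)"
  note D' = higher_diff_Suc_derivative[OF Suc.prems(3)]
  show ?case
  proof (rule higher_diff_SucI[OF \<open>open U\<close>])
    fix x assume "x \<in> U"
    then have "f x \<in> V" using Suc.prems(1) by auto
    have lin: "linear (?D' (f x))"
      using D'(1)[OF \<open>f x \<in> V\<close>] has_derivative_linear by blast
    have "?D' (f x) (?D x v) = (\<Sum>i\<in>Basis. (?D x v \<bullet> i) *\<^sub>R ?D' (f x) i)" for v
    proof -
      have "?D' (f x) (?D x v) = ?D' (f x) (\<Sum>i\<in>Basis. (?D x v \<bullet> i) *\<^sub>R i)"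
        by (simp only: euclidean_representation)
      also have "\<dots> = (\<Sum>i\<in>Basis. (?D x v \<bullet> i) *\<^sub>R ?D' (f x) i)"
        by (simp only: linear_sum[OF lin] linear_scale[OF lin])
      finally show ?thesis .
    qed
    then show "((\<lambda>x. g (f x)) has_derivative (\<lambda>v. \<Sum>i\<in>Basis. (?D x v \<bullet> i) *\<^sub>R ?D' (f x) i)) (at x)"
      using has_derivative_compose[OF D(1)[OF \<open>x \<in> U\<close>] D'(1)[OF \<open>f x \<in> V\<close>]] by simp
  next
    fix v
    show "higher_diff n U (\<lambda>x. \<Sum>i\<in>Basis. (?D x v \<bullet> i) *\<^sub>R ?D' (f x) i)"
    proof (intro higher_diff_sum higher_diff_bilinear[OF bounded_bilinear_scaleR] \<open>open U\<close>)
      fix i :: 'b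
      show "higher_diff n U (\<lambda>x. ?D x v \<bullet> i)"
        by (rule higher_diff_bilinear[OF bounded_bilinear_inner \<open>open U\<close> D(2) higher_diff_const])
      show "higher_diff n U (\<lambda>x. ?D' (f x) i)"
        using Suc.IH[OF Suc.prems(1) higher_diff_SucD[OF Suc.prems(2)] D'(2)] .
    qed
  qed
qed

lemma higher_diff_Pair:
  assumes "open U" "higher_diff n U f" "higher_diff n U g"
  shows "higher_diff n U (\<lambda>x. (f x, g x))"
proof -
  have 1: "bounded_linear (\<lambda>x. (x, 0))" "bounded_linear (\<lambda>x. (0, x))"
    by (auto intro!: bounded_linear_intros)
  have "higher_diff n U (\<lambda>x. (f x, 0) + (0, g x))"
    using higher_diff_compose[OF assms(1) open_UNIV _ assms(2) higher_diff_bounded_linear[OF 1(1) open_UNIV]]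
      higher_diff_compose[OF assms(1) open_UNIV _ assms(3) higher_diff_bounded_linear[OF 1(2) open_UNIV]]
    by (intro higher_diff_add assms(1)) auto
  then show ?thesis by simp
qed

section \<open>Maps of class C^k on arbitrary sets\<close>

lemma ck_eucD:
  assumes "ck_euc k S f" "x \<in> S"
  shows "\<exists>U g. open U \<and> x \<in> U \<and> (\<forall>n. enat n \<le> k \<longrightarrow> higher_diff n U g) \<and>
    (\<forall>y. y \<in> S \<longrightarrow> y \<in> U \<longrightarrow> g y = f y)"
  using assms(1)[unfolded ck_euc_def, rule_format, OF assms(2)] by (simp only: Ball_def Int_iff imp_conjL)

lemma ck_eucI_local:
  assumes "\<And>x. x \<in> S \<Longrightarrow> \<exists>U g. open U \<and> x \<in> U \<and> (\<forall>n. enat n \<le> k \<longrightarrow> higher_diff n U g) \<and>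
    (\<forall>y\<in>S \<inter> U. g y = f y)"
  shows "ck_euc k S f"
  using assms unfolding ck_euc_def by (rule ballI)

lemma ck_eucI:
  assumes "open U" "\<And>n. enat n \<le> k \<Longrightarrow> higher_diff n U f" "S \<subseteq> U"
  shows "ck_euc k S f"
  by (rule ck_eucI_local) (use assms in \<open>intro exI[of _ U] exI[of _ f], auto\<close>)

lemma ck_euc_weaken:
  assumes "ck_euc k S f" "T \<subseteq> S" "l \<le> k"
  shows "ck_euc l T f"
proof (rule ck_eucI_local)
  fix x assume "x \<in> T"
  then have "x \<in> S" using assms(2) by auto
  from ck_eucD[OF assms(1) this] obtain U g where U: "open U" "x \<in> U"
    "\<forall>n. enat n \<le> k \<longrightarrow> higher_diff n U g" "\<forall>y. y \<in> S \<longrightarrow> y \<in> U \<longrightarrow> g y = f y"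
    by (elim exE conjE)
  have "higher_diff n U g" if "enat n \<le> l" for n
    using U(3) order_trans[OF that assms(3)] by simp
  moreover have "\<forall>y\<in>T \<inter> U. g y = f y"
    using U(4) assms(2) by auto
  ultimately show "\<exists>U g. open U \<and> x \<in> U \<and> (\<forall>n. enat n \<le> l \<longrightarrow> higher_diff n U g) \<and> (\<forall>y\<in>T \<inter> U. g y = f y)"
    using U(1,2) by (intro exI[of _ U] exI[of _ g]) simp
qed

lemmas ck_euc_subset = ck_euc_weaken[OF _ _ order_refl]
lemmas ck_euc_antimono = ck_euc_weaken[OF _ subset_refl]

lemma ck_euc_cong: "ck_euc k S f \<Longrightarrow> (\<And>x. x \<in> S \<Longrightarrow> f x = g x) \<Longrightarrow> ck_euc k S g"
  unfolding ck_euc_def by simp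

lemma ck_euc_local:
  assumes "\<And>x. x \<in> S \<Longrightarrow> \<exists>T. open T \<and> x \<in> T \<and> ck_euc k (S \<inter> T) f"
  shows "ck_euc k S f"
proof (rule ck_eucI_local)
  fix x assume "x \<in> S"
  then obtain T where T: "open T" "x \<in> T" "ck_euc k (S \<inter> T) f"
    using assms by blast
  then have xT: "x \<in> S \<inter> T" using \<open>x \<in> S\<close> by simp
  obtain U g where U: "open U" "x \<in> U" "\<And>n. enat n \<le> k \<Longrightarrow> higher_diff n U g"
    "\<And>y. y \<in> S \<inter> T \<Longrightarrow> y \<in> U \<Longrightarrow> g y = f y"
    using ck_eucD[OF T(3) xT] by blast
  have "higher_diff n (T \<inter> U) g" if "enat n \<le> k" for n
    by (rule higher_diff_subset[OF U(3)[OF that]]) simp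
  moreover have "open (T \<inter> U)" "x \<in> T \<inter> U" "\<forall>y\<in>S \<inter> (T \<inter> U). g y = f y"
    using T U by auto
  ultimately show "\<exists>U g. open U \<and> x \<in> U \<and> (\<forall>n. enat n \<le> k \<longrightarrow> higher_diff n U g) \<and> (\<forall>y\<in>S \<inter> U. g y = f y)"
    by (intro exI[of _ "T \<inter> U"] exI[of _ g]) simp
qed

lemma higher_diff_local:
  assumes "\<And>x. x \<in> S \<Longrightarrow> \<exists>U. open U \<and> x \<in> U \<and> higher_diff n U f"
  shows "higher_diff n S f"
  using assms
proof (induction n arbitrary: f)
  case 0
  have "continuous (at x) f" if "x \<in> S" for x
    using 0[OF that] by (auto simp: continuous_on_eq_continuous_at)
  then show ?case by (simp add: continuous_at_imp_continuous_on)
next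
  case (Suc n)
  have "higher_diff n S (\<lambda>x. frechet_derivative f (at x) v)" for v
  proof (rule Suc.IH)
    fix x assume "x \<in> S"
    from Suc.prems[OF this] obtain U where "open U" "x \<in> U" "higher_diff (Suc n) U f" by blast
    then show "\<exists>U. open U \<and> x \<in> U \<and> higher_diff n U (\<lambda>x. frechet_derivative f (at x) v)"
      by (intro exI[of _ U]) simp
  qed
  moreover have "f differentiable (at x)" if "x \<in> S" for x
    using Suc.prems[OF that] by auto
  ultimately show ?case by simp
qed

lemma ck_euc_openD:
  assumes "ck_euc k S f" "open S" "enat n \<le> k"
  shows "higher_diff n S f"
proof (rule higher_diff_local)
  fix x assume x: "x \<in> S"
  obtain U g where U: "open U" "x \<in> U" "\<And>n. enat n \<le> k \<Longrightarrow> higher_diff n U g"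
    "\<And>y. y \<in> S \<Longrightarrow> y \<in> U \<Longrightarrow> g y = f y"
    using ck_eucD[OF assms(1) x] by blast
  have op: "open (S \<inter> U)" by (rule open_Int[OF assms(2) U(1)])
  have "higher_diff n (S \<inter> U) g"
    by (rule higher_diff_subset[OF U(3)[OF assms(3)]]) simp
  then have "higher_diff n (S \<inter> U) f"
    by (rule higher_diff_cong[OF op, rotated]) (use U(4) in simp)
  then show "\<exists>U. open U \<and> x \<in> U \<and> higher_diff n U f"
    using op U(2) x by (intro exI[of _ "S \<inter> U"]) simp
qed

lemma ck_euc_continuous_on:
  assumes "ck_euc k S f"
  shows "continuous_on S f"
proof -
  have "continuous (at x within S) f" if x: "x \<in> S" for x
  proof -
    obtain U g where U: "open U" "x \<in> U" "\<And>n. enat n \<le> k \<Longrightarrow> higher_diff n U g"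
      "\<And>y. y \<in> S \<Longrightarrow> y \<in> U \<Longrightarrow> g y = f y"
      using ck_eucD[OF assms x] by blast
    have "continuous (at x) g"
      using U(3)[of 0] U(1,2) by (simp add: continuous_on_eq_continuous_at zero_enat_def[symmetric])
    then have "continuous (at x within S) g"
      by (rule continuous_at_imp_continuous_at_within)
    then show ?thesis
      by (rule continuous_transform_within_openin[of _ _ _ "S \<inter> U"]) (use U x in auto)
  qed
  then show ?thesis by (simp add: continuous_on_eq_continuous_within)
qed

lemma ck_euc_differentiable:
  assumes "ck_euc k S f" "open S" "1 \<le> k" "x \<in> S"
  shows "f differentiable (at x)"
proof -
  have "higher_diff (Suc 0) S f"
    using assms by (intro ck_euc_openD[of k]) (auto simp: one_enat_def)
  then show ?thesis using assms by simp
qed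

lemma ck_euc_compose:
  fixes f :: "'a::euclidean_space \<Rightarrow> 'b::euclidean_space" and g :: "'b \<Rightarrow> 'c::euclidean_space"
  assumes "ck_euc k T g" "ck_euc k S f" "\<And>x. x \<in> S \<Longrightarrow> f x \<in> T"
  shows "ck_euc k S (\<lambda>x. g (f x))"
proof (rule ck_eucI_local)
  fix x assume x: "x \<in> S"
  obtain U f' where U: "open U" "x \<in> U" "\<And>n. enat n \<le> k \<Longrightarrow> higher_diff n U f'"
    "\<And>y. y \<in> S \<Longrightarrow> y \<in> U \<Longrightarrow> f' y = f y"
    using ck_eucD[OF assms(2) x] by blast
  obtain V g' where V: "open V" "f x \<in> V" "\<And>n. enat n \<le> k \<Longrightarrow> higher_diff n V g'"
    "\<And>y. y \<in> T \<Longrightarrow> y \<in> V \<Longrightarrow> g' y = g y"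
    using ck_eucD[OF assms(1) assms(3)[OF x]] by blast
  have cont: "continuous_on U f'"
    using U(3)[of 0] by (simp add: zero_enat_def[symmetric])
  define X where "X = U \<inter> f' -` V"
  have "open X"
    unfolding X_def by (rule continuous_open_preimage[OF cont U(1) V(1)])
  moreover have "x \<in> X" "X \<subseteq> U" "f' ` X \<subseteq> V"
    using U(2) U(4)[OF x] V(2) unfolding X_def by auto
  moreover have "\<forall>y\<in>S \<inter> X. g' (f' y) = g (f y)"
  proof
    fix y assume "y \<in> S \<inter> X"
    then have y: "y \<in> S" "y \<in> U" "f' y \<in> V" by (simp_all add: X_def)
    then show "g' (f' y) = g (f y)"
      using U(4)[OF y(1,2)] V(4)[OF assms(3)[OF y(1)]] by simp
  qed
  moreover have "higher_diff n X (\<lambda>x. g' (f' x))" if "enat n \<le> k" for n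
    by (rule higher_diff_compose[OF \<open>open X\<close> V(1) \<open>f' ` X \<subseteq> V\<close>
          higher_diff_subset[OF U(3)[OF that] \<open>X \<subseteq> U\<close>] V(3)[OF that]])
  ultimately show "\<exists>U ga. open U \<and> x \<in> U \<and> (\<forall>n. enat n \<le> k \<longrightarrow> higher_diff n U ga) \<and> (\<forall>y\<in>S \<inter> U. ga y = g (f y))"
    by (intro exI[of _ X] exI[of _ "\<lambda>x. g' (f' x)"]) simp
qed

named_theorems ck_intros

lemma ck_euc_Pair [ck_intros]:
  assumes "ck_euc k S f" "ck_euc k S g"
  shows "ck_euc k S (\<lambda>x. (f x, g x))"
proof (rule ck_eucI_local)
  fix x assume x: "x \<in> S"
  obtain U f' where U: "open U" "x \<in> U" "\<And>n. enat n \<le> k \<Longrightarrow> higher_diff n U f'"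
    "\<And>y. y \<in> S \<Longrightarrow> y \<in> U \<Longrightarrow> f' y = f y"
    using ck_eucD[OF assms(1) x] by blast
  obtain V g' where V: "open V" "x \<in> V" "\<And>n. enat n \<le> k \<Longrightarrow> higher_diff n V g'"
    "\<And>y. y \<in> S \<Longrightarrow> y \<in> V \<Longrightarrow> g' y = g y"
    using ck_eucD[OF assms(2) x] by blast
  have op: "open (U \<inter> V)" by (rule open_Int[OF U(1) V(1)])
  have "higher_diff n (U \<inter> V) (\<lambda>x. (f' x, g' x))" if "enat n \<le> k" for n
    by (rule higher_diff_Pair[OF op higher_diff_subset[OF U(3)[OF that]]
          higher_diff_subset[OF V(3)[OF that]]]) auto
  then show "\<exists>U ga. open U \<and> x \<in> U \<and> (\<forall>n. enat n \<le> k \<longrightarrow> higher_diff n U ga) \<and> (\<forall>y\<in>S \<inter> U. ga y = (f y, g y))"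
    using op U(2,4) V(2,4) by (intro exI[of _ "U \<inter> V"] exI[of _ "\<lambda>x. (f' x, g' x)"]) simp
qed

lemma ck_euc_bounded_linear:
  assumes "bounded_linear l" "ck_euc k S f"
  shows "ck_euc k S (\<lambda>x. l (f x))"
proof (rule ck_euc_compose[OF _ assms(2)])
  show "ck_euc k UNIV l"
    by (rule ck_eucI[OF open_UNIV higher_diff_bounded_linear[OF assms(1) open_UNIV] subset_UNIV])
qed simp

lemma ck_euc_bilinear:
  assumes "bounded_bilinear b" "ck_euc k S f" "ck_euc k S g"
  shows "ck_euc k S (\<lambda>x. b (f x) (g x))"
proof -
  have "higher_diff n UNIV (\<lambda>z. b (fst z) (snd z))" for n
    by (rule higher_diff_bilinear[OF assms(1) open_UNIV
          higher_diff_bounded_linear[OF bounded_linear_fst open_UNIV]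
          higher_diff_bounded_linear[OF bounded_linear_snd open_UNIV]])
  then have "ck_euc k UNIV (\<lambda>z. b (fst z) (snd z))"
    by (rule ck_eucI[OF open_UNIV _ subset_UNIV])
  from ck_euc_compose[OF this ck_euc_Pair[OF assms(2,3)]] show ?thesis by simp
qed

lemma ck_euc_const [ck_intros]: "ck_euc k S (\<lambda>x. c)"
  by (rule ck_eucI[OF open_UNIV higher_diff_const subset_UNIV])

lemma ck_euc_ident [ck_intros]: "ck_euc k S (\<lambda>x. x)"
  by (rule ck_eucI[OF open_UNIV higher_diff_bounded_linear[OF bounded_linear_ident open_UNIV] subset_UNIV])

lemma ck_euc_add [ck_intros]:
  assumes "ck_euc k S f" "ck_euc k S g" shows "ck_euc k S (\<lambda>x. f x + g x)"
proof -
  have "bounded_linear (\<lambda>z::'b\<times>'b. fst z + snd z)" by (intro bounded_linear_intros)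
  from ck_euc_bounded_linear[OF this ck_euc_Pair[OF assms]] show ?thesis by simp
qed

lemmas ck_euc_linear_intros [ck_intros] =
  ck_euc_bounded_linear[OF bounded_linear_fst] ck_euc_bounded_linear[OF bounded_linear_snd]
  ck_euc_bounded_linear[OF bounded_linear_Re] ck_euc_bounded_linear[OF bounded_linear_Im]
  ck_euc_bounded_linear[OF bounded_linear_of_real]
  ck_euc_bounded_linear[OF bounded_linear_minus[OF bounded_linear_ident]]
  ck_euc_bilinear[OF bounded_bilinear_scaleR] ck_euc_bilinear[OF bounded_bilinear_mult]
  ck_euc_bilinear[OF bounded_bilinear_inner]

lemma ck_euc_diff [ck_intros]:
  assumes "ck_euc k S f" "ck_euc k S g" shows "ck_euc k S (\<lambda>x. f x - g x)"
proof -
  have "bounded_linear (\<lambda>z::'b\<times>'b. fst z - snd z)" by (intro bounded_linear_intros)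
  from ck_euc_bounded_linear[OF this ck_euc_Pair[OF assms]] show ?thesis by simp
qed

lemma ck_euc_power [ck_intros]:
  fixes f :: "'a::euclidean_space \<Rightarrow> real"
  assumes "ck_euc k S f" shows "ck_euc k S (\<lambda>x. f x ^ n)"
  by (induction n) (auto intro!: ck_intros assms)

lemma ck_euc_norm_power2 [ck_intros]:
  assumes "ck_euc k S f" shows "ck_euc k S (\<lambda>x. (norm (f x))\<^sup>2)"
  unfolding power2_norm_eq_inner by (intro ck_intros assms)

section \<open>Exponential and trigonometric functions and the inverse\<close>

lemma higher_diff_exp: "higher_diff n UNIV (exp :: real \<Rightarrow> real)"
proof (induction n)
  case (Suc n)
  have "(exp has_derivative (\<lambda>v. v * exp x)) (at x)" for x :: real
    by (rule has_derivative_eq_rhs[OF DERIV_exp[unfolded has_field_derivative_def]])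
      (simp add: fun_eq_iff mult.commute)
  then show ?case
    by (rule higher_diff_SucI[OF open_UNIV])
      (rule higher_diff_bilinear[OF bounded_bilinear_mult open_UNIV higher_diff_const Suc])
qed (auto intro: continuous_intros)

text \<open>The two functions go together because each is the derivative of the other up to
  sign.\<close>

lemma higher_diff_sin_cos:
  "higher_diff n UNIV (sin :: real \<Rightarrow> real) \<and> higher_diff n UNIV (cos :: real \<Rightarrow> real)"
proof (induction n)
  case (Suc n)
  have 1: "(sin has_derivative (\<lambda>v. v * cos x)) (at x)" for x :: real
    by (rule has_derivative_eq_rhs[OF DERIV_sin[unfolded has_field_derivative_def]])
      (simp add: fun_eq_iff mult.commute)
  have 2: "(cos has_derivative (\<lambda>v. (- v) * sin x)) (at x)" for x :: real
    by (rule has_derivative_eq_rhs[OF DERIV_cos[unfolded has_field_derivative_def]])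
      (simp add: fun_eq_iff mult.commute)
  have "higher_diff n UNIV (\<lambda>x. v * cos x)" "higher_diff n UNIV (\<lambda>x. (- v) * sin x)" for v :: real
    using Suc by (intro higher_diff_bilinear[OF bounded_bilinear_mult open_UNIV higher_diff_const]; simp)+
  then show ?case
    by (intro conjI higher_diff_SucI[OF open_UNIV 1] higher_diff_SucI[OF open_UNIV 2])
qed (auto intro: continuous_intros)

lemma higher_diff_inverse: "higher_diff n (- {0}) (inverse :: real \<Rightarrow> real)"
proof (induction n)
  case (Suc n)
  have "(inverse has_derivative (\<lambda>v. - v * (inverse x * inverse x))) (at x)" if "x \<in> - {0}" for x :: real
    using has_derivative_inverse'[of x] that by (simp add: algebra_simps)
  moreover have op: "open (- {0 :: real})" by (simp add: open_Compl)
  moreover have "higher_diff n (- {0}) (\<lambda>x. - v * (inverse x * inverse x))" for v :: real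
    by (rule higher_diff_bilinear[OF bounded_bilinear_mult op higher_diff_const
          higher_diff_bilinear[OF bounded_bilinear_mult op Suc Suc]])
  ultimately show ?case
    by (intro higher_diff_SucI)
qed (auto intro!: continuous_intros)

lemma ck_euc_exp [ck_intros]:
  fixes f :: "'a::euclidean_space \<Rightarrow> real"
  assumes "ck_euc k S f" shows "ck_euc k S (\<lambda>x. exp (f x))"
  by (rule ck_euc_compose[OF ck_eucI[OF open_UNIV higher_diff_exp subset_UNIV] assms UNIV_I])

lemma ck_euc_cis [ck_intros]:
  assumes "ck_euc k S f" shows "ck_euc k S (\<lambda>x. cis (f x))"
proof -
  have "ck_euc k S (\<lambda>x. sin (f x))" "ck_euc k S (\<lambda>x. cos (f x))"
    by (rule ck_euc_compose[OF ck_eucI[OF open_UNIV _ subset_UNIV] assms UNIV_I];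
        simp add: higher_diff_sin_cos)+
  then have "ck_euc k S (\<lambda>x. of_real (cos (f x)) + \<i> * of_real (sin (f x)))"
    by (intro ck_intros)
  then show ?thesis by (rule ck_euc_cong) (simp add: cis_conv_exp exp_Euler cos_of_real sin_of_real)
qed

lemma ck_euc_divide [ck_intros]:
  fixes f g :: "'a::euclidean_space \<Rightarrow> real"
  assumes "ck_euc k S f" "ck_euc k S g" "\<And>x. x \<in> S \<Longrightarrow> g x \<noteq> 0"
  shows "ck_euc k S (\<lambda>x. f x / g x)"
proof -
  have "ck_euc k (- {0}) (inverse :: real \<Rightarrow> real)"
    by (rule ck_eucI[OF _ higher_diff_inverse]) auto
  then have "ck_euc k S (\<lambda>x. inverse (g x))"
    by (rule ck_euc_compose[OF _ assms(2)]) (use assms(3) in auto)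
  then show ?thesis unfolding divide_inverse by (intro ck_intros assms)
qed

section \<open>The phase rotation\<close>

text \<open>For \<open>k = 0\<close> this is the standard smooth function that is flat at 0. The
  powers of \<open>1 / x\<close> are carried along because differentiation produces them.\<close>

definition flat :: "nat \<Rightarrow> real \<Rightarrow> real" where
  "flat k x = (if x > 0 then (1 / x) ^ k * exp (- (1 / x)) else 0)"

lemma flat_tendsto_0: "((\<lambda>x. (1 / x) ^ k * exp (- (1 / x))) \<longlongrightarrow> 0) (at_right (0::real))"
proof -
  have "((\<lambda>y. y ^ k / exp y) \<longlongrightarrow> 0) (at_top :: real filter)"
    by (rule tendsto_power_div_exp_0)
  from filterlim_compose[OF this filterlim_inverse_at_top_right]
  show ?thesis by (simp add: exp_minus divide_inverse)
qed

lemma flat_tendsto_0_at: "(flat k \<longlongrightarrow> 0) (at 0)"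
proof (rule filterlim_split_at)
  show "(flat k \<longlongrightarrow> 0) (at_left 0)"
    by (rule Lim_transform_eventually[OF tendsto_const])
      (simp add: flat_def eventually_at_filter)
  show "(flat k \<longlongrightarrow> 0) (at_right 0)"
    by (rule Lim_transform_eventually[OF flat_tendsto_0[of k]])
      (simp add: flat_def eventually_at_filter)
qed

lemma flat_has_real_derivative:
  "(flat k has_real_derivative (flat (k + 2) x - k * flat (Suc k) x)) (at x)"
proof -
  consider "x > 0" | "x < 0" | "x = 0" by linarith
  then show ?thesis
  proof cases
    case 1
    have "((\<lambda>x. (1 / x) ^ k * exp (- (1 / x))) has_real_derivative
        (flat (k + 2) x - k * flat (Suc k) x)) (at x)"
      using 1 by (auto intro!: derivative_eq_intros
        simp: flat_def power_divide divide_simps power2_eq_square power_Suc[symmetric] simp del: power_Suc)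
        (cases k; auto simp: field_simps)
    then show ?thesis
      by (rule has_field_derivative_transform_within_open[of _ _ _ "{0<..}"])
        (use 1 in \<open>auto simp: flat_def\<close>)
  next
    case 2
    have "((\<lambda>x. 0) has_real_derivative (flat (k + 2) x - k * flat (Suc k) x)) (at x)"
      using 2 by (simp add: flat_def)
    then show ?thesis
      by (rule has_field_derivative_transform_within_open[of _ _ _ "{..<0}"])
        (use 2 in \<open>auto simp: flat_def\<close>)
  next
    case 3
    \<comment> \<open>Off 0 the difference quotient is \<open>flat (Suc k)\<close>; the claimed
      derivative is 0 here because every \<open>flat\<close> vanishes at 0.\<close>
    have "((\<lambda>h. (flat k (0 + h) - flat k 0) / h) \<longlongrightarrow> 0) (at 0)"
      by (rule Lim_transform_eventually[OF flat_tendsto_0_at[of "Suc k"]])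
        (auto simp: flat_def eventually_at_filter)
    then show ?thesis
      unfolding 3 DERIV_def by (simp add: flat_def)
  qed
qed

lemma higher_diff_flat: "higher_diff n UNIV (flat k)"
proof (induction n arbitrary: k)
  case 0
  have "isCont (flat k) x" for x
    using DERIV_isCont[OF flat_has_real_derivative] .
  then show ?case by (simp add: continuous_at_imp_continuous_on)
next
  case (Suc n)
  have "(flat k has_derivative (\<lambda>v. v * (flat (k + 2) x + (- real k) * flat (Suc k) x))) (at x)" for x
    by (rule has_derivative_eq_rhs[OF flat_has_real_derivative[unfolded has_field_derivative_def]])
      (simp add: fun_eq_iff mult.commute)
  then show ?case
    by (rule higher_diff_SucI[OF open_UNIV])
      (rule higher_diff_bilinear[OF bounded_bilinear_mult open_UNIV higher_diff_const]
        higher_diff_add[OF open_UNIV Suc] Suc)+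
qed

text \<open>In use \<open>\<tau> = 1 - t\<close>. For \<open>\<tau> \<noteq> 0\<close> this is
  \<open>flat 0 (\<eta> / \<tau>\<^sup>2)\<close>, smooth across \<open>\<eta> = 0\<close>; for
  \<open>\<tau> = 0\<close> it degenerates to the indicator of \<open>\<eta> > 0\<close>.\<close>

definition step :: "real \<Rightarrow> real \<Rightarrow> real" where
  "step \<tau> \<eta> = (if \<eta> > 0 then exp (- (\<tau>\<^sup>2 / \<eta>)) else 0)"

lemma step_bounds: "0 \<le> step \<tau> \<eta>" "step \<tau> \<eta> \<le> 1"
  by (auto simp: step_def)

text \<open>Off \<open>\<tau> = 0\<close> the step is a smooth function of
  \<open>\<eta> / \<tau>\<^sup>2\<close>, and off \<open>\<eta> = 0\<close> it is an elementary
  function or 0; only the origin remains.\<close>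

lemma ck_euc_step: "ck_euc k {p. fst p \<noteq> 0 \<or> snd p \<noteq> 0} (\<lambda>p. step (fst p) (snd p))"
proof (rule ck_euc_local)
  fix p :: "real \<times> real"
  assume "p \<in> {p. fst p \<noteq> 0 \<or> snd p \<noteq> 0}"
  then consider "fst p \<noteq> 0" | "snd p > 0" | "snd p < 0" by force
  then show "\<exists>T. open T \<and> p \<in> T \<and>
    ck_euc k ({p. fst p \<noteq> 0 \<or> snd p \<noteq> 0} \<inter> T) (\<lambda>p. step (fst p) (snd p))"
  proof cases
    case 1
    let ?T = "{p :: real \<times> real. fst p \<noteq> 0}"
    have "open ?T" by (intro open_Collect_neq continuous_intros)
    moreover have "ck_euc k ?T (\<lambda>p. step (fst p) (snd p))"
    proof (rule ck_euc_cong)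
      show "ck_euc k ?T (\<lambda>p. flat 0 (snd p / (fst p)\<^sup>2))"
        by (rule ck_euc_compose[OF ck_eucI[OF open_UNIV higher_diff_flat subset_UNIV]])
          (auto intro!: ck_intros)
    qed (auto simp: flat_def step_def zero_less_divide_iff)
    ultimately show ?thesis
      using 1 by (intro exI[of _ ?T] conjI) (auto intro: ck_euc_subset)
  next
    case 2
    let ?T = "{p :: real \<times> real. snd p > 0}"
    have "open ?T" by (intro open_Collect_less continuous_intros)
    moreover have "ck_euc k ?T (\<lambda>p. step (fst p) (snd p))"
    proof (rule ck_euc_cong)
      show "ck_euc k ?T (\<lambda>p. exp (- ((fst p)\<^sup>2 / snd p)))"
        by (auto intro!: ck_intros)
    qed (auto simp: step_def)
    ultimately show ?thesis
      using 2 by (intro exI[of _ ?T] conjI) (auto intro: ck_euc_subset)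
  next
    case 3
    let ?T = "{p :: real \<times> real. snd p < 0}"
    have "open ?T" by (intro open_Collect_less continuous_intros)
    moreover have "ck_euc k ?T (\<lambda>p. step (fst p) (snd p))"
      by (rule ck_euc_cong[OF ck_euc_const[of _ _ 0]]) (auto simp: step_def)
    ultimately show ?thesis
      using 3 by (intro exI[of _ ?T] conjI) (auto intro: ck_euc_subset)
  qed
qed

section \<open>Differentiability at the singular point of the step\<close>

text \<open>A factor that is \<open>o(|x - p|)\<close> stays so after multiplication by a bounded
  one. In use \<open>q\<close> may fail to have a limit at \<open>p\<close>.\<close>

lemma has_derivative_zero_scaleR_bounded:
  fixes a :: "'a::real_normed_vector \<Rightarrow> real" and q :: "'a \<Rightarrow> 'b::real_normed_vector"
  assumes a: "(a has_derivative (\<lambda>v. 0)) (at p)" "a p = 0"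
    and q: "\<forall>\<^sub>F x in at p. norm (q x) \<le> B"
  shows "((\<lambda>x. a x *\<^sub>R q x) has_derivative (\<lambda>v. 0)) (at p)"
proof -
  have "((\<lambda>x. (a x / norm (x - p)) *\<^sub>R q x) \<longlongrightarrow> 0) (at p)"
  proof (rule lim_null_scaleR_bounded)
    show "((\<lambda>x. a x / norm (x - p)) \<longlongrightarrow> 0) (at p)"
    proof (rule tendsto_norm_zero_cancel)
      have "(\<lambda>x. norm (a x / norm (x - p))) = (\<lambda>x. norm (a x - a p - 0) / norm (x - p))"
        using a(2) by simp
      then show "((\<lambda>x. norm (a x / norm (x - p))) \<longlongrightarrow> 0) (at p)"
        using a(1) unfolding has_derivative_iff_norm by simp
    qed
    show "\<forall>\<^sub>F x in at p. a x / norm (x - p) = 0 \<or> norm (q x) \<le> B"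
      using q by (rule eventually_mono) simp
  qed
  from tendsto_norm_zero[OF this] show ?thesis
    using a by (simp add: has_derivative_iff_norm)
qed

text \<open>A point \<open>p\<close> is a triple \<open>(\<tau>, \<eta>, y)\<close>. The partial
  derivatives of the step are the step times \<open>- 2 \<tau> / \<eta>\<close> and
  \<open>\<tau>\<^sup>2 / \<eta>\<^sup>2\<close>, and the factor \<open>\<eta>\<^sup>2\<close>
  clears both denominators. What remains are the polynomials \<open>a1\<close> and
  \<open>a2\<close>, which vanish at \<open>\<tau> = \<eta> = 0\<close>, times the locally bounded
  terms \<open>q1\<close> and \<open>q2\<close>.\<close>

lemma ck_euc_square_scaleR_step:
  fixes Q :: "real \<Rightarrow> 'b::euclidean_space"
  assumes Q: "\<And>x. (Q has_vector_derivative Q' x) (at x)" and Q': "continuous_on UNIV Q'"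
  shows "ck_euc 1 UNIV (\<lambda>p. (fst (snd p))\<^sup>2 *\<^sub>R Q (step (fst p) (fst (snd p)) * snd (snd p)))"
proof -
  define s where "s p = step (fst p) (fst (snd p))" for p :: "real \<times> real \<times> real"
  define f where "f p = (fst (snd p))\<^sup>2 *\<^sub>R Q (s p * snd (snd p))" for p :: "real \<times> real \<times> real"
  define a1 where "a1 p v = 2 * fst (snd p) * fst (snd v)" for p v :: "real \<times> real \<times> real"
  define a2 where "a2 p v = (fst (snd p))\<^sup>2 * snd (snd v)
      - 2 * snd (snd p) * fst p * fst (snd p) * fst v + snd (snd p) * (fst p)\<^sup>2 * fst (snd v)"
    for p v :: "real \<times> real \<times> real"
  define q1 where "q1 p = Q (s p * snd (snd p))" for p
  define q2 where "q2 p = s p *\<^sub>R Q' (s p * snd (snd p))" for p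
  define D where "D p v = a1 p v *\<^sub>R q1 p + a2 p v *\<^sub>R q2 p" for p v
  have contQ: "continuous_on UNIV Q"
    by (rule continuous_at_imp_continuous_on) (simp add: has_vector_derivative_continuous[OF Q])
  have s01: "0 \<le> s p" "s p \<le> 1" for p
    by (simp_all add: s_def step_bounds)
  \<comment> \<open>Since the step lies in \<open>[0, 1]\<close>, the argument of \<open>R\<close>
    stays in a fixed compact interval for all points near \<open>p\<close>, even where the step
    jumps.\<close>
  have bdd: "\<exists>B. \<forall>\<^sub>F x in at p. norm (R (s x * snd (snd x))) \<le> B"
    if R: "continuous_on UNIV R" for R :: "real \<Rightarrow> 'b" and p :: "real \<times> real \<times> real"
  proof -
    let ?m = "\<bar>snd (snd p)\<bar> + 1"
    have "compact (R ` {-?m..?m})"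
      by (rule compact_continuous_image) (use R continuous_on_subset in auto)
    then obtain B where B: "\<forall>y\<in>R ` {-?m..?m}. norm y \<le> B"
      using compact_imp_bounded bounded_iff by metis
    have "isCont (\<lambda>x :: real \<times> real \<times> real. \<bar>snd (snd x)\<bar>) p"
      by (intro continuous_intros)
    then have "\<forall>\<^sub>F x in at p. \<bar>snd (snd x)\<bar> < ?m"
      by (intro order_tendstoD(2)[of _ "\<bar>snd (snd p)\<bar>"]) (auto simp: isCont_def)
    then have "\<forall>\<^sub>F x in at p. norm (R (s x * snd (snd x))) \<le> B"
    proof (rule eventually_mono)
      fix x :: "real \<times> real \<times> real" assume "\<bar>snd (snd x)\<bar> < ?m"
      moreover have "\<bar>s x * snd (snd x)\<bar> \<le> \<bar>snd (snd x)\<bar>"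
        using s01[of x] by (simp add: abs_mult mult_left_le_one_le)
      ultimately show "norm (R (s x * snd (snd x))) \<le> B"
        using B by (intro bspec[OF B imageI]) auto
    qed
    then show ?thesis ..
  qed
  have deriv: "(f has_derivative D p) (at p)" for p
  proof -
    consider "fst (snd p) > 0" | "fst (snd p) < 0" | "fst (snd p) = 0" by linarith
    then show ?thesis
    proof cases
      case 1
      let ?e = "\<lambda>p :: real \<times> real \<times> real. exp (- ((fst p)\<^sup>2 / fst (snd p))) * snd (snd p)"
      have e: "s p = exp (- ((fst p)\<^sup>2 / fst (snd p)))"
        using 1 by (simp add: s_def step_def)
      have "(?e has_derivative (\<lambda>v. s p * (snd (snd v) + snd (snd p) *
          (- (2 * fst p * fst v) / fst (snd p) + (fst p)\<^sup>2 * fst (snd v) / (fst (snd p))\<^sup>2)))) (at p)"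
        unfolding e using 1
        by (auto intro!: derivative_eq_intros simp: fun_eq_iff field_simps power2_eq_square)
      from has_derivative_compose[OF this Q[unfolded has_vector_derivative_def]]
      have "((\<lambda>p. Q (?e p)) has_derivative (\<lambda>v. (s p * (snd (snd v) + snd (snd p) *
          (- (2 * fst p * fst v) / fst (snd p) + (fst p)\<^sup>2 * fst (snd v) / (fst (snd p))\<^sup>2))) *\<^sub>R Q' (s p * snd (snd p)))) (at p)"
        by (simp add: e)
      then have d: "((\<lambda>p. (fst (snd p))\<^sup>2 *\<^sub>R Q (?e p)) has_derivative (\<lambda>v.
          (fst (snd p))\<^sup>2 *\<^sub>R ((s p * (snd (snd v) + snd (snd p) *
          (- (2 * fst p * fst v) / fst (snd p) + (fst p)\<^sup>2 * fst (snd v) / (fst (snd p))\<^sup>2))) *\<^sub>R Q' (s p * snd (snd p)))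
          + (2 * fst (snd p) * fst (snd v)) *\<^sub>R Q (s p * snd (snd p)))) (at p)"
        by (auto intro!: derivative_eq_intros simp: e fun_eq_iff)
      have a2: "a2 p v *\<^sub>R q2 p = (fst (snd p))\<^sup>2 *\<^sub>R ((s p * (snd (snd v) + snd (snd p) *
          (- (2 * fst p * fst v) / fst (snd p) + (fst p)\<^sup>2 * fst (snd v) / (fst (snd p))\<^sup>2))) *\<^sub>R Q' (s p * snd (snd p)))" for v
      proof -
        have "(fst (snd p))\<^sup>2 * (s p * (snd (snd v) + snd (snd p) *
          (- (2 * fst p * fst v) / fst (snd p) + (fst p)\<^sup>2 * fst (snd v) / (fst (snd p))\<^sup>2))) = a2 p v * s p"
          using 1 unfolding a2_def by (simp add: field_simps power2_eq_square)
        then show ?thesis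
          unfolding q2_def scaleR_scaleR by (simp only:)
      qed
      have "((\<lambda>p. (fst (snd p))\<^sup>2 *\<^sub>R Q (?e p)) has_derivative D p) (at p)"
        by (rule has_derivative_eq_rhs[OF d], rule ext)
          (simp only: D_def a2 a1_def q1_def, rule add.commute)
      then show ?thesis
      proof (rule has_derivative_transform_within_open)
        show "open {p :: real \<times> real \<times> real. fst (snd p) > 0}"
          by (intro open_Collect_less continuous_intros)
      qed (use 1 in \<open>auto simp: f_def s_def step_def\<close>)
    next
      case 2
      have "((\<lambda>p :: real \<times> real \<times> real. (fst (snd p))\<^sup>2 *\<^sub>R Q 0) has_derivative D p) (at p)"
        using 2 by (auto intro!: derivative_eq_intros simp: D_def a1_def q1_def q2_def s_def step_def fun_eq_iff)
      then show ?thesis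
      proof (rule has_derivative_transform_within_open)
        show "open {p :: real \<times> real \<times> real. fst (snd p) < 0}"
          by (intro open_Collect_less continuous_intros)
      qed (use 2 in \<open>auto simp: f_def s_def step_def\<close>)
    next
      case 3
      \<comment> \<open>At \<open>\<eta> = 0\<close> the step is 0 by definition, which kills
        \<open>q2\<close>, and \<open>a1\<close> has the factor \<open>\<eta>\<close>. Whatever
        \<open>\<tau>\<close> is, the derivative of \<open>\<eta>\<^sup>2\<close> vanishes here and
        \<open>q1\<close> is bounded nearby.\<close>
      have D0: "D p = (\<lambda>v. 0)"
        using 3 by (simp add: fun_eq_iff D_def a1_def q1_def q2_def s_def step_def)
      obtain B where B: "\<forall>\<^sub>F x in at p. norm (q1 x) \<le> B"
        using bdd[OF contQ] unfolding q1_def by blast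
      have "((\<lambda>p :: real \<times> real \<times> real. (fst (snd p))\<^sup>2) has_derivative (\<lambda>v. 0)) (at p)"
        using 3 by (auto intro!: derivative_eq_intros)
      from has_derivative_zero_scaleR_bounded[OF this _ B] show ?thesis
        unfolding D0 f_def q1_def using 3 by simp
    qed
  qed
  have cont: "isCont (\<lambda>p. D p v) p" for p v
  proof (cases "fst p = 0 \<and> fst (snd p) = 0")
    case False
    let ?O = "{p :: real \<times> real. fst p \<noteq> 0 \<or> snd p \<noteq> 0}"
    have "?O = - {(0, 0)}" by (auto simp: prod_eq_iff)
    then have "open ?O" by (simp add: open_Compl)
    then have "isCont (\<lambda>p. step (fst p) (snd p)) (fst p, fst (snd p))"
      using ck_euc_continuous_on[OF ck_euc_step[of 0]] False
      by (simp add: continuous_on_eq_continuous_at)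
    then have "isCont s p"
      unfolding s_def
      using isCont_o2[of p "\<lambda>p. (fst p, fst (snd p))" "\<lambda>p. step (fst p) (snd p)"]
      by (simp add: isCont_Pair)
    then have sy: "isCont (\<lambda>p. s p * snd (snd p)) p"
      by (intro continuous_intros)
    have "isCont Q x" "isCont Q' x" for x
      using contQ Q' by (auto simp: continuous_on_eq_continuous_at)
    note QQ' = isCont_o2[OF sy this(1)] isCont_o2[OF sy this(2)]
    have "isCont q1 p" "isCont q2 p"
      unfolding q1_def q2_def by (rule QQ'(1)) (rule continuous_scaleR[OF \<open>isCont s p\<close> QQ'(2)])
    moreover have "isCont (\<lambda>p. a1 p v) p" "isCont (\<lambda>p. a2 p v) p"
      unfolding a1_def a2_def by (intro continuous_intros)+
    ultimately show ?thesis
      unfolding D_def by (intro continuous_intros)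
  next
    case True
    \<comment> \<open>Here the step itself is discontinuous: both coefficients tend to 0 while the
      other factors stay bounded.\<close>
    have "((\<lambda>p. a1 p v *\<^sub>R q1 p) \<longlongrightarrow> 0) (at p)"
    proof -
      obtain B where B: "\<forall>\<^sub>F x in at p. norm (q1 x) \<le> B"
        using bdd[OF contQ] unfolding q1_def by blast
      have "isCont (\<lambda>p. a1 p v) p"
        unfolding a1_def by (intro continuous_intros)
      then have "((\<lambda>p. a1 p v) \<longlongrightarrow> 0) (at p)"
        using True by (simp add: isCont_def a1_def)
      then show ?thesis
        by (rule lim_null_scaleR_bounded) (use B in \<open>auto elim: eventually_mono\<close>)
    qed
    moreover have "((\<lambda>p. a2 p v *\<^sub>R q2 p) \<longlongrightarrow> 0) (at p)"
    proof -
      obtain B where B: "\<forall>\<^sub>F x in at p. norm (Q' (s x * snd (snd x))) \<le> B"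
        using bdd[OF Q'] by blast
      have "norm (q2 x) \<le> norm (Q' (s x * snd (snd x)))" for x
        using s01[of x] unfolding q2_def by (simp add: mult_left_le_one_le)
      then have B2: "\<forall>\<^sub>F x in at p. a2 x v = 0 \<or> norm (q2 x) \<le> B"
        by (intro eventually_mono[OF B]) (use order_trans in blast)
      have "isCont (\<lambda>p. a2 p v) p"
        unfolding a2_def by (intro continuous_intros)
      then have "((\<lambda>p. a2 p v) \<longlongrightarrow> 0) (at p)"
        using True by (simp add: isCont_def a2_def)
      then show ?thesis
        by (rule lim_null_scaleR_bounded) (rule B2)
    qed
    ultimately have "((\<lambda>p. D p v) \<longlongrightarrow> 0) (at p)"
      unfolding D_def using tendsto_add by fastforce
    moreover have "D p v = 0"
      using True by (simp add: D_def a1_def a2_def)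
    ultimately show ?thesis by (simp add: isCont_def)
  qed
  have h: "higher_diff (Suc 0) UNIV f"
    by (rule higher_diff_SucI[OF open_UNIV deriv])
      (simp add: continuous_at_imp_continuous_on cont)
  have "higher_diff n UNIV f" if "enat n \<le> 1" for n
    by (rule higher_diff_antimono[OF h]) (use that in \<open>simp add: one_enat_def\<close>)
  then have "ck_euc 1 UNIV f"
    by (rule ck_eucI[OF open_UNIV _ subset_UNIV])
  then show ?thesis
    by (rule ck_euc_cong) (simp add: f_def s_def)
qed

section \<open>The phase rotation of one coordinate\<close>

text \<open>The weights of the two coordinates add up to \<open>1\<close>, so the phases of \<open>push\<close> below differ by exactly
  \<open>k\<close> times the step, while each phase vanishes to high order at the seam on which its own
  coordinate is not small.\<close>

definition twist_angle :: "real \<Rightarrow> real \<Rightarrow> real \<Rightarrow> complex \<Rightarrow> complex \<Rightarrow> real" where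
  "twist_angle r k \<tau> u v = k * (step \<tau> (r\<^sup>2 - (norm u)\<^sup>2 - (norm v)\<^sup>2) *
     ((norm v)\<^sup>2 / ((norm u)\<^sup>2 + (norm v)\<^sup>2)))"

definition twist :: "real \<Rightarrow> real \<Rightarrow> real \<Rightarrow> complex \<Rightarrow> complex \<Rightarrow> complex" where
  "twist r k \<tau> u v = cis (twist_angle r k \<tau> u v) * u"

lemma norm_twist [simp]: "norm (twist r k \<tau> u v) = norm u"
  by (simp add: twist_def twist_angle_def norm_mult)

lemma norm_sum_squares_eq_0: "(norm u)\<^sup>2 + (norm v)\<^sup>2 = 0 \<longleftrightarrow> u = 0 \<and> v = 0"
  for u v :: "'a::real_normed_vector"
  by (simp add: add_nonneg_eq_0_iff)

lemma ck_euc_twist: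
  "ck_euc m {p. snd (snd p) \<noteq> 0 \<and> (fst (snd p) \<noteq> 0 \<or> (norm (fst (snd (snd p))))\<^sup>2 + (norm (snd (snd (snd p))))\<^sup>2 \<noteq> r\<^sup>2)}
     (\<lambda>p. twist r (fst p) (fst (snd p)) (fst (snd (snd p))) (snd (snd (snd p))))" (is "ck_euc m ?S _")
proof -
  let ?\<tau> = "\<lambda>p :: real \<times> real \<times> complex \<times> complex. fst (snd p)"
  let ?u = "\<lambda>p :: real \<times> real \<times> complex \<times> complex. fst (snd (snd p))"
  let ?v = "\<lambda>p :: real \<times> real \<times> complex \<times> complex. snd (snd (snd p))"
  let ?q = "\<lambda>p. (?\<tau> p, r\<^sup>2 - (norm (?u p))\<^sup>2 - (norm (?v p))\<^sup>2)"
  have q: "ck_euc m ?S ?q"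
    by (intro ck_intros)
  have "ck_euc m ?S (\<lambda>p. step (fst (?q p)) (snd (?q p)))"
    by (rule ck_euc_compose[OF ck_euc_step q]) auto
  then have "ck_euc m ?S (\<lambda>p. step (?\<tau> p) (r\<^sup>2 - (norm (?u p))\<^sup>2 - (norm (?v p))\<^sup>2))"
    by simp
  then show ?thesis
    unfolding twist_def twist_angle_def
    by (intro ck_intros) (auto simp: norm_sum_squares_eq_0 prod_eq_iff)
qed

text \<open>The pairs \<open>(u, v)\<close> outside the ball of radius \<open>r\<close> together with those on the annulus: there
  \<open>u\<close> and \<open>v\<close> have the same argument and \<open>8 r\<^sup>2 |u| |v| = \<eta>\<^sup>2\<close> with \<open>\<eta> = r\<^sup>2 - |u|\<^sup>2 - |v|\<^sup>2\<close>, which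
  is what makes the factor \<open>\<eta>\<^sup>2\<close> of \<open>ck_euc_square_scaleR_step\<close> available.\<close>

definition flared :: "real \<Rightarrow> (complex \<times> complex) set" where
  "flared r = {(u, v). (u, v) \<noteq> 0 \<and> ((norm u)\<^sup>2 + (norm v)\<^sup>2 > r\<^sup>2 \<or>
     (8 * r\<^sup>2 * (norm v)\<^sup>2) *\<^sub>R u = (r\<^sup>2 - (norm u)\<^sup>2 - (norm v)\<^sup>2)\<^sup>2 *\<^sub>R v \<and>
     (8 * r\<^sup>2 * (norm u)\<^sup>2) *\<^sub>R v = (r\<^sup>2 - (norm u)\<^sup>2 - (norm v)\<^sup>2)\<^sup>2 *\<^sub>R u)}"

lemma flared_swap: "(u, v) \<in> flared r \<Longrightarrow> (v, u) \<in> flared r"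
  by (auto simp: flared_def zero_prod_def add.commute diff_right_commute)

text \<open>Near \<open>v \<noteq> 0\<close> the displacement \<open>(cis \<phi> - 1) u\<close> is
  rewritten with \<open>u = \<eta>\<^sup>2 v / (8 r\<^sup>2 |v|\<^sup>2)\<close>; near
  \<open>u \<noteq> 0\<close> the phase is rewritten with
  \<open>|v|\<^sup>2 = \<eta>\<^sup>4 / (64 r\<^sup>4 |u|\<^sup>2)\<close>. Either way a factor
  \<open>\<eta>\<^sup>2\<close> meets the step. Outside the ball the step is 0, so the same formulas
  hold there.\<close>

lemma ck_euc_1_twist:
  assumes "r > 0"
  shows "ck_euc 1 {p. snd (snd p) \<in> flared r}
     (\<lambda>p. twist r (fst p) (fst (snd p)) (fst (snd (snd p))) (snd (snd (snd p))))" (is "ck_euc 1 ?S ?f")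
proof (rule ck_euc_local)
  let ?k = "\<lambda>p :: real \<times> real \<times> complex \<times> complex. fst p"
  let ?\<tau> = "\<lambda>p :: real \<times> real \<times> complex \<times> complex. fst (snd p)"
  let ?u = "\<lambda>p :: real \<times> real \<times> complex \<times> complex. fst (snd (snd p))"
  let ?v = "\<lambda>p :: real \<times> real \<times> complex \<times> complex. snd (snd (snd p))"
  let ?\<eta> = "\<lambda>p. r\<^sup>2 - (norm (?u p))\<^sup>2 - (norm (?v p))\<^sup>2"
  let ?s = "\<lambda>p. step (?\<tau> p) (?\<eta> p)"
  let ?y = "\<lambda>p. ?k p * ((norm (?v p))\<^sup>2 / ((norm (?u p))\<^sup>2 + (norm (?v p))\<^sup>2))"
  fix p assume p: "p \<in> ?S"
  then consider "?v p \<noteq> 0" | "?u p \<noteq> 0"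
    by (auto simp: flared_def prod_eq_iff split_beta)
  then show "\<exists>T. open T \<and> p \<in> T \<and> ck_euc 1 (?S \<inter> T) ?f"
  proof cases
    case 1
    let ?T = "{p. ?v p \<noteq> 0}"
    have "open ?T" by (intro open_Collect_neq continuous_intros)
    moreover have "ck_euc 1 (?S \<inter> ?T) ?f"
    proof (rule ck_euc_cong)
      let ?q = "\<lambda>p. (?\<tau> p, ?\<eta> p, ?y p)"
      have "ck_euc 1 UNIV (\<lambda>p :: real \<times> real \<times> real.
          (fst (snd p))\<^sup>2 *\<^sub>R (cis (step (fst p) (fst (snd p)) * snd (snd p)) - 1))"
      proof (rule ck_euc_square_scaleR_step)
        show "((\<lambda>y. cis y - 1) has_vector_derivative (\<i> * cis y)) (at y)" for y
          unfolding has_vector_derivative_def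
          by (auto intro!: derivative_eq_intros has_derivative_cis
              simp: fun_eq_iff scaleR_conv_of_real)
      qed (intro continuous_intros)
      moreover have "ck_euc 1 (?S \<inter> ?T) ?q"
        by (intro ck_intros) (auto simp: norm_sum_squares_eq_0)
      ultimately have "ck_euc 1 (?S \<inter> ?T) (\<lambda>p. (fst (snd (?q p)))\<^sup>2 *\<^sub>R
          (cis (step (fst (?q p)) (fst (snd (?q p))) * snd (snd (?q p))) - 1))"
        by (rule ck_euc_compose) simp
      then have "ck_euc 1 (?S \<inter> ?T) (\<lambda>p. (?\<eta> p)\<^sup>2 *\<^sub>R (cis (?s p * ?y p) - 1))"
        by simp
      note \<psi> = this
      have c: "ck_euc 1 (?S \<inter> ?T) (\<lambda>p. 1 / (8 * r\<^sup>2 * (norm (?v p))\<^sup>2))"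
        by (intro ck_intros) (use assms in auto)
      have uv: "ck_euc 1 (?S \<inter> ?T) ?u" "ck_euc 1 (?S \<inter> ?T) ?v"
        by (intro ck_intros)+
      show "ck_euc 1 (?S \<inter> ?T)
          (\<lambda>p. ?u p + (1 / (8 * r\<^sup>2 * (norm (?v p))\<^sup>2)) *\<^sub>R ((?\<eta> p)\<^sup>2 *\<^sub>R (cis (?s p * ?y p) - 1) * ?v p))"
        by (rule ck_euc_add[OF uv(1) ck_euc_bilinear[OF bounded_bilinear_scaleR c
                ck_euc_bilinear[OF bounded_bilinear_mult \<psi> uv(2)]]])
    next
      fix p assume p: "p \<in> ?S \<inter> ?T"
      show "?u p + (1 / (8 * r\<^sup>2 * (norm (?v p))\<^sup>2)) *\<^sub>R ((?\<eta> p)\<^sup>2 *\<^sub>R (cis (?s p * ?y p) - 1) * ?v p) = ?f p"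
      proof (cases "(norm (?u p))\<^sup>2 + (norm (?v p))\<^sup>2 > r\<^sup>2")
        case True
        then show ?thesis by (simp add: twist_def twist_angle_def step_def)
      next
        case False
        then have "(8 * r\<^sup>2 * (norm (?v p))\<^sup>2) *\<^sub>R ?u p = (?\<eta> p)\<^sup>2 *\<^sub>R ?v p"
          using p by (auto simp: flared_def)
        note eq = this
        have "8 * r\<^sup>2 * (norm (?v p))\<^sup>2 \<noteq> 0"
          using p assms by simp
        then have "(1 / (8 * r\<^sup>2 * (norm (?v p))\<^sup>2)) *\<^sub>R ((?\<eta> p)\<^sup>2 *\<^sub>R ?v p) = ?u p"
          unfolding eq[symmetric] scaleR_scaleR by simp
        then have "(cis (?s p * ?y p) - 1) * ((1 / (8 * r\<^sup>2 * (norm (?v p))\<^sup>2)) *\<^sub>R ((?\<eta> p)\<^sup>2 *\<^sub>R ?v p))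
            = (cis (?s p * ?y p) - 1) * ?u p"
          by simp
        then show ?thesis
          by (simp add: twist_def twist_angle_def algebra_simps)
      qed
    qed
    ultimately show ?thesis
      using 1 by (intro exI[of _ ?T]) simp
  next
    case 2
    let ?T = "{p. ?u p \<noteq> 0}"
    let ?\<phi> = "\<lambda>p. ?k p * (((?\<eta> p)\<^sup>2 * ?s p) * ((?\<eta> p)\<^sup>2 / (64 * r^4 * (norm (?u p))\<^sup>2) / ((norm (?u p))\<^sup>2 + (norm (?v p))\<^sup>2)))"
    have "open ?T" by (intro open_Collect_neq continuous_intros)
    moreover have "ck_euc 1 (?S \<inter> ?T) ?f"
    proof (rule ck_euc_cong)
      \<comment> \<open>With \<open>Q\<close> the identity and third argument 1,
        \<open>ck_euc_square_scaleR_step\<close> speaks about \<open>\<eta>\<^sup>2\<close> times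
        the step.\<close>
      let ?q = "\<lambda>p. (?\<tau> p, ?\<eta> p, 1 :: real)"
      have "ck_euc 1 UNIV (\<lambda>p :: real \<times> real \<times> real.
          (fst (snd p))\<^sup>2 *\<^sub>R (step (fst p) (fst (snd p)) * snd (snd p)))"
        by (rule ck_euc_square_scaleR_step[of _ "\<lambda>y. 1"]) (auto intro!: derivative_eq_intros)
      moreover have "ck_euc 1 (?S \<inter> ?T) ?q"
        by (intro ck_intros)
      ultimately have "ck_euc 1 (?S \<inter> ?T) (\<lambda>p. (fst (snd (?q p)))\<^sup>2 *\<^sub>R
          (step (fst (?q p)) (fst (snd (?q p))) * snd (snd (?q p))))"
        by (rule ck_euc_compose) simp
      then have 1: "ck_euc 1 (?S \<inter> ?T) (\<lambda>p. (?\<eta> p)\<^sup>2 * ?s p)"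
        by simp
      have 2: "ck_euc 1 (?S \<inter> ?T) (\<lambda>p. (?\<eta> p)\<^sup>2 / (64 * r^4 * (norm (?u p))\<^sup>2) / ((norm (?u p))\<^sup>2 + (norm (?v p))\<^sup>2))"
        by (intro ck_intros) (use assms in \<open>auto simp: norm_sum_squares_eq_0\<close>)
      have "ck_euc 1 (?S \<inter> ?T) ?k" by (intro ck_intros)
      from ck_euc_bilinear[OF bounded_bilinear_mult this ck_euc_bilinear[OF bounded_bilinear_mult 1 2]]
      have 3: "ck_euc 1 (?S \<inter> ?T) ?\<phi>" .
      have "ck_euc 1 (?S \<inter> ?T) ?u" by (intro ck_intros)
      from ck_euc_bilinear[OF bounded_bilinear_mult ck_euc_cis[OF 3] this]
      show "ck_euc 1 (?S \<inter> ?T) (\<lambda>p. cis (?\<phi> p) * ?u p)" .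
    next
      fix p assume p: "p \<in> ?S \<inter> ?T"
      show "cis (?\<phi> p) * ?u p = ?f p"
      proof (cases "(norm (?u p))\<^sup>2 + (norm (?v p))\<^sup>2 > r\<^sup>2")
        case True
        then show ?thesis by (simp add: twist_def twist_angle_def step_def)
      next
        case False
        then have "(8 * r\<^sup>2 * (norm (?u p))\<^sup>2) *\<^sub>R ?v p = (?\<eta> p)\<^sup>2 *\<^sub>R ?u p"
          using p by (auto simp: flared_def)
        then have "norm ((8 * r\<^sup>2 * (norm (?u p))\<^sup>2) *\<^sub>R ?v p) = norm ((?\<eta> p)\<^sup>2 *\<^sub>R ?u p)"
          by simp
        then have "8 * r\<^sup>2 * (norm (?u p))\<^sup>2 * norm (?v p) = (?\<eta> p)\<^sup>2 * norm (?u p)"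
          by (simp add: abs_mult)
        moreover have "norm (?u p) > 0" using p by simp
        ultimately have "8 * r\<^sup>2 * norm (?u p) * norm (?v p) = (?\<eta> p)\<^sup>2"
          by (simp add: power2_eq_square)
        then have "(?\<eta> p)\<^sup>2 * (?\<eta> p)\<^sup>2 = (8 * r\<^sup>2 * norm (?u p) * norm (?v p))\<^sup>2"
          by (simp add: power2_eq_square)
        then have "(?\<eta> p)\<^sup>2 * (?\<eta> p)\<^sup>2 / (64 * r^4 * (norm (?u p))\<^sup>2) = (norm (?v p))\<^sup>2"
          using p assms by (simp add: power_mult_distrib field_simps power2_eq_square power4_eq_xxxx)
        then have "?s p * ((?\<eta> p)\<^sup>2 * (?\<eta> p)\<^sup>2 / (64 * r^4 * (norm (?u p))\<^sup>2)) / ((norm (?u p))\<^sup>2 + (norm (?v p))\<^sup>2)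
            = ?s p * (norm (?v p))\<^sup>2 / ((norm (?u p))\<^sup>2 + (norm (?v p))\<^sup>2)"
          by simp
        then show ?thesis
          by (simp add: twist_def twist_angle_def mult_ac)
      qed
    qed
    ultimately show ?thesis
      using 2 by (intro exI[of _ ?T]) simp
  qed
qed

text \<open>The chord \<open>|cis \<phi> - 1|\<close> is at most \<open>|\<phi>|\<close>, hence at
  most \<open>|k| |v|\<^sup>2 / (|u|\<^sup>2 + |v|\<^sup>2)\<close>, and on the annulus
  \<open>8 r\<^sup>2 |v|\<^sup>2 |u| = \<eta>\<^sup>2 |v|\<close>. So away from the origin the
  displacement is bounded by a multiple of \<open>\<eta>\<^sup>2\<close>, uniformly in
  \<open>\<tau>\<close>.\<close>

lemma norm_twist_diff_le:
  assumes "(u, v) \<in> flared r" "r > 0"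
  shows "norm (twist r k \<tau> u v - u) * (8 * r\<^sup>2) * ((norm u)\<^sup>2 + (norm v)\<^sup>2)
    \<le> \<bar>k\<bar> * (r\<^sup>2 - (norm u)\<^sup>2 - (norm v)\<^sup>2)\<^sup>2 * norm v"
proof (cases "(norm u)\<^sup>2 + (norm v)\<^sup>2 > r\<^sup>2")
  case True
  then show ?thesis by (simp add: twist_def twist_angle_def step_def)
next
  case False
  define \<rho> where "\<rho> = (norm u)\<^sup>2 + (norm v)\<^sup>2"
  define \<eta> where "\<eta> = r\<^sup>2 - (norm u)\<^sup>2 - (norm v)\<^sup>2"
  define \<phi> where "\<phi> = k * (step \<tau> \<eta> * ((norm v)\<^sup>2 / \<rho>))"
  have \<rho>: "\<rho> > 0"
    using assms(1) by (auto simp: \<rho>_def flared_def zero_prod_def sum_power2_gt_zero_iff)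
  have "(8 * r\<^sup>2 * (norm v)\<^sup>2) *\<^sub>R u = \<eta>\<^sup>2 *\<^sub>R v"
    using assms False by (auto simp: flared_def \<eta>_def)
  then have "norm ((8 * r\<^sup>2 * (norm v)\<^sup>2) *\<^sub>R u) = norm (\<eta>\<^sup>2 *\<^sub>R v)"
    by simp
  then have eq: "8 * r\<^sup>2 * (norm v)\<^sup>2 * norm u = \<eta>\<^sup>2 * norm v"
    by (simp add: abs_mult)
  have "norm (cis \<phi> - 1) = 2 * \<bar>sin (\<phi> / 2)\<bar>"
    using dist_exp_i_1[of \<phi>] by (simp add: cis_conv_exp)
  also have "\<dots> \<le> \<bar>\<phi>\<bar>"
    using abs_sin_x_le_abs_x[of "\<phi> / 2"] by simp
  also have "\<dots> = \<bar>k\<bar> * (step \<tau> \<eta> * ((norm v)\<^sup>2 / \<rho>))"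
    using \<rho> step_bounds[of \<tau> \<eta>] by (simp add: \<phi>_def abs_mult)
  also have "\<dots> \<le> \<bar>k\<bar> * (1 * ((norm v)\<^sup>2 / \<rho>))"
    using \<rho> step_bounds[of \<tau> \<eta>] by (intro mult_left_mono mult_right_mono) auto
  finally have *: "norm (cis \<phi> - 1) * \<rho> \<le> \<bar>k\<bar> * (norm v)\<^sup>2"
    using \<rho> by (simp add: field_simps)
  have "twist r k \<tau> u v - u = (cis \<phi> - 1) * u"
    by (simp add: twist_def twist_angle_def \<phi>_def \<eta>_def \<rho>_def algebra_simps)
  then have "norm (twist r k \<tau> u v - u) * (8 * r\<^sup>2) * \<rho> = (norm (cis \<phi> - 1) * \<rho>) * (8 * r\<^sup>2 * norm u)"
    by (simp add: norm_mult mult_ac)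
  also have "\<dots> \<le> (\<bar>k\<bar> * (norm v)\<^sup>2) * (8 * r\<^sup>2 * norm u)"
    using * by (rule mult_right_mono) auto
  also have "\<dots> = \<bar>k\<bar> * \<eta>\<^sup>2 * norm v"
    using eq by (simp add: mult_ac)
  finally show ?thesis by (simp add: \<rho>_def \<eta>_def)
qed

section \<open>The phase rotation of both coordinates\<close>

definition push :: "real \<Rightarrow> real \<Rightarrow> real \<Rightarrow> complex \<times> complex \<Rightarrow> complex \<times> complex" where
  "push r k \<tau> w = (twist r (- k) \<tau> (fst w) (snd w), twist r k \<tau> (snd w) (fst w))"

lemma norm_push [simp]: "norm (push r k \<tau> w) = norm w"
  by (simp add: push_def norm_prod_def)

text \<open>The phases depend only on the moduli, which \<open>push\<close> preserves; at the image
  they are therefore the same up to the sign of \<open>k\<close> and cancel.\<close>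

lemma push_minus: "push r (- k) \<tau> (push r k \<tau> w) = w"
proof -
  \<comment> \<open>\<open>k'\<close> is free because only the modulus of the last argument enters
    the phase.\<close>
  have "twist r (- k) \<tau> (twist r k \<tau> u v) (twist r k' \<tau> v u) = u" for k k' and u v
  proof -
    have "twist_angle r (- k) \<tau> (twist r k \<tau> u v) (twist r k' \<tau> v u) = - twist_angle r k \<tau> u v"
      by (simp add: twist_angle_def)
    then show ?thesis
      by (simp add: twist_def[of _ "- k"]) (simp add: twist_def cis_mult flip: mult.assoc)
  qed
  from this[of k "fst w" "snd w" "-k"] this[of "-k" "fst w" "snd w"] this[of k "snd w" "fst w"] show ?thesis
    by (simp add: push_def)
qed

lemma norm_prod_power2: "(norm w)\<^sup>2 = (norm (fst w))\<^sup>2 + (norm (snd w))\<^sup>2"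
  by (simp add: norm_prod_def)

text \<open>The sphere itself is included because the step is 0 at \<open>\<eta> = 0\<close>, also
  for \<open>\<tau> = 0\<close>.\<close>

lemma push_outside: "r > 0 \<Longrightarrow> norm w \<ge> r \<Longrightarrow> push r k \<tau> w = w"
  using power_mono[of r "norm w" 2] unfolding norm_prod_power2
  by (simp add: push_def twist_def twist_angle_def step_def prod_eq_iff)

lemma push_0 [simp]: "push r 0 \<tau> w = w"
  by (simp add: push_def twist_def twist_angle_def)

lemma ck_euc_push:
  "ck_euc m {p. snd (snd p) \<noteq> 0 \<and> (fst (snd p) \<noteq> 0 \<or> norm (snd (snd p)) \<noteq> r)}
     (\<lambda>p. push r (fst p) (fst (snd p)) (snd (snd p)))"
  if "r > 0"
proof -
  have iff: "(norm u)\<^sup>2 + (norm v)\<^sup>2 = r\<^sup>2 \<longleftrightarrow> norm (u, v) = r" for u v :: complex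
    using that unfolding norm_prod_def
    by (metis fst_conv less_eq_real_def real_sqrt_abs abs_of_pos real_sqrt_eq_iff snd_conv)
  let ?S = "{p :: real \<times> real \<times> complex \<times> complex. snd (snd p) \<noteq> 0 \<and> (fst (snd p) \<noteq> 0 \<or> norm (snd (snd p)) \<noteq> r)}"
  let ?g = "\<lambda>p. twist r (fst p) (fst (snd p)) (fst (snd (snd p))) (snd (snd (snd p)))"
  let ?q1 = "\<lambda>p :: real \<times> real \<times> complex \<times> complex. (- fst p, fst (snd p), snd (snd p))"
  let ?q2 = "\<lambda>p :: real \<times> real \<times> complex \<times> complex. (fst p, fst (snd p), snd (snd (snd p)), fst (snd (snd p)))"
  have "ck_euc m ?S ?q1" "ck_euc m ?S ?q2"
    by (intro ck_intros)+
  note q = this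
  have 1: "ck_euc m ?S (\<lambda>p. ?g (?q1 p))"
    by (rule ck_euc_compose[OF ck_euc_twist[of m r] q(1)]) (auto simp: iff)
  have 2: "ck_euc m ?S (\<lambda>p. ?g (?q2 p))"
    by (rule ck_euc_compose[OF ck_euc_twist[of m r] q(2)])
      (auto simp: iff zero_prod_def norm_prod_def add.commute)
  from ck_euc_Pair[OF 1 2] show ?thesis by (simp add: push_def)
qed

lemma ck_euc_1_push:
  "ck_euc 1 {p. snd (snd p) \<in> flared r} (\<lambda>p. push r (fst p) (fst (snd p)) (snd (snd p)))"
  if "r > 0"
proof -
  let ?S = "{p :: real \<times> real \<times> complex \<times> complex. snd (snd p) \<in> flared r}"
  let ?g = "\<lambda>p. twist r (fst p) (fst (snd p)) (fst (snd (snd p))) (snd (snd (snd p)))"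
  let ?q1 = "\<lambda>p :: real \<times> real \<times> complex \<times> complex. (- fst p, fst (snd p), snd (snd p))"
  let ?q2 = "\<lambda>p :: real \<times> real \<times> complex \<times> complex. (fst p, fst (snd p), snd (snd (snd p)), fst (snd (snd p)))"
  have "ck_euc 1 ?S ?q1" "ck_euc 1 ?S ?q2"
    by (intro ck_intros)+
  note q = this
  have 1: "ck_euc 1 ?S (\<lambda>p. ?g (?q1 p))"
    by (rule ck_euc_compose[OF ck_euc_1_twist[OF that] q(1)]) simp
  have 2: "ck_euc 1 ?S (\<lambda>p. ?g (?q2 p))"
    by (rule ck_euc_compose[OF ck_euc_1_twist[OF that] q(2)]) (auto intro: flared_swap)
  from ck_euc_Pair[OF 1 2] show ?thesis by (simp add: push_def)
qed

lemma norm_push_diff_le: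
  assumes "w \<in> flared r" "r > 0"
  shows "norm (push r k \<tau> w - w) * (4 * r\<^sup>2) * norm w \<le> \<bar>k\<bar> * (r\<^sup>2 - (norm w)\<^sup>2)\<^sup>2"
proof -
  obtain u v where w: "w = (u, v)" by fastforce
  have "norm w > 0"
    using assms(1) by (auto simp: flared_def)
  have "norm (push r k \<tau> w - w) \<le> norm (twist r (- k) \<tau> u v - u) + norm (twist r k \<tau> v u - v)"
    by (simp add: push_def w norm_Pair_le)
  then have "norm (push r k \<tau> w - w) * ((8 * r\<^sup>2) * (norm w)\<^sup>2)
      \<le> (norm (twist r (- k) \<tau> u v - u) + norm (twist r k \<tau> v u - v)) * ((8 * r\<^sup>2) * (norm w)\<^sup>2)"
    by (rule mult_right_mono) simp
  also have "\<dots> \<le> \<bar>k\<bar> * (r\<^sup>2 - (norm w)\<^sup>2)\<^sup>2 * norm v + \<bar>k\<bar> * (r\<^sup>2 - (norm w)\<^sup>2)\<^sup>2 * norm u"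
    using norm_twist_diff_le[of u v r "-k" \<tau>] norm_twist_diff_le[of v u r k \<tau>] assms flared_swap[of u v r]
    by (simp add: w norm_prod_power2 algebra_simps)
  also have "\<dots> \<le> \<bar>k\<bar> * (r\<^sup>2 - (norm w)\<^sup>2)\<^sup>2 * (norm w) + \<bar>k\<bar> * (r\<^sup>2 - (norm w)\<^sup>2)\<^sup>2 * (norm w)"
    using norm_fst_le[of u v] norm_snd_le[of v u] by (intro add_mono mult_left_mono) (auto simp: w)
  finally have "(norm (push r k \<tau> w - w) * (4 * r\<^sup>2) * norm w) * (2 * norm w)
      \<le> (\<bar>k\<bar> * (r\<^sup>2 - (norm w)\<^sup>2)\<^sup>2) * (2 * norm w)"
    by (simp add: power2_eq_square mult_ac)
  then show ?thesis
    by (rule mult_right_le_imp_le) (use \<open>norm w > 0\<close> in simp)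
qed

section \<open>The two annuli\<close>

text \<open>The index \<open>j = 1, 2\<close> becomes real and imaginary part, so a rotation of the
  index becomes multiplication by \<open>cis \<theta>\<close>; dividing by \<open>sqrt 2\<close>
  makes the map an isometry.\<close>

definition diag :: "R4 \<Rightarrow> complex \<times> complex" where
  "diag z = (Complex ((Re (fst z) + Im (fst z)) / sqrt 2) ((Re (snd z) + Im (snd z)) / sqrt 2),
             Complex ((Re (fst z) - Im (fst z)) / sqrt 2) ((Re (snd z) - Im (snd z)) / sqrt 2))"

definition undiag :: "complex \<times> complex \<Rightarrow> R4" where
  "undiag w = (Complex ((Re (fst w) + Re (snd w)) / sqrt 2) ((Re (fst w) - Re (snd w)) / sqrt 2),
               Complex ((Im (fst w) + Im (snd w)) / sqrt 2) ((Im (fst w) - Im (snd w)) / sqrt 2))"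

lemma bounded_linear_diag: "bounded_linear diag"
  unfolding linear_conv_bounded_linear[symmetric]
  by (rule linearI) (simp_all add: diag_def complex_eq_iff field_simps)

lemma bounded_linear_undiag: "bounded_linear undiag"
  unfolding linear_conv_bounded_linear[symmetric]
  by (rule linearI) (simp_all add: undiag_def complex_eq_iff field_simps)

lemma undiag_diag [simp]: "undiag (diag z) = z"
  by (simp add: diag_def undiag_def prod_eq_iff complex_eq_iff field_simps)

lemma diag_undiag [simp]: "diag (undiag w) = w"
  by (simp add: diag_def undiag_def prod_eq_iff complex_eq_iff field_simps)

lemma diag_eq_iff: "diag z = diag z' \<longleftrightarrow> z = z'"
  by (metis undiag_diag)

lemma diag_eq_0_iff [simp]: "diag z = 0 \<longleftrightarrow> z = 0"
  using bounded_linear.linear[OF bounded_linear_diag] by (metis diag_eq_iff linear_0)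

lemma norm_diag [simp]: "norm (diag z) = norm z"
proof -
  have "(norm (diag z))\<^sup>2 = (norm z)\<^sup>2"
    by (simp add: diag_def norm_prod_power2 cmod_power2 power_divide power2_sum power2_diff)
      (simp add: field_simps)
  then show ?thesis by simp
qed

lemma norm_power2_diag: "(norm z)\<^sup>2 = (norm (fst (diag z)))\<^sup>2 + (norm (snd (diag z)))\<^sup>2"
  using norm_prod_power2[of "diag z"] by simp

lemma norm_undiag [simp]: "norm (undiag w) = norm w"
  by (metis diag_undiag norm_diag)

lemma diag_rot: "diag (rot \<theta> z) = (cis \<theta> * fst (diag z), cis \<theta> * snd (diag z))"
  by (simp add: diag_def rot_def prod_eq_iff complex_eq_iff field_simps)

lemma diag_swap_xy: "diag (swap_xy z) = (fst (diag z), - snd (diag z))"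
  by (simp add: diag_def swap_xy_def prod_eq_iff complex_eq_iff field_simps)

text \<open>This expression is unchanged by a common rotation of the two coordinates and changes
  sign when one of them is negated; so \<open>rot\<close> and \<open>swap_xy\<close> both preserve
  isotropic planes.\<close>

lemma omega0_diag:
  "omega0 z z' = snd (diag z) \<bullet> fst (diag z') - fst (diag z) \<bullet> snd (diag z')"
  by (simp add: omega0_def diag_def inner_complex_def field_simps)

lemma rot_rot: "rot \<alpha> (rot \<beta> z) = rot (\<alpha> + \<beta>) z"
  by (subst diag_eq_iff[symmetric]) (simp add: diag_rot cis_mult flip: mult.assoc)

lemma rot_0 [simp]: "rot 0 z = z"
  by (simp add: rot_def)

lemma swap_xy_rot: "swap_xy (rot \<theta> z) = rot \<theta> (swap_xy z)"
  by (subst diag_eq_iff[symmetric]) (simp add: diag_rot diag_swap_xy)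

lemma norm_rot [simp]: "norm (rot \<theta> z) = norm z"
proof -
  have "norm (diag (rot \<theta> z)) = norm (diag z)"
    unfolding diag_rot by (simp add: norm_prod_def norm_mult del: norm_diag)
  then show ?thesis by simp
qed

lemma norm_swap_xy [simp]: "norm (swap_xy z) = norm z"
proof -
  have "norm (diag (swap_xy z)) = norm (diag z)"
    unfolding diag_swap_xy by (simp add: norm_prod_def del: norm_diag)
  then show ?thesis by simp
qed

text \<open>In the coordinates \<open>diag\<close> the curve \<open>\<gamma>\<close> is the quarter of the circle of radius \<open>r\<close> about \<open>(r, r)\<close>
  that is tangent to the two axes.\<close>

lemma gammaE:
  assumes "z \<in> gamma r" "r > 0"
  obtains a b where "diag z = (of_real a, of_real b)" "0 \<le> a" "0 \<le> b" "(a, b) \<noteq> (0, 0)"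
    "a\<^sup>2 + b\<^sup>2 \<le> r\<^sup>2" "8 * r\<^sup>2 * (a * b) = (r\<^sup>2 - a\<^sup>2 - b\<^sup>2)\<^sup>2"
proof -
  obtain s where s: "3 * pi / 4 \<le> s" "s \<le> 5 * pi / 4"
    "z = (Complex (sqrt 2 * r + r * cos s) (r * sin s), 0)"
    using assms(1) by (auto simp: gamma_def)
  \<comment> \<open>The point will be \<open>(r - r c, r - r d)\<close>: seen from the centre
    \<open>(r, r)\<close> of the circle it lies in the direction \<open>- (c, d)\<close>. For these
    \<open>s\<close> both cosines are at most 0.\<close>
  define c where "c = - cos (s - pi / 4)"
  define d where "d = - cos (s + pi / 4)"
  have "c = - (cos s + sin s) / sqrt 2" "d = - (cos s - sin s) / sqrt 2"
    unfolding c_def d_def cos_diff cos_add cos_45 sin_45 by (simp_all add: field_simps)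
  then have *: "cos s + sin s = - (c * sqrt 2)" "cos s - sin s = - (d * sqrt 2)"
    by (simp_all add: field_simps)
  have "c\<^sup>2 + d\<^sup>2 = 1"
  proof -
    have "(cos s + sin s)\<^sup>2 + (cos s - sin s)\<^sup>2 = 2"
      using sin_cos_squared_add[of s] by (simp add: power2_sum power2_diff)
    then show ?thesis
      unfolding * by (simp add: power_mult_distrib)
  qed
  have "c \<ge> 0"
  proof -
    have "cos (s - pi / 4) = - cos (s - pi / 4 - pi)"
      using cos_diff[of "s - pi / 4" pi] by simp
    moreover have "cos (s - pi / 4 - pi) \<ge> 0"
      using s by (intro cos_ge_zero) auto
    ultimately show ?thesis by (simp add: c_def)
  qed
  have "d \<ge> 0"
  proof -
    have "cos (s + pi / 4) = - cos (s + pi / 4 - pi)"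
      using cos_diff[of "s + pi / 4" pi] by simp
    moreover have "cos (s + pi / 4 - pi) \<ge> 0"
      using s by (intro cos_ge_zero) auto
    ultimately show ?thesis by (simp add: d_def)
  qed
  have le1: "c \<le> 1" "d \<le> 1"
    using cos_ge_minus_one[of "s - pi / 4"] cos_ge_minus_one[of "s + pi / 4"]
    unfolding c_def d_def by linarith+
  have cd1: "c + d \<ge> 1"
  proof (rule power2_le_imp_le)
    show "1\<^sup>2 \<le> (c + d)\<^sup>2"
      using \<open>c\<^sup>2 + d\<^sup>2 = 1\<close> \<open>c \<ge> 0\<close> \<open>d \<ge> 0\<close> by (simp add: power2_sum)
  qed (use \<open>c \<ge> 0\<close> \<open>d \<ge> 0\<close> in simp)
  define a where "a = r * (1 - c)"
  define b where "b = r * (1 - d)"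
  \<comment> \<open>Both expressions depend on \<open>c + d\<close> alone; eliminating it gives the
    relation between \<open>a\<close> and \<open>b\<close>.\<close>
  have sq: "a\<^sup>2 + b\<^sup>2 = r\<^sup>2 * (3 - 2 * (c + d))"
    using \<open>c\<^sup>2 + d\<^sup>2 = 1\<close> unfolding a_def b_def by algebra
  have ab: "2 * (a * b) = r\<^sup>2 * (1 - (c + d))\<^sup>2"
    using \<open>c\<^sup>2 + d\<^sup>2 = 1\<close> unfolding a_def b_def by algebra
  show ?thesis
  proof
    show "diag z = (of_real a, of_real b)"
    proof -
      have "sqrt 2 * r + r * (cos s + sin s) = sqrt 2 * a" "sqrt 2 * r + r * (cos s - sin s) = sqrt 2 * b"
        unfolding * by (simp_all add: a_def b_def algebra_simps)
      then have "sqrt 2 * r + r * cos s + r * sin s = sqrt 2 * a" "sqrt 2 * r + r * cos s - r * sin s = sqrt 2 * b"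
        by (simp_all add: algebra_simps)
      then show ?thesis
        by (simp add: s(3) diag_def complex_eq_iff)
    qed
    show "0 \<le> a" "0 \<le> b" using le1 assms by (simp_all add: a_def b_def)
    show "(a, b) \<noteq> (0, 0)"
    proof
      assume "(a, b) = (0, 0)"
      then have "c = 1" "d = 1" using assms by (auto simp: a_def b_def)
      with \<open>c\<^sup>2 + d\<^sup>2 = 1\<close> show False by simp
    qed
    have "r\<^sup>2 * (3 - 2 * (c + d)) \<le> r\<^sup>2 * 1"
      using cd1 by (intro mult_left_mono) auto
    then show "a\<^sup>2 + b\<^sup>2 \<le> r\<^sup>2"
      unfolding sq by simp
    have "r\<^sup>2 - a\<^sup>2 - b\<^sup>2 = r\<^sup>2 - (a\<^sup>2 + b\<^sup>2)" by simp
    also have "\<dots> = r\<^sup>2 * (2 * (c + d - 1))"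
      unfolding sq by (simp add: algebra_simps)
    finally have eq: "r\<^sup>2 - a\<^sup>2 - b\<^sup>2 = r\<^sup>2 * (2 * (c + d - 1))" .
    have "(r\<^sup>2 - a\<^sup>2 - b\<^sup>2)\<^sup>2 = 4 * r\<^sup>2 * (r\<^sup>2 * (1 - (c + d))\<^sup>2)"
      unfolding eq by algebra
    then show "8 * r\<^sup>2 * (a * b) = (r\<^sup>2 - a\<^sup>2 - b\<^sup>2)\<^sup>2"
      unfolding ab[symmetric] by simp
  qed
qed

text \<open>A common unit factor takes the point to the real pair of \<open>gammaE\<close>. The
  scalar relation there becomes the vector equations of \<open>flared\<close>, and the equal
  arguments make the moment map of the rotations vanish, which is the third claim.\<close>

lemma Orb_gamma_flared:
  assumes "z \<in> Orb (gamma r)" "r > 0"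
  shows "diag z \<in> flared r" "norm z \<le> r" "Im (fst (diag z) * cnj (snd (diag z))) = 0"
proof -
  obtain \<theta> z0 where z: "z = rot \<theta> z0" "z0 \<in> gamma r"
    using assms(1) by (auto simp: Orb_def)
  obtain a b where ab: "diag z0 = (of_real a, of_real b)" "0 \<le> a" "0 \<le> b" "(a, b) \<noteq> (0, 0)"
    "a\<^sup>2 + b\<^sup>2 \<le> r\<^sup>2" "8 * r\<^sup>2 * (a * b) = (r\<^sup>2 - a\<^sup>2 - b\<^sup>2)\<^sup>2"
    using gammaE[OF z(2) assms(2)] by metis
  have dz: "diag z = (cis \<theta> * of_real a, cis \<theta> * of_real b)"
    by (simp add: z diag_rot ab)
  have "(8 * r\<^sup>2 * b\<^sup>2) *\<^sub>R (cis \<theta> * of_real a) = (8 * r\<^sup>2 * (a * b)) *\<^sub>R (cis \<theta> * of_real b)"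
    "(8 * r\<^sup>2 * a\<^sup>2) *\<^sub>R (cis \<theta> * of_real b) = (8 * r\<^sup>2 * (a * b)) *\<^sub>R (cis \<theta> * of_real a)"
    by (simp_all add: scaleR_conv_of_real power2_eq_square)
  then show "diag z \<in> flared r"
    using ab(4) unfolding flared_def dz ab(6) by (auto simp: norm_mult zero_prod_def)
  have "(norm z)\<^sup>2 \<le> r\<^sup>2"
    unfolding norm_power2_diag dz using ab(5) by (simp add: norm_mult)
  then show "norm z \<le> r"
    by (rule power2_le_imp_le) (use assms(2) in simp)
  show "Im (fst (diag z) * cnj (snd (diag z))) = 0"
    unfolding dz by (simp add: algebra_simps)
qed

text \<open>For \<open>|z| = r\<close> the relation forces \<open>a b = 0\<close>; negating the
  second coordinate is then a rotation by \<open>pi\<close> if \<open>a = 0\<close> and the identity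
  if \<open>b = 0\<close>.\<close>

lemma swap_xy_gamma_boundary:
  assumes "z \<in> gamma r" "r > 0" "norm z = r"
  obtains \<delta> where "swap_xy z = rot \<delta> z"
proof -
  obtain a b where ab: "diag z = (of_real a, of_real b)" "0 \<le> a" "0 \<le> b" "(a, b) \<noteq> (0, 0)"
    "a\<^sup>2 + b\<^sup>2 \<le> r\<^sup>2" "8 * r\<^sup>2 * (a * b) = (r\<^sup>2 - a\<^sup>2 - b\<^sup>2)\<^sup>2"
    using gammaE[OF assms(1,2)] by metis
  have "(norm z)\<^sup>2 = a\<^sup>2 + b\<^sup>2"
    unfolding norm_power2_diag ab(1) by simp
  then have "8 * r\<^sup>2 * (a * b) = 0"
    using assms(3) ab(6) by simp
  then consider "a = 0" | "b = 0" using assms(2) by auto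
  then show ?thesis
  proof cases
    case 1
    then have "swap_xy z = rot pi z"
      by (subst diag_eq_iff[symmetric]) (simp add: diag_rot diag_swap_xy ab)
    then show ?thesis by (rule that)
  next
    case 2
    then have "swap_xy z = rot 0 z"
      by (subst diag_eq_iff[symmetric]) (simp add: diag_rot diag_swap_xy ab)
    then show ?thesis by (rule that)
  qed
qed

lemma rot_in_Orb: "z \<in> X \<Longrightarrow> rot \<theta> z \<in> Orb X"
  by (auto simp: Orb_def)

text \<open>At radius \<open>r\<close> the swap acts within a single rotation orbit, so there the
  two annuli have the same circles.\<close>

lemma Orb_boundary:
  assumes "r > 0" "norm z = r"
  shows "z \<in> Orb (gamma r) \<longleftrightarrow> z \<in> Orb (swap_xy ` gamma r)"
proof
  assume "z \<in> Orb (gamma r)"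
  then obtain \<theta> z0 where z: "z = rot \<theta> z0" "z0 \<in> gamma r"
    by (auto simp: Orb_def)
  then obtain \<delta> where "swap_xy z0 = rot \<delta> z0"
    using swap_xy_gamma_boundary[of z0 r] assms by auto
  then have "z = rot (\<theta> - \<delta>) (swap_xy z0)"
    by (simp add: z rot_rot)
  then show "z \<in> Orb (swap_xy ` gamma r)"
    using rot_in_Orb[of "swap_xy z0" "swap_xy ` gamma r"] z by simp
next
  assume "z \<in> Orb (swap_xy ` gamma r)"
  then obtain \<theta> z0 where z: "z = rot \<theta> (swap_xy z0)" "z0 \<in> gamma r"
    by (auto simp: Orb_def)
  then obtain \<delta> where "swap_xy z0 = rot \<delta> z0"
    using swap_xy_gamma_boundary[of z0 r] assms by auto
  then have "z = rot (\<theta> + \<delta>) z0"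
    by (simp add: z rot_rot)
  then show "z \<in> Orb (gamma r)"
    using rot_in_Orb[of z0 "gamma r"] z by simp
qed

section \<open>The phase rotation on \<open>R4\<close> and its final stage\<close>

definition bend :: "real \<Rightarrow> real \<Rightarrow> real \<Rightarrow> R4 \<Rightarrow> R4" where
  "bend r k \<tau> z = undiag (push r k \<tau> (diag z))"

lemma norm_bend [simp]: "norm (bend r k \<tau> z) = norm z"
  by (simp add: bend_def)

lemma bend_eq_0_iff [simp]: "bend r k \<tau> z = 0 \<longleftrightarrow> z = 0"
  by (metis norm_bend norm_eq_zero)

lemma bend_minus: "bend r (- k) \<tau> (bend r k \<tau> z) = z"
  by (simp add: bend_def push_minus)

lemma bend_outside: "r > 0 \<Longrightarrow> norm z \<ge> r \<Longrightarrow> bend r k \<tau> z = z"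
  by (simp add: bend_def push_outside)

lemma bend_0 [simp]: "bend r 0 \<tau> z = z"
  by (simp add: bend_def)

lemma inj_bend: "inj (bend r k \<tau>)"
  by (metis bend_minus injI)

lemma ck_euc_bend:
  assumes "r > 0"
  shows "ck_euc m {p. snd (snd p) \<noteq> 0 \<and> (fst (snd p) \<noteq> 0 \<or> norm (snd (snd p)) \<noteq> r)}
     (\<lambda>p. bend r (fst p) (fst (snd p)) (snd (snd p)))" (is "ck_euc m ?S _")
proof -
  have q: "ck_euc m ?S (\<lambda>p. (fst p, fst (snd p), diag (snd (snd p))))"
    by (intro ck_intros ck_euc_bounded_linear[OF bounded_linear_diag])
  have "ck_euc m ?S (\<lambda>p. push r (fst p) (fst (snd p)) (diag (snd (snd p))))"
    using ck_euc_compose[OF ck_euc_push[OF assms, of m] q] by simp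
  from ck_euc_bounded_linear[OF bounded_linear_undiag this] show ?thesis
    by (simp add: bend_def)
qed

lemma ck_euc_1_bend:
  assumes "r > 0"
  shows "ck_euc 1 {p. diag (snd (snd p)) \<in> flared r}
     (\<lambda>p. bend r (fst p) (fst (snd p)) (snd (snd p)))" (is "ck_euc 1 ?S _")
proof -
  have q: "ck_euc 1 ?S (\<lambda>p. (fst p, fst (snd p), diag (snd (snd p))))"
    by (intro ck_intros ck_euc_bounded_linear[OF bounded_linear_diag])
  have "ck_euc 1 ?S (\<lambda>p. push r (fst p) (fst (snd p)) (diag (snd (snd p))))"
    using ck_euc_compose[OF ck_euc_1_push[OF assms] q] by simp
  from ck_euc_bounded_linear[OF bounded_linear_undiag this] show ?thesis
    by (simp add: bend_def)
qed

lemma norm_bend_diff_le: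
  assumes "diag z \<in> flared r" "r > 0"
  shows "norm (bend r k \<tau> z - z) * (4 * r\<^sup>2) * norm z \<le> \<bar>k\<bar> * (r\<^sup>2 - (norm z)\<^sup>2)\<^sup>2"
proof -
  have "diag (bend r k \<tau> z - z) = push r k \<tau> (diag z) - diag z"
    using bounded_linear.linear[OF bounded_linear_diag] by (simp add: bend_def linear_diff)
  then have "norm (bend r k \<tau> z - z) = norm (push r k \<tau> (diag z) - diag z)"
    by (metis norm_diag)
  then show ?thesis
    using norm_push_diff_le[OF assms, of k \<tau>] by simp
qed

lemma flared_outside: "r > 0 \<Longrightarrow> norm z > r \<Longrightarrow> diag z \<in> flared r"
  using power_strict_mono[of r "norm z" 2] unfolding norm_power2_diag
  by (cases "diag z") (auto simp: flared_def zero_prod_def)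

lemma flared_nonzero: "diag z \<in> flared r \<Longrightarrow> z \<noteq> 0"
  using diag_eq_0_iff[of z] by (cases "diag z") (auto simp: flared_def)

text \<open>The phase of the first coordinate for \<open>k = pi\<close> and
  \<open>\<tau> = 0\<close>, where the step is 1 inside the open ball.\<close>

definition turn :: "R4 \<Rightarrow> real" where
  "turn z = - (pi * ((norm (snd (diag z)))\<^sup>2 / (norm z)\<^sup>2))"

text \<open>The weights add up to 1, so the phase of the second coordinate is
  \<open>pi + turn z\<close>: the common part is a rotation, and the extra \<open>pi\<close> is the
  sign by which \<open>swap_xy\<close> acts.\<close>

lemma bend_pi:
  assumes "norm z < r" "z \<noteq> 0"
  shows "bend r pi 0 z = rot (turn z) (swap_xy z)"
proof (subst diag_eq_iff[symmetric])
  define u where "u = fst (diag z)"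
  define v where "v = snd (diag z)"
  have \<rho>: "(norm z)\<^sup>2 = (norm u)\<^sup>2 + (norm v)\<^sup>2"
    unfolding norm_power2_diag u_def v_def by simp
  have lt: "(norm z)\<^sup>2 < r\<^sup>2"
    using assms by (intro power_strict_mono) auto
  have pos: "(norm u)\<^sup>2 + (norm v)\<^sup>2 > 0"
    using assms \<rho> by (metis zero_less_norm_iff zero_less_power)
  have s: "step 0 (r\<^sup>2 - (norm u)\<^sup>2 - (norm v)\<^sup>2) = 1" "step 0 (r\<^sup>2 - (norm v)\<^sup>2 - (norm u)\<^sup>2) = 1"
    using lt unfolding \<rho> by (auto simp: step_def)
  have "pi * ((norm u)\<^sup>2 / ((norm u)\<^sup>2 + (norm v)\<^sup>2)) = pi + turn z"
  proof -
    have "(norm u)\<^sup>2 / ((norm u)\<^sup>2 + (norm v)\<^sup>2) = 1 - (norm v)\<^sup>2 / ((norm u)\<^sup>2 + (norm v)\<^sup>2)"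
      by (rule eq_diff_eq[THEN iffD2]) (use pos in \<open>auto simp: add_divide_distrib[symmetric]\<close>)
    then show ?thesis
      by (simp add: turn_def \<rho> v_def[symmetric] right_diff_distrib)
  qed
  then have "cis (twist_angle r pi 0 v u) = - cis (turn z)"
    by (simp add: twist_angle_def s add.commute[of "(norm v)\<^sup>2"] cis_mult[symmetric] del: cis_mult)
  moreover have "twist_angle r (- pi) 0 u v = turn z"
    by (simp add: twist_angle_def s turn_def \<rho> v_def[symmetric])
  ultimately show "diag (bend r pi 0 z) = diag (rot (turn z) (swap_xy z))"
    by (simp add: bend_def push_def twist_def diag_rot diag_swap_xy u_def v_def)
qed

lemma turn_rot: "turn (rot \<theta> z) = turn z"
  by (simp add: turn_def diag_rot norm_mult)

lemma bend_pi_image_Orb: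
  assumes "r > 0"
  shows "bend r pi 0 ` Orb (gamma r) = Orb (swap_xy ` gamma r)"
proof (intro equalityI subsetI)
  fix z' assume "z' \<in> bend r pi 0 ` Orb (gamma r)"
  then obtain z where z: "z \<in> Orb (gamma r)" "z' = bend r pi 0 z" by auto
  then obtain \<theta> z0 where z0: "z = rot \<theta> z0" "z0 \<in> gamma r"
    by (auto simp: Orb_def)
  have "z \<noteq> 0" "norm z \<le> r"
    using Orb_gamma_flared[OF z(1) assms] flared_nonzero by auto
  then consider "norm z < r" | "norm z = r" by linarith
  then show "z' \<in> Orb (swap_xy ` gamma r)"
  proof cases
    case 1
    then have "z' = rot (turn z + \<theta>) (swap_xy z0)"
      using bend_pi[OF 1 \<open>z \<noteq> 0\<close>] z(2) by (simp add: z0 swap_xy_rot rot_rot)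
    then show ?thesis
      using rot_in_Orb[of "swap_xy z0" "swap_xy ` gamma r"] z0 by simp
  next
    case 2
    then show ?thesis
      using Orb_boundary[OF assms, of z] z bend_outside[OF assms, of z] by simp
  qed
next
  fix z' assume z': "z' \<in> Orb (swap_xy ` gamma r)"
  then obtain \<theta> z0 where z0: "z' = rot \<theta> (swap_xy z0)" "z0 \<in> gamma r"
    by (auto simp: Orb_def)
  have "z0 \<in> Orb (gamma r)"
    using rot_in_Orb[OF z0(2), of 0] by simp
  then have "z0 \<noteq> 0" "norm z0 \<le> r"
    using Orb_gamma_flared[of z0 r] assms flared_nonzero by blast+
  then consider "norm z0 < r" | "norm z0 = r" by linarith
  then show "z' \<in> bend r pi 0 ` Orb (gamma r)"
  proof cases
    case 1
    \<comment> \<open>Undoes in advance the turn that \<open>bend\<close> will add; its amount is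
      the same at \<open>z\<close> and \<open>z0\<close> because \<open>turn\<close> is invariant
      under \<open>rot\<close>.\<close>
    define z where "z = rot (\<theta> - turn z0) z0"
    have "norm z = norm z0" "turn z = turn z0"
      by (simp_all add: z_def turn_rot)
    then have z: "norm z < r" "z \<noteq> 0" "turn z = turn z0"
      using 1 \<open>z0 \<noteq> 0\<close> by auto
    have "bend r pi 0 z = z'"
      using bend_pi[OF z(1,2)] z(3) by (simp add: z_def swap_xy_rot rot_rot z0)
    then show ?thesis
      using rot_in_Orb[OF z0(2)] z_def by blast
  next
    case 2
    then have "norm z' = r" by (simp add: z0)
    then show ?thesis
      using Orb_boundary[OF assms, of z'] z' bend_outside[OF assms, of z' pi 0] by (metis imageI order_refl)
  qed
qed

section \<open>Derivatives of the phase rotation along a surface\<close>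

text \<open>The displacement is \<open>m\<close> times a bounded factor, where
  \<open>m = \<eta>\<^sup>2\<close> has derivative 0 at a point of the sphere. So the displacement
  has derivative 0 there, for every \<open>k\<close> and \<open>\<tau>\<close>.\<close>

lemma bend_has_derivative_boundary:
  assumes h: "(h has_derivative h') (at x)" and "r > 0" "norm (h x) = r"
    and fl: "\<forall>\<^sub>F y in at x. diag (h y) \<in> flared r"
  shows "((\<lambda>y. bend r k \<tau> (h y)) has_derivative h') (at x)"
proof -
  define m where "m y = (r\<^sup>2 - h y \<bullet> h y)\<^sup>2" for y
  \<comment> \<open>Where \<open>m\<close> is 0 the quotient is 0 by convention; this is consistent
    because \<open>bend\<close> fixes the sphere.\<close>
  define q where "q y = (1 / m y) *\<^sub>R (bend r k \<tau> (h y) - h y)" for y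
  have m: "m y = (r\<^sup>2 - (norm (h y))\<^sup>2)\<^sup>2" for y
    by (simp add: m_def power2_norm_eq_inner)
  have m0: "m x = 0" using assms by (simp add: m)
  have "(m has_derivative (\<lambda>v. 0)) (at x)"
    unfolding m_def using m0 unfolding m_def
    by (auto intro!: derivative_eq_intros h)
  moreover have "\<forall>\<^sub>F y in at x. norm (q y) \<le> \<bar>k\<bar> / (2 * r ^ 3)"
  proof -
    \<comment> \<open>Nearby \<open>|h y| > r / 2\<close>, away from 0, where the bound on the
      displacement degenerates; this turns \<open>4 r\<^sup>2 |h y|\<close> into the constant
      \<open>2 r\<^sup>3\<close>.\<close>
    have "isCont (\<lambda>y. norm (h y)) x"
      using has_derivative_continuous[OF h] by (intro continuous_intros)
    then have "\<forall>\<^sub>F y in at x. norm (h y) > r / 2"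
      using assms by (intro order_tendstoD(1)[of _ r]) (auto simp: isCont_def)
    with fl show ?thesis
    proof eventually_elim
      case (elim y)
      show ?case
      proof (cases "m y = 0")
        case True
        then show ?thesis using \<open>r > 0\<close> by (simp add: q_def)
      next
        case False
        then have "m y > 0" by (simp add: m)
        have "norm (bend r k \<tau> (h y) - h y) * (2 * r ^ 3) = norm (bend r k \<tau> (h y) - h y) * (4 * r\<^sup>2) * (r / 2)"
          by (simp add: power3_eq_cube power2_eq_square)
        also have "\<dots> \<le> norm (bend r k \<tau> (h y) - h y) * (4 * r\<^sup>2) * norm (h y)"
          using elim by (intro mult_left_mono) auto
        also have "\<dots> \<le> \<bar>k\<bar> * m y"
          using norm_bend_diff_le[OF elim(1) \<open>r > 0\<close>] by (simp add: m)
        finally show ?thesis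
          using \<open>r > 0\<close> \<open>m y > 0\<close> unfolding q_def norm_scaleR by (simp add: field_simps)
      qed
    qed
  qed
  ultimately have "((\<lambda>y. m y *\<^sub>R q y) has_derivative (\<lambda>v. 0)) (at x)"
    using m0 by (intro has_derivative_zero_scaleR_bounded)
  moreover have "\<forall>\<^sub>F y in at x. m y *\<^sub>R q y = bend r k \<tau> (h y) - h y"
    using fl
  proof eventually_elim
    case (elim y)
    show ?case
    proof (cases "m y = 0")
      case True
      then have "norm (h y) = r"
        using \<open>r > 0\<close> by (simp add: m)
      then show ?thesis
        using \<open>r > 0\<close> by (simp add: True bend_outside)
    qed (simp add: q_def)
  qed
  moreover have "m x *\<^sub>R q x = bend r k \<tau> (h x) - h x"
    using assms m0 by (simp add: bend_outside)
  ultimately have "((\<lambda>y. bend r k \<tau> (h y) - h y) has_derivative (\<lambda>v. 0)) (at x)"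
    using has_derivative_transform_eventually[of "\<lambda>y. m y *\<^sub>R q y" _ x UNIV] by simp
  from has_derivative_add[OF this h] show ?thesis by simp
qed

lemma bend_differentiable:
  assumes "r > 0" "z \<noteq> 0" "\<tau> \<noteq> 0 \<or> norm z \<noteq> r"
  shows "bend r k \<tau> differentiable (at z)"
proof -
  let ?S = "{z :: R4. z \<noteq> 0 \<and> (\<tau> \<noteq> 0 \<or> norm z \<noteq> r)}"
  have "open ?S"
    by (intro open_Collect_conj open_Collect_disj open_Collect_neq open_Collect_const continuous_intros)
  moreover have "ck_euc 1 ?S (\<lambda>z. bend r k \<tau> z)"
  proof -
    have q: "ck_euc 1 ?S (\<lambda>z. (k, \<tau>, z))"
      by (intro ck_intros)
    show ?thesis
      using ck_euc_compose[OF ck_euc_bend[OF assms(1), of 1] q] by simp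
  qed
  ultimately show ?thesis
    using assms by (intro ck_euc_differentiable[of 1 ?S]) auto
qed

text \<open>\<open>h\<close> is recovered by the inverse rotation, with \<open>- k\<close>, which is
  differentiable at the image point since the exceptional set depends on the norm only. So
  \<open>h'\<close> factors through \<open>j'\<close>.\<close>

lemma bend_derivative_inj:
  assumes h: "(h has_derivative h') (at x)" "inj h'"
    and j: "((\<lambda>y. bend r k \<tau> (h y)) has_derivative j') (at x)"
    and "r > 0" "h x \<noteq> 0" "\<tau> \<noteq> 0 \<or> norm (h x) \<noteq> r"
  shows "inj j'"
proof -
  have "bend r (- k) \<tau> differentiable (at (bend r k \<tau> (h x)))"
    using assms by (intro bend_differentiable) auto
  then obtain B where B: "(bend r (- k) \<tau> has_derivative B) (at (bend r k \<tau> (h x)))"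
    unfolding differentiable_def by blast
  have "(h has_derivative (\<lambda>v. B (j' v))) (at x)"
    using has_derivative_compose[OF j B] by (simp add: bend_minus)
  then have "h' = (\<lambda>v. B (j' v))"
    using has_derivative_unique h(1) by blast
  then show ?thesis
    using h(2) by (auto simp: inj_def)
qed

text \<open>Inside the ball \<open>bend r pi 0\<close> is \<open>swap_xy\<close> followed by a
  rotation through \<open>turn\<close>. The swap and a fixed rotation preserve \<open>omega0\<close>
  up to sign; letting the angle vary adds multiples of the derivative of the moment map, which is 0
  because the moment map vanishes near \<open>x\<close>.\<close>

lemma bend_pi_isotropic:
  assumes h: "(h has_derivative h') (at x)" "\<And>u v. omega0 (h' u) (h' v) = 0"
    and j: "((\<lambda>y. bend r pi 0 (h y)) has_derivative j') (at x)"
    and x: "norm (h x) < r" "h x \<noteq> 0"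
    and real: "\<forall>\<^sub>F y in nhds x. Im (fst (diag (h y)) * cnj (snd (diag (h y)))) = 0"
  shows "omega0 (j' u) (j' v) = 0"
proof -
  define p where "p y = fst (diag (h y))" for y
  define q where "q y = snd (diag (h y))" for y
  define p' where "p' v = fst (diag (h' v))" for v
  define q' where "q' v = snd (diag (h' v))" for v
  have dh: "((\<lambda>y. diag (h y)) has_derivative (\<lambda>v. diag (h' v))) (at x)"
    by (rule bounded_linear.has_derivative[OF bounded_linear_diag h(1)])
  have p: "(p has_derivative p') (at x)"
    unfolding p_def p'_def by (rule has_derivative_fst[OF dh])
  have q: "(q has_derivative q') (at x)"
    unfolding q_def q'_def by (rule has_derivative_snd[OF dh])
  have mom: "Im (p' v * cnj (q x) + p x * cnj (q' v)) = 0" for v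
  proof -
    have "((\<lambda>y. Im (p y * cnj (q y))) has_derivative (\<lambda>v. Im (p' v * cnj (q x) + p x * cnj (q' v)))) (at x)"
      by (intro bounded_linear.has_derivative[OF bounded_linear_Im])
        (auto intro!: derivative_eq_intros p q bounded_linear.has_derivative[OF bounded_linear_cnj] simp: fun_eq_iff)
    moreover have "((\<lambda>y. Im (p y * cnj (q y))) has_derivative (\<lambda>v. 0)) (at x)"
      by (rule has_derivative_transform_eventually[of "\<lambda>y. 0"])
        (use real eventually_nhds_x_imp_x[OF real] in \<open>auto simp: p_def q_def eventually_at_filter elim: eventually_mono\<close>)
    ultimately show ?thesis
      using has_derivative_unique by (metis (no_types, lifting))
  qed
  have nz: "h x \<bullet> h x \<noteq> 0" using x by simp
  \<comment> \<open>Any differentiable angle would do: its derivative \<open>t'\<close> only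
    multiplies derivatives of the moment map.\<close>
  obtain t' where t': "((\<lambda>y. turn (h y)) has_derivative t') (at x)"
  proof
    show "((\<lambda>y. turn (h y)) has_derivative (\<lambda>v. - (pi *
        ((- (q x \<bullet> q x) * (inverse (h x \<bullet> h x) * (h x \<bullet> h' v + h' v \<bullet> h x) * inverse (h x \<bullet> h x))
          + (q x \<bullet> q' v + q' v \<bullet> q x) / (h x \<bullet> h x)))))) (at x)"
      unfolding turn_def power2_norm_eq_inner q_def[symmetric]
      by (intro has_derivative_minus has_derivative_mult_right has_derivative_divide has_derivative_inner q h(1) nz)
  qed
  define e where "e = cis (turn (h x))"
  define P where "P v = p' v + t' v *\<^sub>R (\<i> * p x)" for v
  define Q where "Q v = q' v + t' v *\<^sub>R (\<i> * q x)" for v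
  have "((\<lambda>y. (cis (turn (h y)) * p y, - (cis (turn (h y)) * q y))) has_derivative (\<lambda>v. (e * P v, - (e * Q v)))) (at x)"
    by (auto intro!: derivative_eq_intros p q t' simp: fun_eq_iff e_def P_def Q_def algebra_simps scaleR_conv_of_real)
  then have "((\<lambda>y. diag (bend r pi 0 (h y))) has_derivative (\<lambda>v. (e * P v, - (e * Q v)))) (at x)"
  proof (rule has_derivative_transform_eventually)
    have eq: "(cis (turn (h y)) * p y, - (cis (turn (h y)) * q y)) = diag (bend r pi 0 (h y))"
      if "norm (h y) < r" "h y \<noteq> 0" for y
      by (simp add: bend_pi[OF that] diag_rot diag_swap_xy p_def q_def)
    have "isCont h x" using has_derivative_continuous[OF h(1)] by simp
    then have "\<forall>\<^sub>F y in at x. norm (h y) < r" "\<forall>\<^sub>F y in at x. h y \<noteq> 0"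
      using x by (auto simp: isCont_def intro: order_tendstoD(2)[OF tendsto_norm] tendsto_imp_eventually_ne)
    then show "\<forall>\<^sub>F y in at x. (cis (turn (h y)) * p y, - (cis (turn (h y)) * q y)) = diag (bend r pi 0 (h y))"
      by eventually_elim (rule eq)
    show "(cis (turn (h x)) * p x, - (cis (turn (h x)) * q x)) = diag (bend r pi 0 (h x))"
      by (rule eq[OF x])
  qed simp
  moreover have "((\<lambda>y. diag (bend r pi 0 (h y))) has_derivative (\<lambda>v. diag (j' v))) (at x)"
    by (rule bounded_linear.has_derivative[OF bounded_linear_diag j])
  ultimately have dj: "diag (j' v) = (e * P v, - (e * Q v))" for v
    using has_derivative_unique by (metis (no_types, lifting))
  have unit: "(e * a) \<bullet> (e * b) = a \<bullet> b" for a b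
  proof -
    have "(e * a) \<bullet> (e * b) = Re (e * cnj e * (a * cnj b))"
      by (simp add: inner_complex_def algebra_simps)
    also have "e * cnj e = 1"
      by (simp add: e_def cis_cnj cis_mult)
    finally show ?thesis by (simp add: inner_complex_def)
  qed
  have om: "q' u \<bullet> p' v - p' u \<bullet> q' v = 0"
    using h(2)[of u v] by (simp add: omega0_diag p'_def q'_def)
  have "omega0 (j' u) (j' v) = - (Q u \<bullet> P v - P u \<bullet> Q v)"
    by (simp add: omega0_diag dj unit)
  \<comment> \<open>The terms with \<open>t' u * t' v\<close> cancel by symmetry of the inner
    product; the mixed terms are those of \<open>mom\<close>.\<close>
  also have "Q u \<bullet> P v - P u \<bullet> Q v = (q' u \<bullet> p' v - p' u \<bullet> q' v)
      - t' v * Im (p' u * cnj (q x) + p x * cnj (q' u)) + t' u * Im (p' v * cnj (q x) + p x * cnj (q' v))"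
    by (simp add: P_def Q_def inner_complex_def algebra_simps)
  finally show ?thesis
    by (simp only: om mom)
qed

section \<open>The isotopy\<close>

lemma smooth_manifold_chart:
  assumes "smooth_manifold M" "c \<in> atlas M"
  shows chart_openin: "openin (mtop M) (fst c)"
    and chart_subset: "fst c \<subseteq> mpoints M"
    and chart_inj: "inj_on (snd c) (fst c)"
    and chart_open_image: "openin (mtop M) Y \<Longrightarrow> open (snd c ` (fst c \<inter> Y))"
proof -
  have c: "openin (mtop M) (fst c)" "open (snd c ` fst c)"
    "homeomorphic_map (subtopology (mtop M) (fst c)) (top_of_set (snd c ` fst c)) (snd c)"
    using assms unfolding smooth_manifold_def by blast+
  show "openin (mtop M) (fst c)" by (rule c(1))
  show sub: "fst c \<subseteq> mpoints M" by (rule openin_subset[OF c(1)])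
  show "inj_on (snd c) (fst c)"
    using homeomorphic_imp_injective_map[OF c(3)] sub by (simp add: Int_absorb1)
  show "open (snd c ` (fst c \<inter> Y))" if "openin (mtop M) Y"
  proof -
    have "openin (subtopology (mtop M) (fst c)) (fst c \<inter> Y)"
      using that by (auto simp: openin_subtopology)
    then have "openin (top_of_set (snd c ` fst c)) (snd c ` (fst c \<inter> Y))"
      using homeomorphic_imp_open_map[OF c(3)] unfolding open_map_def by blast
    then show ?thesis
      using openin_open_trans c(2) by blast
  qed
qed

lemma chart_covers: "smooth_manifold M \<Longrightarrow> p \<in> mpoints M \<Longrightarrow> \<exists>c\<in>atlas M. p \<in> fst c"
  unfolding smooth_manifold_def by blast

lemma chart_inv_image:
  assumes "smooth_manifold M" "c \<in> atlas M" "p \<in> fst c"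
  shows "chart_inv c (snd c p) = p"
  unfolding chart_inv_def by (rule inv_into_f_f[OF chart_inj[OF assms(1,2)] assms(3)])

lemma chart_inv_in:
  assumes "x \<in> snd c ` fst c"
  shows "chart_inv c x \<in> fst c" "snd c (chart_inv c x) = x"
  unfolding chart_inv_def using assms by (auto intro: inv_into_into f_inv_into_f)

lemma diff_in_open:
  assumes "open (loc_dom c d A f)" "p \<in> A" "p \<in> fst c" "f p \<in> fst d"
  shows "diff_in c d A f p = frechet_derivative (loc_rep c d f) (at (snd c p))"
  unfolding diff_in_def by (subst at_within_open[OF _ assms(1)]) (use assms in \<open>auto simp: loc_dom_def\<close>)

lemma chart_image_iff:
  assumes "smooth_manifold M" "c \<in> atlas M" "Y \<subseteq> mpoints M"
  shows "x \<in> snd c ` (fst c \<inter> Y) \<longleftrightarrow> x \<in> snd c ` fst c \<and> chart_inv c x \<in> Y"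
  using chart_inv_image[OF assms(1,2)] chart_inv_in[of x c] by (auto intro!: image_eqI[of _ _ "chart_inv c x"])

text \<open>The charts of the line times \<open>S\<close> are the identity times charts of
  \<open>S\<close>; so regularity of a family becomes a question about functions of
  \<open>(t, x)\<close>.\<close>

lemma ck_on_product_line:
  assumes S: "smooth_manifold S" and X: "X \<subseteq> UNIV \<times> mpoints S"
    and cont: "continuous_map (prod_topology euclidean (mtop S)) (mtop W) (\<lambda>z. F (fst z) (snd z))"
    and ck: "\<And>c d. c \<in> atlas S \<Longrightarrow> d \<in> atlas W \<Longrightarrow>
      ck_euc k {z. snd z \<in> snd c ` fst c \<and> (fst z, chart_inv c (snd z)) \<in> X \<and> F (fst z) (chart_inv c (snd z)) \<in> fst d}
        (\<lambda>z. snd d (F (fst z) (chart_inv c (snd z))))"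
  shows "ck_on k (prod_mfd eucl_mfd S) W X (\<lambda>(t :: real, p). F t p)"
  unfolding ck_on_def
proof (intro conjI ballI)
  show "X \<subseteq> mpoints (prod_mfd eucl_mfd S)"
    using X by (simp add: prod_mfd_def eucl_mfd_def)
  show "continuous_map (subtopology (mtop (prod_mfd eucl_mfd S)) X) (mtop W) (\<lambda>(t, p). F t p)"
    using continuous_map_from_subtopology[OF cont] by (simp add: prod_mfd_def eucl_mfd_def split_beta')
  fix c d assume "c \<in> atlas (prod_mfd (eucl_mfd :: (real, real) manifold) S)" and d: "d \<in> atlas W"
  then obtain c' where c': "c' \<in> atlas S" and c: "c = (UNIV \<times> fst c', map_prod id (snd c'))"
    by (auto simp: prod_mfd_def eucl_mfd_def)
  have inj: "inj_on (map_prod id (snd c')) (UNIV \<times> fst c' :: (real \<times> _) set)"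
    using chart_inj[OF S c'] by (auto simp: inj_on_def)
  have inv: "chart_inv c (t, snd c' p) = (t, p)" if "p \<in> fst c'" for t p
    unfolding chart_inv_def c using that by (auto intro!: inv_into_f_eq[OF inj])
  show "ck_euc k (loc_dom c d X (\<lambda>(t, p). F t p)) (loc_rep c d (\<lambda>(t, p). F t p))"
  proof (rule ck_euc_cong[OF ck_euc_subset[OF ck[OF c' d]]])
    show "loc_dom c d X (\<lambda>(t, p). F t p) \<subseteq> {z. snd z \<in> snd c' ` fst c' \<and>
        (fst z, chart_inv c' (snd z)) \<in> X \<and> F (fst z) (chart_inv c' (snd z)) \<in> fst d}"
      unfolding loc_dom_def c by (auto simp: chart_inv_image[OF S c'])
    fix z assume "z \<in> loc_dom c d X (\<lambda>(t, p). F t p)"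
    then obtain t p where "z = (t, snd c' p)" "p \<in> fst c'"
      unfolding loc_dom_def c by auto
    then show "snd d (F (fst z) (chart_inv c' (snd z))) = loc_rep c d (\<lambda>(t, p). F t p) z"
      by (simp add: loc_rep_def inv chart_inv_image[OF S c'])
  qed
qed

text \<open>Takes the same chart condition as the preceding lemma, so that one computation serves
  the family and each stage; a stage is the composition with
  \<open>x \<mapsto> (t, x)\<close>.\<close>

lemma ck_on_slice:
  assumes S: "smooth_manifold S" and Y: "Y \<subseteq> mpoints S" "\<And>p. p \<in> Y \<Longrightarrow> (t, p) \<in> X"
    and cont: "continuous_map (prod_topology euclidean (mtop S)) (mtop W) (\<lambda>z. F (fst z) (snd z))"
    and ck: "\<And>c d. c \<in> atlas S \<Longrightarrow> d \<in> atlas W \<Longrightarrow>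
      ck_euc k {z. snd z \<in> snd c ` fst c \<and> (fst z, chart_inv c (snd z)) \<in> X \<and> F (fst z) (chart_inv c (snd z)) \<in> fst d}
        (\<lambda>z. snd d (F (fst z) (chart_inv c (snd z))))"
  shows "ck_on k S W Y (F (t :: real))"
  unfolding ck_on_def
proof (intro conjI ballI)
  show "Y \<subseteq> mpoints S" by (rule Y(1))
  have "continuous_map (mtop S) (prod_topology euclidean (mtop S)) (\<lambda>p. (t, p))"
    by (simp add: continuous_map_paired)
  from continuous_map_compose[OF this cont]
  show "continuous_map (subtopology (mtop S) Y) (mtop W) (F t)"
    by (intro continuous_map_from_subtopology) (simp add: o_def)
  fix c d assume c: "c \<in> atlas S" and d: "d \<in> atlas W"
  have "ck_euc k (loc_dom c d Y (F t)) (\<lambda>x. (t, x))"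
    by (intro ck_intros)
  from ck_euc_compose[OF ck[OF c d] this]
  have "ck_euc k (loc_dom c d Y (F t)) (\<lambda>x. snd d (F (fst (t, x)) (chart_inv c (snd (t, x)))))"
    by (rule meta_mp) (use Y(2) in \<open>auto simp: loc_dom_def chart_inv_image[OF S c]\<close>)
  then show "ck_euc k (loc_dom c d Y (F t)) (loc_rep c d (F t))"
    by (rule ck_euc_cong) (simp add: loc_rep_def)
qed

section \<open>The setting of the surgery and the immersion in normal form coordinates\<close>

locale surgery =
  fixes W :: "('w, R4) manifold" and \<omega> :: "('w, R4) two_form"
    and S :: "('s, R2) manifold" and \<iota> :: "'s \<Rightarrow> 'w"
    and D U :: "'w set" and \<Phi> :: "'w \<Rightarrow> R4" and r :: real
  assumes W: "smooth_manifold W"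
    and lag: "lagrangian_surface {} S W \<omega> \<iota>"
    and nbhd: "la_nbhd W \<omega> (\<iota> ` mpoints S) D U \<Phi> r"
begin

lemma S: "smooth_manifold S" "compact_space (mtop S)"
  and \<iota>_ck: "ck_on \<infinity> S W (mpoints S) \<iota>"
  and \<iota>_immersive: "immersive_on S W (mpoints S) \<iota>"
  and \<iota>_isotropic: "isotropic_on S W \<omega> (mpoints S) \<iota>"
  using lag by (simp_all add: lagrangian_surface_def)

lemma r_pos: "r > 0"
  and U_open: "openin (mtop W) U"
  and inj_\<Phi>: "inj_on \<Phi> U"
  and \<Phi>_ck: "ck_on \<infinity> W eucl_mfd U \<Phi>"
  and \<Psi>_ck: "ck_on \<infinity> eucl_mfd W (\<Phi> ` U) (inv_into U \<Phi>)"
  and open_\<Phi>: "open (\<Phi> ` U)"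
  and ball: "cball 0 r \<subseteq> \<Phi> ` U"
  and annulus: "\<Phi> ` (\<iota> ` mpoints S \<inter> U) \<inter> cball 0 r = Orb (gamma r)"
  by (simp_all only: nbhd[unfolded la_nbhd_def])

lemma \<omega>_\<Phi>: "c \<in> atlas W \<Longrightarrow> p \<in> U \<Longrightarrow> p \<in> fst c \<Longrightarrow>
   \<omega> c p u v = omega0 (diff_in c (UNIV, id) U \<Phi> p u) (diff_in c (UNIV, id) U \<Phi> p v)"
  by (simp only: nbhd[unfolded la_nbhd_def] Int_iff)

abbreviation "\<Psi> \<equiv> inv_into U \<Phi>"

lemma \<Psi>_\<Phi>: "p \<in> U \<Longrightarrow> \<Psi> (\<Phi> p) = p"
  using inj_\<Phi> by simp

lemma \<Psi>_in: "z \<in> \<Phi> ` U \<Longrightarrow> \<Psi> z \<in> U"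
  and \<Phi>_\<Psi>: "z \<in> \<Phi> ` U \<Longrightarrow> \<Phi> (\<Psi> z) = z"
  by (simp_all add: inv_into_into f_inv_into_f)

lemma U_sub: "U \<subseteq> mpoints W"
  by (rule openin_subset[OF U_open])

lemma cont_\<iota>: "continuous_map (mtop S) (mtop W) \<iota>"
  using \<iota>_ck by (simp add: ck_on_def)

lemma \<iota>_in: "p \<in> mpoints S \<Longrightarrow> \<iota> p \<in> mpoints W"
  using cont_\<iota> by (auto simp: continuous_map_def)

lemma openin_preimage: "openin (mtop W) Y \<Longrightarrow> openin (mtop S) {p \<in> mpoints S. \<iota> p \<in> Y}"
  by (rule openin_continuous_map_preimage[OF cont_\<iota>])

lemma cont_\<Phi>: "continuous_map (subtopology (mtop W) U) euclidean \<Phi>"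
  using \<Phi>_ck by (simp add: ck_on_def eucl_mfd_def)

lemma cont_\<Psi>: "continuous_map (top_of_set (\<Phi> ` U)) (mtop W) \<Psi>"
  using \<Psi>_ck by (simp add: ck_on_def eucl_mfd_def)

lemma ck_\<Phi>:
  assumes "d \<in> atlas W"
  shows "ck_euc \<infinity> (snd d ` (fst d \<inter> U)) (\<lambda>y. \<Phi> (chart_inv d y))"
proof -
  have "ck_euc \<infinity> (loc_dom d (UNIV, id) U \<Phi>) (loc_rep d (UNIV, id) \<Phi>)"
    using \<Phi>_ck assms by (simp add: ck_on_def eucl_mfd_def)
  then show ?thesis
    by (simp add: loc_dom_def loc_rep_def o_def Int_commute)
qed

lemma ck_\<Psi>:
  assumes "d \<in> atlas W"
  shows "ck_euc \<infinity> {z \<in> \<Phi> ` U. \<Psi> z \<in> fst d} (\<lambda>z. snd d (\<Psi> z))"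
proof -
  have "ck_euc \<infinity> (loc_dom (UNIV, id) d (\<Phi> ` U) \<Psi>) (loc_rep (UNIV, id) d \<Psi>)"
    using \<Psi>_ck assms by (simp add: ck_on_def eucl_mfd_def)
  moreover have "chart_inv (UNIV, id) = (id :: R4 \<Rightarrow> R4)"
    by (simp add: chart_inv_def inv_id)
  ultimately show ?thesis
    by (simp add: loc_dom_def loc_rep_def o_def vimage_def Int_def)
qed

lemma ck_\<iota>:
  assumes "c \<in> atlas S" "d \<in> atlas W"
  shows "ck_euc \<infinity> {x \<in> snd c ` fst c. \<iota> (chart_inv c x) \<in> fst d} (\<lambda>x. snd d (\<iota> (chart_inv c x)))"
proof -
  have "ck_euc \<infinity> (loc_dom c d (mpoints S) \<iota>) (loc_rep c d \<iota>)"
    using \<iota>_ck assms by (simp add: ck_on_def)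
  moreover have "loc_dom c d (mpoints S) \<iota> = {x \<in> snd c ` fst c. \<iota> (chart_inv c x) \<in> fst d}"
    using chart_inv_image[OF S(1) assms(1)] chart_subset[OF S(1) assms(1)]
    by (auto simp: loc_dom_def)
  ultimately show ?thesis
    by (simp add: loc_rep_def o_def)
qed

definition h where "h c x = \<Phi> (\<iota> (chart_inv c x))"

definition V where "V c = {x \<in> snd c ` fst c. \<iota> (chart_inv c x) \<in> U}"

lemma open_chart_preimage:
  assumes "c \<in> atlas S" "openin (mtop S) Y"
  shows "open {x \<in> snd c ` fst c. chart_inv c x \<in> Y}"
proof -
  have "{x \<in> snd c ` fst c. chart_inv c x \<in> Y} = snd c ` (fst c \<inter> Y)"
    using chart_image_iff[OF S(1) assms(1) openin_subset[OF assms(2)]] by blast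
  then show ?thesis
    using chart_open_image[OF S(1) assms] by simp
qed

lemma chart_inv_mpoints: "c \<in> atlas S \<Longrightarrow> x \<in> snd c ` fst c \<Longrightarrow> chart_inv c x \<in> mpoints S"
  using chart_inv_in(1)[of x c] chart_subset[OF S(1)] by blast

lemma open_\<iota>_preimage:
  assumes "c \<in> atlas S" "openin (mtop W) Y"
  shows "open {x \<in> snd c ` fst c. \<iota> (chart_inv c x) \<in> Y}"
proof -
  have "{x \<in> snd c ` fst c. \<iota> (chart_inv c x) \<in> Y}
      = {x \<in> snd c ` fst c. chart_inv c x \<in> {p \<in> mpoints S. \<iota> p \<in> Y}}"
    using chart_inv_mpoints[OF assms(1)] by auto
  then show ?thesis
    using open_chart_preimage[OF assms(1) openin_preimage[OF assms(2)]] by simp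
qed

lemma open_V: "c \<in> atlas S \<Longrightarrow> open (V c)"
  unfolding V_def by (rule open_\<iota>_preimage[OF _ U_open])

text \<open>The smoothness of \<open>\<Phi>\<close> and \<open>\<iota>\<close> is given through
  charts of \<open>W\<close>, so near each point a chart of \<open>W\<close> is inserted between
  them.\<close>

lemma ck_h:
  assumes c: "c \<in> atlas S"
  shows "ck_euc \<infinity> (V c) (h c)"
proof (rule ck_euc_local)
  fix x assume "x \<in> V c"
  then have x: "x \<in> snd c ` fst c" "\<iota> (chart_inv c x) \<in> U" by (simp_all add: V_def)
  then have "\<iota> (chart_inv c x) \<in> mpoints W" using U_sub by blast
  from chart_covers[OF W this] obtain d where d: "d \<in> atlas W" "\<iota> (chart_inv c x) \<in> fst d" by blast
  let ?T = "{x \<in> snd c ` fst c. \<iota> (chart_inv c x) \<in> fst d}"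
  have "ck_euc \<infinity> (V c \<inter> ?T) (\<lambda>x. snd d (\<iota> (chart_inv c x)))"
    by (rule ck_euc_subset[OF ck_\<iota>[OF c d(1)]]) simp
  from ck_euc_compose[OF ck_\<Phi>[OF d(1)] this]
  have "ck_euc \<infinity> (V c \<inter> ?T) (\<lambda>x. \<Phi> (chart_inv d (snd d (\<iota> (chart_inv c x)))))"
    by (auto simp: V_def)
  then have "ck_euc \<infinity> (V c \<inter> ?T) (h c)"
    by (rule ck_euc_cong) (simp add: chart_inv_image[OF W d(1)] h_def)
  moreover have "open ?T"
    by (rule open_\<iota>_preimage[OF c chart_openin[OF W d(1)]])
  ultimately show "\<exists>T. open T \<and> x \<in> T \<and> ck_euc \<infinity> (V c \<inter> T) (h c)"
    using x d(2) by (intro exI[of _ ?T]) simp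
qed

section \<open>The family of immersions\<close>

text \<open>At \<open>t = 0\<close> the amount \<open>k = pi * t\<close> is 0 and
  \<open>bend\<close> is the identity; at \<open>t = 1\<close> it is \<open>pi\<close> and
  \<open>\<tau> = 1 - t\<close> is 0, so the step has become the indicator of the open ball.\<close>

definition F :: "real \<Rightarrow> 's \<Rightarrow> 'w" where
  "F t p = (if \<iota> p \<in> U then \<Psi> (bend r (pi * t) (1 - t) (\<Phi> (\<iota> p))) else \<iota> p)"

lemma on_annulus:
  assumes "p \<in> mpoints S" "\<iota> p \<in> U" "norm (\<Phi> (\<iota> p)) \<le> r"
  shows "\<Phi> (\<iota> p) \<in> Orb (gamma r)"
  using assms annulus by (auto simp: dist_norm)

text \<open>In the closed ball the surface is the annulus by the normal form, and beyond it every
  point is flared. So the estimates hold along the whole surface in \<open>U\<close>.\<close>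

lemma \<iota>_flared:
  assumes "p \<in> mpoints S" "\<iota> p \<in> U"
  shows "diag (\<Phi> (\<iota> p)) \<in> flared r"
proof (cases "norm (\<Phi> (\<iota> p)) \<le> r")
  case True
  then show ?thesis using on_annulus[OF assms] Orb_gamma_flared(1) r_pos by blast
next
  case False
  then show ?thesis using flared_outside r_pos by simp
qed

lemma bend_in_\<Phi>:
  assumes "z \<in> \<Phi> ` U"
  shows "bend r k \<tau> z \<in> \<Phi> ` U"
proof (cases "norm z \<le> r")
  case True
  then have "bend r k \<tau> z \<in> cball 0 r" by simp
  then show ?thesis using ball by blast
next
  case False
  then show ?thesis using assms bend_outside[OF r_pos, of z] by simp
qed

lemma F_in_U_iff: "F t p \<in> U \<longleftrightarrow> \<iota> p \<in> U"
  by (simp add: F_def \<Psi>_in bend_in_\<Phi>)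

lemma \<Phi>_F: "\<iota> p \<in> U \<Longrightarrow> \<Phi> (F t p) = bend r (pi * t) (1 - t) (\<Phi> (\<iota> p))"
  by (simp add: F_def \<Phi>_\<Psi> bend_in_\<Phi>)

lemma F_0: "F 0 p = \<iota> p"
  by (simp add: F_def \<Psi>_\<Phi>)

text \<open>The compact region outside which \<open>F\<close> agrees with \<open>\<iota>\<close>. It
  is closed as \<open>W\<close> is Hausdorff, so \<open>U\<close> and the complement of
  \<open>core\<close> are two open sets covering \<open>W\<close>, on which regularity is checked
  separately.\<close>

definition core where "core = \<Psi> ` cball 0 r"

lemma closedin_core: "closedin (mtop W) core"
proof (rule compactin_imp_closedin)
  show "Hausdorff_space (mtop W)" using W by (simp add: smooth_manifold_def)
  have "compactin (top_of_set (\<Phi> ` U)) (cball 0 r)"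
    using ball by (simp add: compactin_subtopology)
  then show "compactin (mtop W) core"
    unfolding core_def by (rule image_compactin[OF _ cont_\<Psi>])
qed

lemma core_sub: "core \<subseteq> U"
  unfolding core_def using ball \<Psi>_in by blast

lemma F_outside_core:
  assumes "\<iota> p \<notin> core"
  shows "F t p = \<iota> p"
proof (cases "\<iota> p \<in> U")
  case True
  have "norm (\<Phi> (\<iota> p)) > r"
  proof (rule ccontr)
    assume "\<not> norm (\<Phi> (\<iota> p)) > r"
    then have "\<Psi> (\<Phi> (\<iota> p)) \<in> core"
      unfolding core_def by (intro imageI) simp
    then show False using assms True \<Psi>_\<Phi> by simp
  qed
  then show ?thesis
    using bend_outside[OF r_pos, of "\<Phi> (\<iota> p)"] True by (simp add: F_def \<Psi>_\<Phi>)
qed (simp add: F_def)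

lemma openin_outside: "openin (mtop W) (mpoints W - core)"
  using closedin_core by (rule openin_diff[OF openin_topspace])

section \<open>Regularity of the family\<close>

text \<open>Reduces every regularity class to that of the rotation: on \<open>U\<close> the chart
  expression is \<open>bend\<close> followed by the smooth \<open>\<Psi>\<close>, and away from
  \<open>core\<close> it is that of \<open>\<iota>\<close>.\<close>

lemma ck_F_chart:
  assumes c: "c \<in> atlas S" and d: "d \<in> atlas W"
    and b: "ck_euc k {z. snd z \<in> V c \<and> (fst z, chart_inv c (snd z)) \<in> X}
      (\<lambda>z. bend r (pi * fst z) (1 - fst z) (h c (snd z)))"
  shows "ck_euc k {z. snd z \<in> snd c ` fst c \<and> (fst z, chart_inv c (snd z)) \<in> X \<and> F (fst z) (chart_inv c (snd z)) \<in> fst d}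
        (\<lambda>z. snd d (F (fst z) (chart_inv c (snd z))))" (is "ck_euc k ?A ?R")
proof (rule ck_euc_local)
  fix z assume z: "z \<in> ?A"
  show "\<exists>T. open T \<and> z \<in> T \<and> ck_euc k (?A \<inter> T) ?R"
  proof (cases "\<iota> (chart_inv c (snd z)) \<in> U")
    case True
    let ?T = "UNIV \<times> V c :: (real \<times> R2) set"
    have "open ?T" using open_V[OF c] by (simp add: open_Times)
    moreover have "z \<in> ?T" using True z by (auto simp: V_def mem_Times_iff)
    moreover have "ck_euc k (?A \<inter> ?T) ?R"
    proof -
      have \<Psi>: "ck_euc k {z \<in> \<Phi> ` U. \<Psi> z \<in> fst d} (\<lambda>z. snd d (\<Psi> z))"
        by (rule ck_euc_antimono[OF ck_\<Psi>[OF d]]) simp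
      have b': "ck_euc k (?A \<inter> ?T) (\<lambda>z. bend r (pi * fst z) (1 - fst z) (h c (snd z)))"
        by (rule ck_euc_subset[OF b]) (auto simp: mem_Times_iff)
      have "ck_euc k (?A \<inter> ?T) (\<lambda>z. snd d (\<Psi> (bend r (pi * fst z) (1 - fst z) (h c (snd z)))))"
        by (rule ck_euc_compose[OF \<Psi> b'])
          (auto simp: mem_Times_iff V_def h_def F_def bend_in_\<Phi>)
      then show ?thesis
        by (rule ck_euc_cong) (auto simp: mem_Times_iff V_def h_def F_def)
    qed
    ultimately show ?thesis by blast
  next
    case False
    let ?N = "{x \<in> snd c ` fst c. \<iota> (chart_inv c x) \<in> mpoints W - core}"
    let ?T = "UNIV \<times> ?N :: (real \<times> R2) set"
    have "open ?T"
      using open_\<iota>_preimage[OF c openin_outside] by (simp add: open_Times)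
    moreover have "z \<in> ?T"
      using False z core_sub chart_inv_mpoints[OF c] \<iota>_in by (auto simp: mem_Times_iff)
    moreover have "ck_euc k (?A \<inter> ?T) ?R"
    proof -
      have 1: "ck_euc k {x \<in> snd c ` fst c. \<iota> (chart_inv c x) \<in> fst d} (\<lambda>x. snd d (\<iota> (chart_inv c x)))"
        by (rule ck_euc_antimono[OF ck_\<iota>[OF c d]]) simp
      have 2: "ck_euc k (?A \<inter> ?T) snd"
        by (intro ck_intros)
      have "ck_euc k (?A \<inter> ?T) (\<lambda>z. snd d (\<iota> (chart_inv c (snd z))))"
        by (rule ck_euc_compose[OF 1 2]) (auto simp: mem_Times_iff F_outside_core)
      then show ?thesis
        by (rule ck_euc_cong) (auto simp: mem_Times_iff F_outside_core)
    qed
    ultimately show ?thesis by blast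
  qed
qed

text \<open>\<open>X\<close> is arbitrary, the seam at time 1 included, because all points involved
  are flared.\<close>

lemma ck_1_F:
  assumes "c \<in> atlas S" "d \<in> atlas W"
  shows "ck_euc 1 {z. snd z \<in> snd c ` fst c \<and> (fst z, chart_inv c (snd z)) \<in> X \<and> F (fst z) (chart_inv c (snd z)) \<in> fst d}
        (\<lambda>z. snd d (F (fst z) (chart_inv c (snd z))))"
proof (rule ck_F_chart[OF assms])
  let ?A = "{z. snd z \<in> V c \<and> (fst z, chart_inv c (snd z)) \<in> X}"
  have "ck_euc 1 ?A (\<lambda>z. h c (snd z))"
    by (rule ck_euc_compose[OF ck_euc_antimono[OF ck_h[OF assms(1)]]]) (auto intro: ck_intros)
  then have q: "ck_euc 1 ?A (\<lambda>z. (pi * fst z, 1 - fst z, h c (snd z)))"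
    by (intro ck_euc_Pair) (intro ck_intros)+
  have "ck_euc 1 ?A (\<lambda>z. bend r (fst (pi * fst z, 1 - fst z, h c (snd z)))
      (fst (snd (pi * fst z, 1 - fst z, h c (snd z)))) (snd (snd (pi * fst z, 1 - fst z, h c (snd z)))))"
    by (rule ck_euc_compose[OF ck_euc_1_bend[OF r_pos] q])
      (auto simp: V_def h_def intro!: \<iota>_flared chart_inv_mpoints[OF assms(1)])
  then show "ck_euc 1 ?A (\<lambda>z. bend r (pi * fst z) (1 - fst z) (h c (snd z)))" by simp
qed

lemma ck_infinity_F:
  assumes "c \<in> atlas S" "d \<in> atlas W"
    and X: "\<And>p. (1, p) \<in> X \<Longrightarrow> \<iota> p \<in> U \<Longrightarrow> norm (\<Phi> (\<iota> p)) \<noteq> r"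
  shows "ck_euc \<infinity> {z. snd z \<in> snd c ` fst c \<and> (fst z, chart_inv c (snd z)) \<in> X \<and> F (fst z) (chart_inv c (snd z)) \<in> fst d}
        (\<lambda>z. snd d (F (fst z) (chart_inv c (snd z))))"
proof (rule ck_F_chart[OF assms(1,2)])
  let ?A = "{z. snd z \<in> V c \<and> (fst z, chart_inv c (snd z)) \<in> X}"
  have "ck_euc \<infinity> ?A (\<lambda>z. h c (snd z))"
    by (rule ck_euc_compose[OF ck_h[OF assms(1)]]) (auto intro: ck_intros)
  then have q: "ck_euc \<infinity> ?A (\<lambda>z. (pi * fst z, 1 - fst z, h c (snd z)))"
    by (intro ck_euc_Pair) (intro ck_intros)+
  have "ck_euc \<infinity> ?A (\<lambda>z. bend r (fst (pi * fst z, 1 - fst z, h c (snd z)))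
      (fst (snd (pi * fst z, 1 - fst z, h c (snd z)))) (snd (snd (pi * fst z, 1 - fst z, h c (snd z)))))"
  proof (rule ck_euc_compose[OF ck_euc_bend[OF r_pos] q])
    fix z assume z: "z \<in> ?A"
    then have "h c (snd z) \<noteq> 0"
      using \<iota>_flared[of "chart_inv c (snd z)"] chart_inv_mpoints[OF assms(1)] flared_nonzero
      by (auto simp: V_def h_def)
    moreover have "1 - fst z \<noteq> 0 \<or> norm (h c (snd z)) \<noteq> r"
      using z X[of "chart_inv c (snd z)"] by (auto simp: V_def h_def)
    ultimately show "(pi * fst z, 1 - fst z, h c (snd z)) \<in> {p. snd (snd p) \<noteq> 0 \<and> (fst (snd p) \<noteq> 0 \<or> norm (snd (snd p)) \<noteq> r)}"
      by simp
  qed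
  then show "ck_euc \<infinity> ?A (\<lambda>z. bend r (pi * fst z) (1 - fst z) (h c (snd z)))" by simp
qed

lemma continuous_F: "continuous_map (prod_topology euclideanreal (mtop S)) (mtop W) (\<lambda>z. F (fst z) (snd z))"
proof -
  let ?P = "prod_topology euclideanreal (mtop S)"
  define T where "T b = (UNIV :: real set) \<times> {p \<in> mpoints S. \<iota> p \<in> (if b then U else mpoints W - core)}" for b
  show ?thesis
  proof (rule pasting_lemma[where I = UNIV and T = T and f = "\<lambda>_ z. F (fst z) (snd z)"])
    fix b
    have op: "openin (mtop W) (if b then U else mpoints W - core)"
      using U_open openin_outside by simp
    show "openin ?P (T b)"
      unfolding T_def openin_prod_Times_iff using openin_preimage[OF op] by simp
    have \<iota>T: "continuous_map (subtopology ?P (T b)) (mtop W) (\<lambda>z. \<iota> (snd z))"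
      using continuous_map_compose[OF continuous_map_snd cont_\<iota>]
      by (intro continuous_map_from_subtopology) (simp add: o_def)
    show "continuous_map (subtopology ?P (T b)) (mtop W) (\<lambda>z. F (fst z) (snd z))"
    proof (cases b)
      case False
      show ?thesis
        by (rule continuous_map_eq[OF \<iota>T]) (use False in \<open>auto simp: T_def F_outside_core\<close>)
    next
      case True
      let ?X = "subtopology ?P (T b)"
      have "continuous_map ?X (subtopology (mtop W) U) (\<lambda>z. \<iota> (snd z))"
        by (rule continuous_map_into_subtopology[OF \<iota>T]) (use True in \<open>auto simp: T_def\<close>)
      from continuous_map_compose[OF this cont_\<Phi>]
      have 1: "continuous_map ?X euclidean (\<lambda>z. \<Phi> (\<iota> (snd z)))"
        by (simp add: o_def)
      have 2: "continuous_map ?X euclideanreal fst"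
        by (rule continuous_map_from_subtopology[OF continuous_map_fst])
      have "continuous_map ?X (prod_topology euclideanreal euclidean) (\<lambda>z. (fst z, \<Phi> (\<iota> (snd z))))"
        using 1 2 by (simp only: continuous_map_paired)
      then have 3: "continuous_map ?X euclidean (\<lambda>z. (fst z, \<Phi> (\<iota> (snd z))))"
        by (simp add: euclidean_product_topology)
      \<comment> \<open>At time 1 the rotation, as a map of \<open>R4\<close>, jumps across the
        sphere; continuity comes from restricting it to flared points, among which the surface
        lies.\<close>
      let ?Y = "{y :: real \<times> R4. diag (snd y) \<in> flared r \<and> snd y \<in> \<Phi> ` U}"
      have 4: "continuous_map ?X (top_of_set ?Y) (\<lambda>z. (fst z, \<Phi> (\<iota> (snd z))))"
        by (rule continuous_map_into_subtopology[OF 3])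
          (use True in \<open>auto simp: T_def intro: \<iota>_flared\<close>)
      have q: "ck_euc 1 ?Y (\<lambda>y. (pi * fst y, 1 - fst y, snd y))"
        by (intro ck_intros)
      have "ck_euc 1 ?Y (\<lambda>y. bend r (fst (pi * fst y, 1 - fst y, snd y))
          (fst (snd (pi * fst y, 1 - fst y, snd y))) (snd (snd (pi * fst y, 1 - fst y, snd y))))"
        by (rule ck_euc_compose[OF ck_euc_1_bend[OF r_pos] q]) auto
      then have "continuous_on ?Y (\<lambda>y. bend r (pi * fst y) (1 - fst y) (snd y))"
        using ck_euc_continuous_on by fastforce
      then have 5: "continuous_map (top_of_set ?Y) (top_of_set (\<Phi> ` U)) (\<lambda>y. bend r (pi * fst y) (1 - fst y) (snd y))"
        by (intro continuous_map_into_subtopology) (auto simp: bend_in_\<Phi>)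
      show ?thesis
        by (rule continuous_map_eq[OF continuous_map_compose[OF continuous_map_compose[OF 4 5] cont_\<Psi>]])
          (use True in \<open>auto simp: T_def F_def\<close>)
    qed
  next
    fix z assume "z \<in> topspace ?P"
    then show "\<exists>j. j \<in> UNIV \<and> z \<in> T j \<and> F (fst z) (snd z) = F (fst z) (snd z)"
      using core_sub \<iota>_in by (cases "\<iota> (snd z) \<in> U") (auto simp: T_def intro: exI[of _ True] exI[of _ False])
  qed simp
qed

lemma continuous_F_t: "continuous_map (mtop S) (mtop W) (F t)"
proof -
  have "continuous_map (mtop S) (prod_topology euclideanreal (mtop S)) (\<lambda>p. (t, p))"
    by (simp add: continuous_map_paired)
  from continuous_map_compose[OF this continuous_F] show ?thesis
    by (simp add: o_def)
qed

section \<open>Differentials of the stages\<close>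

lemma open_loc_dom_F:
  assumes "c \<in> atlas S" "d \<in> atlas W"
  shows "open (loc_dom c d (mpoints S) (F t))"
proof -
  have "openin (mtop S) {p \<in> mpoints S. F t p \<in> fst d}"
    by (rule openin_continuous_map_preimage[OF continuous_F_t chart_openin[OF W assms(2)]])
  from open_chart_preimage[OF assms(1) this]
  have "open {x \<in> snd c ` fst c. chart_inv c x \<in> {p \<in> mpoints S. F t p \<in> fst d}}" .
  moreover have "{x \<in> snd c ` fst c. chart_inv c x \<in> {p \<in> mpoints S. F t p \<in> fst d}} = loc_dom c d (mpoints S) (F t)"
    using chart_inv_image[OF S(1) assms(1)] by (auto simp: loc_dom_def)
  ultimately show ?thesis by simp
qed

lemma ck_on_1_F: "ck_on 1 S W (mpoints S) (F t)"
  by (rule ck_on_slice[OF S(1) subset_refl _ continuous_F, of _ UNIV]) (auto intro: ck_1_F[of _ _ UNIV, simplified])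

lemma F_has_derivative:
  assumes "c \<in> atlas S" "d \<in> atlas W" "p \<in> fst c" "F t p \<in> fst d"
  shows "(loc_rep c d (F t) has_derivative diff_in c d (mpoints S) (F t) p) (at (snd c p))"
proof -
  have p: "p \<in> mpoints S" using chart_subset[OF S(1) assms(1)] assms(3) by blast
  have "ck_euc 1 (loc_dom c d (mpoints S) (F t)) (loc_rep c d (F t))"
    using ck_on_1_F assms by (simp add: ck_on_def)
  moreover have "snd c p \<in> loc_dom c d (mpoints S) (F t)"
    using p assms by (auto simp: loc_dom_def)
  ultimately have "loc_rep c d (F t) differentiable (at (snd c p))"
    using open_loc_dom_F[OF assms(1,2)] by (intro ck_euc_differentiable[of 1 "loc_dom c d (mpoints S) (F t)"]) simp_all
  then show ?thesis
    unfolding diff_in_open[OF open_loc_dom_F[OF assms(1,2)] p assms(3,4)]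
    by (simp add: frechet_derivative_works)
qed

lemma \<Phi>_has_derivative:
  assumes "d \<in> atlas W" "q \<in> fst d" "q \<in> U"
  shows "((\<lambda>y. \<Phi> (chart_inv d y)) has_derivative diff_in d (UNIV, id) U \<Phi> q) (at (snd d q))"
proof -
  have eq: "loc_dom d (UNIV, id) U \<Phi> = snd d ` (fst d \<inter> U)"
    by (simp add: loc_dom_def Int_commute)
  have op: "open (loc_dom d (UNIV, id) U \<Phi>)"
    unfolding eq by (rule chart_open_image[OF W assms(1) U_open])
  have rep: "loc_rep d (UNIV, id) \<Phi> = (\<lambda>y. \<Phi> (chart_inv d y))"
    by (simp add: loc_rep_def o_def)
  have "(\<lambda>y. \<Phi> (chart_inv d y)) differentiable (at (snd d q))"
    by (rule ck_euc_differentiable[OF ck_\<Phi>[OF assms(1)]]) (use op eq assms in auto)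
  then show ?thesis
    by (subst diff_in_open[OF op assms(3,2)]) (simp_all add: rep frechet_derivative_works)
qed

lemma \<Psi>_differentiable:
  assumes "d \<in> atlas W" "q \<in> fst d" "q \<in> U"
  shows "(\<lambda>z. snd d (\<Psi> z)) differentiable (at (\<Phi> q))"
proof (rule ck_euc_differentiable[OF ck_\<Psi>[OF assms(1)]])
  have "openin (top_of_set (\<Phi> ` U)) {z \<in> \<Phi> ` U. \<Psi> z \<in> fst d}"
    using openin_continuous_map_preimage[OF cont_\<Psi> chart_openin[OF W assms(1)]] by simp
  then show "open {z \<in> \<Phi> ` U. \<Psi> z \<in> fst d}"
    using openin_open_trans open_\<Phi> by blast
qed (use assms \<Psi>_\<Phi> in auto)

text \<open>Passes between the charts of \<open>W\<close> and the normal form: applying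
  \<open>\<Phi>\<close> composes the differential \<open>R\<close> with \<open>A\<close>, and
  applying \<open>\<Psi>\<close> recovers \<open>R\<close>. Thus \<open>R\<close> is injective
  exactly when its composition with \<open>A\<close> is.\<close>

lemma bend_h_derivative:
  assumes c: "c \<in> atlas S" and d: "d \<in> atlas W" and p: "p \<in> fst c" "F t p \<in> fst d" "\<iota> p \<in> U"
  defines "R \<equiv> diff_in c d (mpoints S) (F t) p"
    and "A \<equiv> diff_in d (UNIV, id) U \<Phi> (F t p)"
  shows "((\<lambda>y. bend r (pi * t) (1 - t) (h c y)) has_derivative (\<lambda>v. A (R v))) (at (snd c p))"
    and "\<exists>B. \<forall>v. R v = B (A (R v))"
proof -
  let ?N = "V c \<inter> loc_dom c d (mpoints S) (F t)"
  let ?g = "\<lambda>y. bend r (pi * t) (1 - t) (h c y)"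
  have pS: "p \<in> mpoints S" using chart_subset[OF S(1) c] p(1) by blast
  have N: "open ?N" by (intro open_Int open_V c open_loc_dom_F d)
  have x: "snd c p \<in> ?N"
    using p pS by (auto simp: V_def loc_dom_def chart_inv_image[OF S(1) c])
  have on_N: "chart_inv c y \<in> mpoints S \<and> \<iota> (chart_inv c y) \<in> U \<and> F t (chart_inv c y) \<in> fst d" if "y \<in> ?N" for y
    using that chart_inv_mpoints[OF c] by (auto simp: V_def loc_dom_def chart_inv_image[OF S(1) c])
  have g: "?g y = \<Phi> (F t (chart_inv c y))" if "y \<in> ?N" for y
    using on_N[OF that] \<Phi>_F by (simp add: h_def)
  have R: "(loc_rep c d (F t) has_derivative R) (at (snd c p))"
    unfolding R_def by (rule F_has_derivative[OF c d p(1,2)])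
  have rep: "loc_rep c d (F t) y = snd d (F t (chart_inv c y))" for y
    by (simp add: loc_rep_def)
  have FU: "F t p \<in> U" using p F_in_U_iff by simp
  have "((\<lambda>y. \<Phi> (chart_inv d y)) has_derivative A) (at (loc_rep c d (F t) (snd c p)))"
    unfolding A_def rep chart_inv_image[OF S(1) c p(1)] by (rule \<Phi>_has_derivative[OF d p(2) FU])
  from has_derivative_compose[OF R this]
  show gd: "(?g has_derivative (\<lambda>v. A (R v))) (at (snd c p))"
    by (rule has_derivative_transform_within_open[OF _ N x])
      (use on_N in \<open>simp add: rep g chart_inv_image[OF W d]\<close>)
  obtain B where B: "((\<lambda>z. snd d (\<Psi> z)) has_derivative B) (at (?g (snd c p)))"
    using \<Psi>_differentiable[OF d p(2) FU] g[OF x] unfolding differentiable_def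
    by (auto simp: chart_inv_image[OF S(1) c p(1)])
  from has_derivative_compose[OF gd B]
  have "(loc_rep c d (F t) has_derivative (\<lambda>v. B (A (R v)))) (at (snd c p))"
    by (rule has_derivative_transform_within_open[OF _ N x])
      (use on_N F_in_U_iff in \<open>simp add: rep g \<Psi>_\<Phi>\<close>)
  then have "R = (\<lambda>v. B (A (R v)))"
    using has_derivative_unique[OF R] by blast
  then show "\<exists>B. \<forall>v. R v = B (A (R v))"
    by (metis (no_types))
qed

lemma \<iota>_immersiveD:
  assumes "c \<in> atlas S" "d \<in> atlas W" "p \<in> mpoints S" "p \<in> fst c" "\<iota> p \<in> fst d"
  shows "inj (diff_in c d (mpoints S) \<iota> p)"
proof -
  have "p \<in> mpoints S \<inter> fst c \<inter> \<iota> -` fst d" using assms by simp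
  with \<iota>_immersive[unfolded immersive_on_def, rule_format, OF assms(1,2)] show ?thesis .
qed

lemma \<iota>_isotropicD:
  assumes "c \<in> atlas S" "d \<in> atlas W" "p \<in> mpoints S" "p \<in> fst c" "\<iota> p \<in> fst d"
  shows "\<omega> d (\<iota> p) (diff_in c d (mpoints S) \<iota> p u) (diff_in c d (mpoints S) \<iota> p v) = 0"
proof -
  have "p \<in> mpoints S \<inter> fst c \<inter> \<iota> -` fst d" using assms by simp
  with \<iota>_isotropic[unfolded isotropic_on_def, rule_format, OF assms(1,2)] show ?thesis .
qed

text \<open>This is \<open>bend_h_derivative\<close> at time 0, where \<open>F 0\<close> is
  \<open>\<iota>\<close> and \<open>bend\<close> is the identity. Injectivity passes through
  \<open>B\<close>, isotropy through the symplecticity of \<open>\<Phi>\<close>.\<close>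

lemma h_derivative:
  assumes c: "c \<in> atlas S" and p: "p \<in> fst c" "\<iota> p \<in> U"
  shows "\<exists>h'. (h c has_derivative h') (at (snd c p)) \<and> inj h' \<and> (\<forall>u v. omega0 (h' u) (h' v) = 0)"
proof -
  have pS: "p \<in> mpoints S" using chart_subset[OF S(1) c] p(1) by blast
  have F0: "F 0 = \<iota>" by (rule ext) (rule F_0)
  obtain d where d: "d \<in> atlas W" "\<iota> p \<in> fst d"
    using chart_covers[OF W] U_sub p(2) by blast
  define R where "R = diff_in c d (mpoints S) \<iota> p"
  define A where "A = diff_in d (UNIV, id) U \<Phi> (\<iota> p)"
  have hd: "(h c has_derivative (\<lambda>v. A (R v))) (at (snd c p))"
    using bend_h_derivative(1)[OF c d(1) p(1), of 0] d(2) p(2) by (simp add: F0 R_def A_def)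
  obtain B where B: "\<And>v. R v = B (A (R v))"
    using bend_h_derivative(2)[OF c d(1) p(1), of 0] d(2) p(2) unfolding F0 R_def A_def by blast
  have "inj R"
    unfolding R_def by (rule \<iota>_immersiveD[OF c d(1) pS p(1) d(2)])
  then have "inj (\<lambda>v. A (R v))"
    using B by (metis (no_types, lifting) injD injI)
  moreover have "omega0 (A (R u)) (A (R v)) = 0" for u v
    using \<omega>_\<Phi>[OF d(1) p(2) d(2), of "R u" "R v"] \<iota>_isotropicD[OF c d(1) pS p(1) d(2), of u v]
    unfolding A_def R_def by simp
  ultimately show ?thesis using hd by blast
qed

lemma bend_h_derivative_outer:
  assumes c: "c \<in> atlas S" and p: "p \<in> fst c" "\<iota> p \<in> U" "norm (\<Phi> (\<iota> p)) \<ge> r"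
    and h': "(h c has_derivative h') (at (snd c p))"
  shows "((\<lambda>y. bend r k \<tau> (h c y)) has_derivative h') (at (snd c p))"
proof -
  have hp: "h c (snd c p) = \<Phi> (\<iota> p)"
    by (simp add: h_def chart_inv_image[OF S(1) c p(1)])
  consider "norm (\<Phi> (\<iota> p)) = r" | "norm (\<Phi> (\<iota> p)) > r" using p(3) by linarith
  then show ?thesis
  proof cases
    case 1
    have "snd c p \<in> V c"
      using p by (simp add: V_def chart_inv_image[OF S(1) c p(1)])
    then have "\<forall>\<^sub>F y in at (snd c p). y \<in> V c"
      using open_V[OF c] by (intro eventually_at_in_open')
    then have "\<forall>\<^sub>F y in at (snd c p). diag (h c y) \<in> flared r"
      by (rule eventually_mono) (auto simp: V_def h_def intro: \<iota>_flared chart_inv_mpoints[OF c])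
    then show ?thesis
      using 1 by (intro bend_has_derivative_boundary[OF h' r_pos]) (simp_all add: hp)
  next
    case 2
    have "isCont (\<lambda>y. norm (h c y)) (snd c p)"
      using has_derivative_continuous[OF h'] by (intro continuous_intros)
    then have "\<forall>\<^sub>F y in at (snd c p). norm (h c y) > r"
      using 2 by (intro order_tendstoD(1)[of _ "norm (h c (snd c p))"]) (auto simp: isCont_def hp)
    then have "\<forall>\<^sub>F y in at (snd c p). h c y = bend r k \<tau> (h c y)"
      by (rule eventually_mono) (simp add: bend_outside[OF r_pos])
    then show ?thesis
      by (rule has_derivative_transform_eventually[OF h']) (use p(3) in \<open>simp_all add: hp bend_outside[OF r_pos]\<close>)
  qed
qed

text \<open>A point mapped off \<open>U\<close> is mapped off the closed set \<open>core\<close>, so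
  \<open>F t\<close> and \<open>\<iota>\<close> agree near it.\<close>

lemma diff_in_F_outside:
  assumes c: "c \<in> atlas S" and d: "d \<in> atlas W" and p: "p \<in> fst c" "F t p \<in> fst d" "\<iota> p \<notin> U"
  shows "diff_in c d (mpoints S) (F t) p = diff_in c d (mpoints S) \<iota> p"
proof -
  have pS: "p \<in> mpoints S" using chart_subset[OF S(1) c] p(1) by blast
  have F0: "F 0 = \<iota>" by (rule ext) (rule F_0)
  have pF: "F t p = \<iota> p" using p(3) by (simp add: F_def)
  let ?N = "{x \<in> snd c ` fst c. \<iota> (chart_inv c x) \<in> mpoints W - core}"
  have N: "open ?N" "snd c p \<in> ?N"
    using open_\<iota>_preimage[OF c openin_outside] p core_sub \<iota>_in[OF pS]
    by (auto simp: chart_inv_image[OF S(1) c p(1)])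
  have "frechet_derivative (loc_rep c d (F t)) (at (snd c p)) = frechet_derivative (loc_rep c d \<iota>) (at (snd c p))"
    by (rule frechet_derivative_cong_open[OF N]) (auto simp: loc_rep_def F_outside_core)
  then show ?thesis
    using diff_in_open[OF open_loc_dom_F[OF c d, of t] pS p(1,2)]
      diff_in_open[OF open_loc_dom_F[OF c d, of 0] pS p(1)] p(2) by (simp add: F0 pF)
qed

section \<open>Immersion, isotropy and embedding\<close>

text \<open>Off the sphere the rotation has a differentiable inverse, so it keeps derivatives
  injective; on the sphere it does not change the derivative.\<close>

lemma immersive_F: "immersive_on S W (mpoints S) (F t)"
  unfolding immersive_on_def
proof (intro ballI)
  fix c d p assume c: "c \<in> atlas S" and d: "d \<in> atlas W" and p: "p \<in> mpoints S \<inter> fst c \<inter> F t -` fst d"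
  let ?R = "diff_in c d (mpoints S) (F t) p"
  show "inj ?R"
  proof (cases "\<iota> p \<in> U")
    case False
    then have "\<iota> p \<in> fst d" using p by (simp add: F_def)
    then show ?thesis
      using \<iota>_immersiveD[OF c d, of p] p False diff_in_F_outside[OF c d, of p t] by simp
  next
    case True
    have hp: "h c (snd c p) = \<Phi> (\<iota> p)"
      using p by (simp add: h_def chart_inv_image[OF S(1) c])
    have pc: "p \<in> fst c" using p by simp
    obtain h' where h': "(h c has_derivative h') (at (snd c p))" "inj h'"
      using h_derivative[OF c pc True] by blast
    let ?A = "diff_in d (UNIV, id) U \<Phi> (F t p)"
    have g: "((\<lambda>y. bend r (pi * t) (1 - t) (h c y)) has_derivative (\<lambda>v. ?A (?R v))) (at (snd c p))"
      by (rule bend_h_derivative(1)[OF c d _ _ True]) (use p in auto)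
    have "inj (\<lambda>v. ?A (?R v))"
    proof (cases "norm (\<Phi> (\<iota> p)) = r")
      case False
      have "h c (snd c p) \<noteq> 0"
        unfolding hp using \<iota>_flared[OF _ True] flared_nonzero p by blast
      then show ?thesis
        using False by (intro bend_derivative_inj[OF h' g r_pos]) (simp_all add: hp)
    next
      case eq: True
      have "((\<lambda>y. bend r (pi * t) (1 - t) (h c y)) has_derivative h') (at (snd c p))"
        by (rule bend_h_derivative_outer[OF c _ True _ h'(1)]) (use p eq in auto)
      then have "h' = (\<lambda>v. ?A (?R v))"
        using has_derivative_unique g by blast
      then show ?thesis using h'(2) by simp
    qed
    then show ?thesis by (metis (no_types, lifting) injD injI)
  qed
qed

text \<open>Inside the ball the moment map argument applies; on and beyond the sphere the
  differential in normal form coordinates is that of \<open>\<iota>\<close>, which is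
  isotropic.\<close>

lemma isotropic_F_1: "isotropic_on S W \<omega> (mpoints S) (F 1)"
  unfolding isotropic_on_def
proof (intro ballI allI)
  fix c d p u v assume c: "c \<in> atlas S" and d: "d \<in> atlas W" and p: "p \<in> mpoints S \<inter> fst c \<inter> F 1 -` fst d"
  let ?R = "diff_in c d (mpoints S) (F 1) p"
  show "\<omega> d (F 1 p) (?R u) (?R v) = 0"
  proof (cases "\<iota> p \<in> U")
    case False
    then have "\<iota> p \<in> fst d" "F 1 p = \<iota> p" using p by (simp_all add: F_def)
    then show ?thesis
      using \<iota>_isotropicD[OF c d, of p] p False diff_in_F_outside[OF c d, of p 1] by simp
  next
    case True
    have hp: "h c (snd c p) = \<Phi> (\<iota> p)"
      using p by (simp add: h_def chart_inv_image[OF S(1) c])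
    have pc: "p \<in> fst c" using p by simp
    obtain h' where h': "(h c has_derivative h') (at (snd c p))" "\<And>u v. omega0 (h' u) (h' v) = 0"
      using h_derivative[OF c pc True] by blast
    let ?A = "diff_in d (UNIV, id) U \<Phi> (F 1 p)"
    have "((\<lambda>y. bend r (pi * 1) (1 - 1) (h c y)) has_derivative (\<lambda>v. ?A (?R v))) (at (snd c p))"
      by (rule bend_h_derivative(1)[OF c d _ _ True]) (use p in auto)
    then have g: "((\<lambda>y. bend r pi 0 (h c y)) has_derivative (\<lambda>v. ?A (?R v))) (at (snd c p))"
      by simp
    have "omega0 (?A (?R u)) (?A (?R v)) = 0"
    proof (cases "norm (\<Phi> (\<iota> p)) < r")
      case lt: True
      show ?thesis
      proof (rule bend_pi_isotropic[OF h' g])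
        show "norm (h c (snd c p)) < r" using lt by (simp add: hp)
        show "h c (snd c p) \<noteq> 0"
          unfolding hp using \<iota>_flared[OF _ True] flared_nonzero p by blast
        \<comment> \<open>Nearby points stay in the open ball, hence on the annulus, so the moment
          map is 0 on a whole neighbourhood and can be differentiated.\<close>
        have "isCont (\<lambda>y. norm (h c y)) (snd c p)"
          using has_derivative_continuous[OF h'(1)] by (intro continuous_intros)
        then have "\<forall>\<^sub>F y in nhds (snd c p). norm (h c y) < r"
          using lt by (intro order_tendstoD(2)[of _ "norm (h c (snd c p))"])
            (auto simp: continuous_at_imp_continuous_at_within isCont_def tendsto_nhds_iff hp)
        moreover have "snd c p \<in> V c"
          using p True by (auto simp: V_def chart_inv_image[OF S(1) c])
        then have "\<forall>\<^sub>F y in nhds (snd c p). y \<in> V c"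
          using open_V[OF c] by (intro eventually_nhds_in_open)
        ultimately show "\<forall>\<^sub>F y in nhds (snd c p). Im (fst (diag (h c y)) * cnj (snd (diag (h c y)))) = 0"
        proof eventually_elim
          case (elim y)
          then have "h c y \<in> Orb (gamma r)"
            unfolding h_def by (intro on_annulus) (auto simp: V_def h_def intro: chart_inv_mpoints[OF c])
          then show ?case by (rule Orb_gamma_flared(3)[OF _ r_pos])
        qed
      qed
    next
      case False
      have "((\<lambda>y. bend r pi 0 (h c y)) has_derivative h') (at (snd c p))"
        by (rule bend_h_derivative_outer[OF c _ True _ h'(1)]) (use p False in auto)
      then have "h' = (\<lambda>v. ?A (?R v))"
        using has_derivative_unique g by blast
      then show ?thesis using h'(2)[of u v] by simp
    qed
    moreover have "F 1 p \<in> U" using True F_in_U_iff by simp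
    ultimately show ?thesis
      using \<omega>_\<Phi>[OF d, of "F 1 p" "?R u" "?R v"] p by simp
  qed
qed

text \<open>From a compact space into a Hausdorff one, a continuous injection is an embedding.
  Injectivity is inherited from \<open>\<iota>\<close> because \<open>bend\<close> is injective,
  \<open>\<Phi>\<close> is so on \<open>U\<close>, and \<open>F t\<close> mixes neither
  \<open>U\<close> nor its complement.\<close>

lemma embedding_F:
  assumes "embedding_map (mtop S) (mtop W) \<iota>"
  shows "embedding_map (mtop S) (mtop W) (F t)"
proof (rule injective_closed_imp_embedding_map[OF continuous_F_t])
  show "closed_map (mtop S) (mtop W) (F t)"
    using W by (intro continuous_imp_closed_map continuous_F_t S) (simp add: smooth_manifold_def)
  show "inj_on (F t) (mpoints S)"
  proof (rule inj_onI)
    fix p q assume pq: "p \<in> mpoints S" "q \<in> mpoints S" "F t p = F t q"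
    have "\<iota> p = \<iota> q"
    proof (cases "\<iota> p \<in> U")
      case True
      then have "\<iota> q \<in> U" using pq(3) F_in_U_iff by metis
      then have "bend r (pi * t) (1 - t) (\<Phi> (\<iota> p)) = bend r (pi * t) (1 - t) (\<Phi> (\<iota> q))"
        using \<Phi>_F[OF True, of t] \<Phi>_F[of q t] pq(3) by simp
      then have "\<Phi> (\<iota> p) = \<Phi> (\<iota> q)"
        using inj_bend injD by metis
      then show ?thesis
        using True \<open>\<iota> q \<in> U\<close> inj_\<Phi> by (auto dest: inj_onD)
    next
      case False
      then have "\<iota> q \<notin> U" using pq(3) F_in_U_iff by metis
      then show ?thesis using False pq(3) by (simp add: F_def)
    qed
    moreover have "inj_on \<iota> (mpoints S)"
      using assms homeomorphic_imp_injective_map unfolding embedding_map_def by blast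
    ultimately show "p = q" using pq by (auto dest: inj_onD)
  qed
qed

section \<open>Identification of the result\<close>

text \<open>The part of the surface in the closed ball is exactly the annulus, and
  \<open>bend r pi 0\<close> carries it onto the new annulus; the rest is outside the ball or off
  \<open>U\<close> and stays fixed.\<close>

lemma image_F_1: "F 1 ` mpoints S = la_surgery U \<Phi> r (\<iota> ` mpoints S)"
proof (intro equalityI subsetI)
  fix q assume "q \<in> F 1 ` mpoints S"
  then obtain p where p: "p \<in> mpoints S" "q = F 1 p" by auto
  show "q \<in> la_surgery U \<Phi> r (\<iota> ` mpoints S)"
  proof (cases "\<iota> p \<in> U \<and> \<Phi> (\<iota> p) \<in> Orb (gamma r)")
    case True
    then have "\<Phi> q \<in> bend r pi 0 ` Orb (gamma r)" "q \<in> U"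
      using \<Phi>_F[of p 1] p F_in_U_iff by auto
    then show ?thesis
      unfolding la_surgery_def bend_pi_image_Orb[OF r_pos] by blast
  next
    case False
    have "q = \<iota> p"
    proof (cases "\<iota> p \<in> U")
      case True
      then have "norm (\<Phi> (\<iota> p)) > r"
        using False on_annulus[OF p(1)] by force
      then show ?thesis
        using True p(2) by (simp add: F_def bend_outside[OF r_pos] \<Psi>_\<Phi>)
    qed (simp add: p F_def)
    then show ?thesis
      unfolding la_surgery_def using False p by blast
  qed
next
  fix q assume "q \<in> la_surgery U \<Phi> r (\<iota> ` mpoints S)"
  then consider p where "p \<in> mpoints S" "q = \<iota> p" "\<not> (\<iota> p \<in> U \<and> \<Phi> (\<iota> p) \<in> Orb (gamma r))"
    | "q \<in> U" "\<Phi> q \<in> Orb (swap_xy ` gamma r)"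
    unfolding la_surgery_def by blast
  then show "q \<in> F 1 ` mpoints S"
  proof cases
    case 1
    have "F 1 p = q"
    proof (cases "\<iota> p \<in> U")
      case True
      then have "norm (\<Phi> (\<iota> p)) > r"
        using 1 on_annulus[of p] by force
      then show ?thesis
        using True 1 by (simp add: F_def bend_outside[OF r_pos] \<Psi>_\<Phi>)
    qed (simp add: 1 F_def)
    then show ?thesis using 1 by blast
  next
    case 2
    then obtain z where z: "z \<in> Orb (gamma r)" "\<Phi> q = bend r pi 0 z"
      unfolding bend_pi_image_Orb[OF r_pos, symmetric] by blast
    then obtain p where p: "p \<in> mpoints S" "\<iota> p \<in> U" "\<Phi> (\<iota> p) = z"
      unfolding annulus[symmetric] by blast
    have "\<Phi> (F 1 p) = \<Phi> q"
      using \<Phi>_F[OF p(2), of 1] z p by simp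
    then have "F 1 p = q"
      using 2 p F_in_U_iff[of 1 p] inj_\<Phi> by (auto dest: inj_onD)
    then show ?thesis using p by blast
  qed
qed

text \<open>Points of the surface on the sphere lie on the first annulus, hence on both by
  \<open>Orb_boundary\<close>, that is, on the seam.\<close>

lemma off_seam:
  assumes "p \<in> mpoints S" "\<iota> p \<notin> seam U \<Phi> r" "\<iota> p \<in> U"
  shows "norm (\<Phi> (\<iota> p)) \<noteq> r"
proof
  assume eq: "norm (\<Phi> (\<iota> p)) = r"
  then have "\<Phi> (\<iota> p) \<in> Orb (gamma r)"
    using on_annulus assms by simp
  then show False
    using Orb_boundary[OF r_pos eq] assms by (simp add: seam_def)
qed

lemma lagrangian_F_1: "lagrangian_surface {p. \<iota> p \<in> seam U \<Phi> r} S W \<omega> (F 1)"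
  unfolding lagrangian_surface_def
proof (intro conjI S ck_on_1_F immersive_F isotropic_F_1)
  let ?E = "{p. \<iota> p \<in> seam U \<Phi> r}"
  show "ck_on \<infinity> S W (mpoints S - ?E) (F 1)"
    by (rule ck_on_slice[OF S(1) _ _ continuous_F ck_infinity_F, of _ _ "UNIV \<times> (mpoints S - ?E)"])
      (auto dest: off_seam)
qed

lemma isotopic_F: "smoothly_isotopic ({1} \<times> {p. \<iota> p \<in> seam U \<Phi> r}) S W \<iota> (F 1)"
  unfolding smoothly_isotopic_def
proof (intro exI[of _ F] conjI ballI impI)
  let ?E = "{p. \<iota> p \<in> seam U \<Phi> r}"
  show "ck_on 1 (prod_mfd eucl_mfd S) W ({0..1} \<times> mpoints S) (\<lambda>(t, p). F t p)"
    by (rule ck_on_product_line[OF S(1) _ continuous_F ck_1_F]) auto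
  show "ck_on \<infinity> (prod_mfd eucl_mfd S) W ({0..1} \<times> mpoints S - {1} \<times> ?E) (\<lambda>(t, p). F t p)"
    by (rule ck_on_product_line[OF S(1) _ continuous_F ck_infinity_F]) (auto dest: off_seam)
qed (simp_all add: F_0 immersive_F embedding_F)

end

theorem proposition2p3p1:
  fixes W :: "('w, R4) manifold" and \<omega> :: "('w, R4) two_form"
    and S :: "('s, R2) manifold" and \<iota> :: "'s \<Rightarrow> 'w"
    and D U :: "'w set" and \<Phi> :: "'w \<Rightarrow> R4" and r :: real
  defines "L \<equiv> \<iota> ` mpoints S"
    and "E \<equiv> {p. \<iota> p \<in> seam U \<Phi> r}"
  assumes "symplectic_4_manifold W \<omega>"
    and "lagrangian_surface {} S W \<omega> \<iota>"
    and "la_disk S W \<omega> \<iota> D"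
    and "la_nbhd W \<omega> L D U \<Phi> r"
  shows "\<exists>j. j ` mpoints S = la_surgery U \<Phi> r L \<and>
             lagrangian_surface E S W \<omega> j \<and>
             smoothly_isotopic ({1} \<times> E) S W \<iota> j"
proof -
  interpret surgery W \<omega> S \<iota> D U \<Phi> r
    using assms(3,4,6) by unfold_locales (simp_all add: symplectic_4_manifold_def L_def)
  \<comment> \<open>The new immersion is the final stage \<open>F 1\<close>.\<close>
  show ?thesis
    unfolding L_def E_def using image_F_1 lagrangian_F_1 isotopic_F by blast
qed

end
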